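(* Let $p>1$. There is a constant $C$ depending only on $p$ such that, for every solution $(A,\phi)$ of the Chern-Simons-Higgs Cauchy problem (described in the context) on $[0,\infty)\times\mathbb{R}^2$ with power $p$ and finite initial conformal energy $\mathcal{E}_{0,2}<\infty$, $$\int_{\mathbb{R}^2}|\phi(t,x)|^{p+1}\,dx\le C\,\mathcal{E}_{0,2}\,(1+t)^{-\min\{\frac{p-1}{2},\,2\}},\qquad \forall t\ge 0.$$
   Context: Coordinates on $\mathbb{R}^{1+2}$ are $(t,x)=(x_0,x_1,x_2)$, with Minkowski metric $m=\mathrm{diag}\{-1,1,1\}$ used to raise and lower indices; Greek indices run over $0,1,2$ and repeated indices are summed; $\partial_0=\partial_t$. $A=(A_0,A_1,A_2)$ is a real-valued 1-form, $\phi$ is a complex-valued function, $D_\mu=\partial_\mu+iA_\mu$, and $F_{\mu\nu}=-i[D_\mu,D_\nu]=\partial_\mu A_\nu-\partial_\nu A_\mu$. The Chern-Simons-Higgs system with power $p>1$ is $$D^\mu D_\mu\phi=|\phi|^{p-1}\phi,\qquad F_{\mu\nu}=\varepsilon_{\mu\nu\gamma}J^\gamma[\phi],\qquad J_\gamma[\phi]=\Im(\phi\cdot\overline{D_\gamma\phi}),$$ with initial data $\phi(0,x)=\phi_0(x)$, $D_0\phi(0,x)=\phi_1(x)$, where $\varepsilon_{\mu\nu\gamma}$ is totally antisymmetric with $\varepsilon_{012}=1$. The system is gauge invariant, and solutions are considered up to gauge. For $0\le\gamma\le 2$ define the gauge invariant weighted energy of the data $$\mathcal{E}_{k,\gamma}=\sum_{l\le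 k}\int_{\mathbb{R}^2}(1+|x|)^{\gamma+2l}\big(|\bar D^{l+1}\phi_0|^2+|\bar D^l\phi_1|^2\big)\,dx+\int_{\mathbb{R}^2}(1+|x|)^\gamma|\phi_0|^{p+1}\,dx,$$ where $\bar D=(D_1,D_2)$ is taken with respect to the connection $A$ on $\{t=0\}$ (in any gauge; its curvature $F_{12}$ at $t=0$ is determined by $\phi_0,\phi_1$ through the system). Solutions are understood to be global, sufficiently regular, and decaying sufficiently fast at spatial infinity that the energy identities (integrations by parts) are valid. *)

theory Defs
  imports "HOL-Analysis.Analysis"
begin

text \<open>
  Spacetime is \<open>real^3\<close>; Greek indices have type \<open>3\<close>, whose elements are \<open>0, 1, 2\<close>
  (with \<open>3 = 0\<close>), and \<open>z $ 0\<close> is the time of \<open>z\<close>. Space is \<open>real^2\<close>; Latin indices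
  have type \<open>2\<close>, whose elements are \<open>1, 2\<close> (with \<open>2 = 0\<close>).
\<close>

definition event :: "real \<Rightarrow> real^2 \<Rightarrow> real^3" where
  "event t x = (\<chi> \<mu>. if \<mu> = 0 then t else if \<mu> = 1 then x $ 1 else x $ 2)"

definition spacetime_index :: "2 \<Rightarrow> 3" where
  "spacetime_index i = (if i = 1 then 1 else 2)"

definition future :: "(real^3) set" where
  "future = {z. 0 \<le> z $ 0}"

text \<open>The derivative is taken within \<^const>\<open>future\<close>, hence one-sided in time at \<open>t = 0\<close>.\<close>

definition partial :: "3 \<Rightarrow> (real^3 \<Rightarrow> 'a::real_normed_vector) \<Rightarrow> real^3 \<Rightarrow> 'a" where
  "partial \<mu> f z = frechet_derivative f (at z within future) (axis \<mu> 1)"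

definition C1_future :: "(real^3 \<Rightarrow> 'a::real_normed_vector) \<Rightarrow> bool" where
  "C1_future f \<longleftrightarrow> f differentiable_on future \<and> (\<forall>\<mu>. continuous_on future (partial \<mu> f))"

definition C2_future :: "(real^3 \<Rightarrow> 'a::real_normed_vector) \<Rightarrow> bool" where
  "C2_future f \<longleftrightarrow> C1_future f \<and> (\<forall>\<mu>. C1_future (partial \<mu> f))"

text \<open>The matrix of \<open>m\<close> is its own inverse, so it also raises indices.\<close>

definition minkowski :: "3 \<Rightarrow> 3 \<Rightarrow> real" where
  "minkowski \<mu> \<nu> = (if \<mu> \<noteq> \<nu> then 0 else if \<mu> = 0 then - 1 else 1)"

definition levi_civita :: "3 \<Rightarrow> 3 \<Rightarrow> 3 \<Rightarrow> real" where
  "levi_civita \<mu> \<nu> \<gamma> =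
    (if (\<mu>, \<nu>, \<gamma>) \<in> {(0, 1, 2), (1, 2, 0), (2, 0, 1)} then 1
     else if (\<mu>, \<nu>, \<gamma>) \<in> {(0, 2, 1), (2, 1, 0), (1, 0, 2)} then - 1
     else 0)"

type_synonym connection = "3 \<Rightarrow> real^3 \<Rightarrow> real"

definition cov :: "connection \<Rightarrow> 3 \<Rightarrow> (real^3 \<Rightarrow> complex) \<Rightarrow> real^3 \<Rightarrow> complex" where
  "cov A \<mu> f z = partial \<mu> f z + \<i> * of_real (A \<mu> z) * f z"

definition curvature :: "connection \<Rightarrow> 3 \<Rightarrow> 3 \<Rightarrow> real^3 \<Rightarrow> real" where
  "curvature A \<mu> \<nu> z = partial \<mu> (A \<nu>) z - partial \<nu> (A \<mu>) z"

definition current :: "connection \<Rightarrow> (real^3 \<Rightarrow> complex) \<Rightarrow> 3 \<Rightarrow> real^3 \<Rightarrow> real" where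
  "current A \<phi> \<gamma> z = Im (\<phi> z * cnj (cov A \<gamma> \<phi> z))"

definition cov_box :: "connection \<Rightarrow> (real^3 \<Rightarrow> complex) \<Rightarrow> real^3 \<Rightarrow> complex" where
  "cov_box A \<phi> z =
    (\<Sum>\<mu>\<in>UNIV. \<Sum>\<nu>\<in>UNIV. of_real (minkowski \<mu> \<nu>) * cov A \<mu> (cov A \<nu> \<phi>) z)"

definition CSH_equations :: "real \<Rightarrow> connection \<Rightarrow> (real^3 \<Rightarrow> complex) \<Rightarrow> bool" where
  "CSH_equations p A \<phi> \<longleftrightarrow>
    (\<forall>z\<in>future.
       cov_box A \<phi> z = of_real (norm (\<phi> z) powr (p - 1)) * \<phi> z \<and>
       (\<forall>\<mu> \<nu>. curvature A \<mu> \<nu> z =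
          (\<Sum>\<gamma>\<in>UNIV. \<Sum>\<delta>\<in>UNIV.
             levi_civita \<mu> \<nu> \<gamma> * minkowski \<gamma> \<delta> * current A \<phi> \<delta> z)))"

text \<open>
  For \<open>t \<le> T\<close> the spatial flux of the energy and conformal energy currents is
  bounded by a constant times \<open>flux_density\<close>. The decay condition says that the
  flux through the cylinder \<open>{0..T} \<times> {|x| = \<rho>}\<close>, averaged over \<open>\<rho> \<in> {R..2*R}\<close>,
  vanishes as \<open>R \<rightarrow> \<infinity>\<close>, so that integrations by parts leave no boundary
  term at spatial infinity. It holds, for example, if \<open>|D\<phi>| = o(|x| powr (-3/2))\<close>,
  \<open>|\<phi>| = o(|x| powr (-1/2))\<close> and \<open>|\<phi>| powr (p + 1) = o(|x| powr (-3))\<close>, uniformly for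
  \<open>t\<close> in compact intervals. Only gauge invariant quantities are involved.
\<close>

definition flux_density :: "real \<Rightarrow> connection \<Rightarrow> (real^3 \<Rightarrow> complex) \<Rightarrow> real \<Rightarrow> real^2 \<Rightarrow> real" where
  "flux_density p A \<phi> t x =
    (1 + norm x)\<^sup>2 *
      ((\<Sum>\<mu>\<in>UNIV. (norm (cov A \<mu> \<phi> (event t x)))\<^sup>2) + norm (\<phi> (event t x)) powr (p + 1)) +
    (norm (\<phi> (event t x)))\<^sup>2"

definition decays_at_spatial_infinity :: "real \<Rightarrow> connection \<Rightarrow> (real^3 \<Rightarrow> complex) \<Rightarrow> bool" where
  "decays_at_spatial_infinity p A \<phi> \<longleftrightarrow>
    (\<forall>T>0. ((\<lambda>R::real. (\<integral>\<^sup>+t\<in>{0..T}. (\<integral>\<^sup>+x\<in>{x. R \<le> norm x \<and> norm x \<le> 2 * R}.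
        ennreal (flux_density p A \<phi> t x) \<partial>lborel) \<partial>lborel) / ennreal R) \<longlongrightarrow> 0) at_top)"

definition CSH_solution :: "real \<Rightarrow> connection \<Rightarrow> (real^3 \<Rightarrow> complex) \<Rightarrow> bool" where
  "CSH_solution p A \<phi> \<longleftrightarrow>
    (\<forall>\<mu>. C1_future (A \<mu>)) \<and> C2_future \<phi> \<and> CSH_equations p A \<phi> \<and>
    decays_at_spatial_infinity p A \<phi>"

definition has_initial_data ::
  "connection \<Rightarrow> (real^3 \<Rightarrow> complex) \<Rightarrow> (real^2 \<Rightarrow> complex) \<Rightarrow> (real^2 \<Rightarrow> complex) \<Rightarrow> bool" where
  "has_initial_data A \<phi> \<phi>\<^sub>0 \<phi>\<^sub>1 \<longleftrightarrow>
    (\<forall>x. \<phi> (event 0 x) = \<phi>\<^sub>0 x \<and> cov A 0 \<phi> (event 0 x) = \<phi>\<^sub>1 x)"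

type_synonym space_connection = "2 \<Rightarrow> real^2 \<Rightarrow> real"

definition initial_connection :: "connection \<Rightarrow> space_connection" where
  "initial_connection A i x = A (spacetime_index i) (event 0 x)"

definition space_cov :: "space_connection \<Rightarrow> 2 \<Rightarrow> (real^2 \<Rightarrow> complex) \<Rightarrow> real^2 \<Rightarrow> complex" where
  "space_cov a i f x = frechet_derivative f (at x) (axis i 1) + \<i> * of_real (a i x) * f x"

text \<open>\<open>|D^l f|^2\<close> for the spatial covariant derivative: the sum of the squares of all
  components \<open>D_i1 ... D_il f\<close>.\<close>

primrec space_cov_sq :: "space_connection \<Rightarrow> nat \<Rightarrow> (real^2 \<Rightarrow> complex) \<Rightarrow> real^2 \<Rightarrow> real" where
  "space_cov_sq a 0 f x = (norm (f x))\<^sup>2"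
| "space_cov_sq a (Suc l) f x = (\<Sum>i\<in>UNIV. space_cov_sq a l (space_cov a i f) x)"

definition weighted_energy ::
  "real \<Rightarrow> nat \<Rightarrow> real \<Rightarrow> space_connection \<Rightarrow> (real^2 \<Rightarrow> complex) \<Rightarrow> (real^2 \<Rightarrow> complex) \<Rightarrow> ennreal" where
  "weighted_energy p k \<gamma> a \<phi>\<^sub>0 \<phi>\<^sub>1 =
    (\<Sum>l\<le>k. \<integral>\<^sup>+x. ennreal ((1 + norm x) powr (\<gamma> + 2 * real l) *
        (space_cov_sq a (Suc l) \<phi>\<^sub>0 x + space_cov_sq a l \<phi>\<^sub>1 x)) \<partial>lborel) +
    (\<integral>\<^sup>+x. ennreal ((1 + norm x) powr \<gamma> * norm (\<phi>\<^sub>0 x) powr (p + 1)) \<partial>lborel)"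

end

theory Submission
  imports Defs
begin

text \<open>
  Let \<open>Q = |\<phi>|^{p+1} / (p + 1)\<close>, \<open>y = x_2\<close> and \<open>u = t - \<sigma> x_1\<close> with \<open>\<sigma> = 1\<close> or \<open>\<sigma> = - 1\<close>. The planes
  \<open>u = const\<close> are null. The proof uses the conformal Killing field
  \<open>K = (1 + u^2) (\<partial>_t - \<sigma> \<partial>_1) + 2 u y \<partial>_2 + y^2 (\<partial>_t + \<sigma> \<partial>_1)\<close> as a multiplier. The energy-momentum
  tensor of a solution is divergence free, since the gauge field enters its divergence through
  \<open>F_{\<mu>\<nu>} J^\<mu>\<close> only, and this vanishes when \<open>F\<close> is the dual of \<open>J\<close>. With the appropriate lower
  order terms, \<open>K\<close> yields a current \<open>C\<close> (\<open>conformal_current\<close>) with the following properties: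
  its divergence is \<open>(5 - p) u Q\<close> (\<open>divergence_conformal_current\<close>), its density is a sum of squares plus
  \<open>(1 + u^2 + y^2) Q\<close>, and its flux through the planes \<open>u = const\<close> is a sum of squares plus
  \<open>2 (1 + u^2) Q\<close>.

  If \<open>p \<ge> 5\<close>, the currents for \<open>\<sigma> = 1\<close> and \<open>\<sigma> = - 1\<close> are added. The divergence of the sum is
  \<open>2 (5 - p) t Q \<le> 0\<close>, and the density is at least \<open>(1 + t^2) Q\<close>, which gives decay like \<open>t^{-2}\<close>
  (\<open>potential_decay_superconformal\<close>). If \<open>p < 5\<close>, the same sum and Gronwall's inequality would only
  give \<open>t^{3-p}\<close>. Instead \<open>C\<close> is multiplied by a function of \<open>u\<close> that equals \<open>1\<close> for \<open>u \<le> 0\<close> and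
  \<open>(1 + u^2) powr (- (5 - p) / 4)\<close> for \<open>u \<ge> 0\<close>. Its decrease brings in the flux through the null
  planes, which absorbs the divergence where \<open>u > 0\<close>; where \<open>u \<le> 0\<close> the divergence is nonpositive
  already. On the half plane \<open>\<sigma> x_1 \<le> 0\<close>, where \<open>u \<ge> t\<close>, the new density still
  controls \<open>(1 + t^2) powr ((p - 1) / 4) Q\<close>. The two signs of \<open>\<sigma>\<close> together cover the plane
  (\<open>potential_decay_subconformal\<close>, \<open>potential_decay\<close>).

  Two facts turn the nonpositive divergence into the estimate. The integral of the density at time \<open>t\<close>
  is at most that at time zero (\<open>current_inequality\<close>): this is the divergence theorem with a cutoff
  in space, whose error is the averaged flux that is assumed to vanish at infinity. At time zero the
  density is bounded by the density of the conformal energy plus \<open>|\<phi>|^2\<close>, and the integral of \<open>|\<phi>|^2\<close> is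
  bounded by a Hardy inequality (\<open>hardy_inequality\<close>), which holds in the plane because
  \<open>|\<phi>|^{p+1}\<close> is integrable.
\<close>

section \<open>Calculus on the half space of nonnegative times\<close>

text \<open>
  The derivative within \<open>future\<close> is unique even at a boundary point: every coordinate
  line through the point meets \<open>future\<close> arbitrarily close to it. All rules of calculus
  for \<open>partial\<close> are read off from Frechet derivatives in this way.
\<close>

lemma partial_eqI:
  fixes f :: "real^3 \<Rightarrow> 'a::real_normed_vector"
  assumes z: "z \<in> future" and D: "(f has_derivative D) (at z within future)"
  shows "partial \<mu> f z = D (axis \<mu> 1)"
proof -
  have "(f has_derivative frechet_derivative f (at z within future)) (at z within future)"
    using D differentiable_def frechet_derivative_works by blast
  moreover have "\<exists>d. 0 < \<bar>d\<bar> \<and> \<bar>d\<bar> < e \<and> z + d *\<^sub>R i \<in> future"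
    if "i \<in> Basis" "0 < e" for i and e :: real
  proof (intro exI conjI)
    obtain \<nu> where "i = axis \<nu> 1" using \<open>i \<in> Basis\<close> by (auto simp: Basis_vec_def)
    then show "z + (e / 2) *\<^sub>R i \<in> future"
      using z \<open>0 < e\<close> by (auto simp: future_def axis_def)
  qed (use \<open>0 < e\<close> in auto)
  ultimately have "frechet_derivative f (at z within future) = D"
    using D frechet_derivative_unique_within[of f "frechet_derivative f (at z within future)" z future D]
    by blast
  then show ?thesis by (simp add: partial_def)
qed

lemma C1_future_has_derivative:
  assumes "C1_future f" "z \<in> future"
  shows "(f has_derivative frechet_derivative f (at z within future)) (at z within future)"
  using assms by (simp add: C1_future_def differentiable_on_def frechet_derivative_works)

lemma has_derivative_imp_C1_future:
  fixes f :: "real^3 \<Rightarrow> 'a::real_normed_vector"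
  assumes D: "\<And>z. z \<in> future \<Longrightarrow> (f has_derivative D z) (at z within future)"
    and cont: "\<And>\<mu>. continuous_on future (\<lambda>z. D z (axis \<mu> 1))"
  shows "C1_future f"
  unfolding C1_future_def
proof (intro conjI allI)
  show "f differentiable_on future"
    using D by (auto simp: differentiable_on_def differentiable_def)
  show "continuous_on future (partial \<mu> f)" for \<mu>
    using cont[of \<mu>] by (rule continuous_on_eq) (use partial_eqI[OF _ D] in auto)
qed

lemma C1_future_continuous: "C1_future f \<Longrightarrow> continuous_on future f"
  by (simp add: C1_future_def differentiable_imp_continuous_on)

lemma C1_future_continuous_partial: "C1_future f \<Longrightarrow> continuous_on future (partial \<mu> f)"
  by (simp add: C1_future_def)

lemma C1_future_const [simp]: "C1_future (\<lambda>z. c)"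
  by (rule has_derivative_imp_C1_future[where D = "\<lambda>z h. 0"]) auto

lemma partial_const [simp]: "z \<in> future \<Longrightarrow> partial \<mu> (\<lambda>z. c) z = 0"
  by (rule partial_eqI[where D = "\<lambda>h. 0"]) auto

lemma bounded_linear_C1_future:
  assumes L: "bounded_linear L" and f: "C1_future f"
  shows "C1_future (\<lambda>z. L (f z))"
proof (rule has_derivative_imp_C1_future)
  show "((\<lambda>z. L (f z)) has_derivative (\<lambda>h. L (frechet_derivative f (at z within future) h)))
      (at z within future)" if "z \<in> future" for z
    by (rule bounded_linear.has_derivative[OF L C1_future_has_derivative[OF f that]])
  show "continuous_on future (\<lambda>z. L (frechet_derivative f (at z within future) (axis \<mu> 1)))" for \<mu>
    using bounded_linear.continuous_on[OF L C1_future_continuous_partial[OF f, of \<mu>]]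
    by (simp add: partial_def)
qed

lemma bounded_linear_partial:
  assumes L: "bounded_linear L" and f: "C1_future f" and z: "z \<in> future"
  shows "partial \<mu> (\<lambda>z. L (f z)) z = L (partial \<mu> f z)"
  using partial_eqI[OF z bounded_linear.has_derivative[OF L C1_future_has_derivative[OF f z]]]
  by (simp add: partial_def)

lemma bounded_bilinear_C1_future:
  assumes B: "bounded_bilinear B" and f: "C1_future f" and g: "C1_future g"
  shows "C1_future (\<lambda>z. B (f z) (g z))"
proof (rule has_derivative_imp_C1_future)
  show "((\<lambda>z. B (f z) (g z)) has_derivative
      (\<lambda>h. B (f z) (frechet_derivative g (at z within future) h) +
           B (frechet_derivative f (at z within future) h) (g z))) (at z within future)"
    if "z \<in> future" for z
    by (rule bounded_bilinear.FDERIV[OF B C1_future_has_derivative[OF f that] C1_future_has_derivative[OF g that]])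
  show "continuous_on future (\<lambda>z. B (f z) (frechet_derivative g (at z within future) (axis \<mu> 1)) +
           B (frechet_derivative f (at z within future) (axis \<mu> 1)) (g z))" for \<mu>
    using C1_future_continuous[OF f] C1_future_continuous[OF g]
      C1_future_continuous_partial[OF f, of \<mu>] C1_future_continuous_partial[OF g, of \<mu>]
    unfolding partial_def
    by (intro continuous_on_add bounded_bilinear.continuous_on[OF B])
qed

lemma bounded_bilinear_partial:
  assumes B: "bounded_bilinear B" and f: "C1_future f" and g: "C1_future g" and z: "z \<in> future"
  shows "partial \<mu> (\<lambda>z. B (f z) (g z)) z = B (f z) (partial \<mu> g z) + B (partial \<mu> f z) (g z)"
  using partial_eqI[OF z bounded_bilinear.FDERIV[OF B C1_future_has_derivative[OF f z] C1_future_has_derivative[OF g z]]]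
  by (simp add: partial_def)

lemma C1_future_add:
  assumes "C1_future f" "C1_future g"
  shows "C1_future (\<lambda>z. f z + g z)"
proof (rule has_derivative_imp_C1_future)
  show "((\<lambda>z. f z + g z) has_derivative (\<lambda>h. frechet_derivative f (at z within future) h +
      frechet_derivative g (at z within future) h)) (at z within future)" if "z \<in> future" for z
    using assms that by (intro has_derivative_add C1_future_has_derivative)
  show "continuous_on future (\<lambda>z. frechet_derivative f (at z within future) (axis \<mu> 1) +
      frechet_derivative g (at z within future) (axis \<mu> 1))" for \<mu>
    using C1_future_continuous_partial[OF assms(1), of \<mu>] C1_future_continuous_partial[OF assms(2), of \<mu>]
    unfolding partial_def by (intro continuous_on_add)
qed

lemma partial_add:
  assumes "C1_future f" "C1_future g" "z \<in> future"
  shows "partial \<mu> (\<lambda>z. f z + g z) z = partial \<mu> f z + partial \<mu> g z"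
  using partial_eqI[OF assms(3) has_derivative_add[OF C1_future_has_derivative[OF assms(1,3)]
    C1_future_has_derivative[OF assms(2,3)]]]
  by (simp add: partial_def)

lemma C1_future_minus: "C1_future f \<Longrightarrow> C1_future (\<lambda>z. - f z)"
  by (rule bounded_linear_C1_future[OF bounded_linear_minus[OF bounded_linear_ident]])

lemma partial_minus: "C1_future f \<Longrightarrow> z \<in> future \<Longrightarrow> partial \<mu> (\<lambda>z. - f z) z = - partial \<mu> f z"
  by (rule bounded_linear_partial[OF bounded_linear_minus[OF bounded_linear_ident]])

lemma C1_future_diff: "C1_future f \<Longrightarrow> C1_future g \<Longrightarrow> C1_future (\<lambda>z. f z - g z)"
  using C1_future_add[of f "\<lambda>z. - g z"] C1_future_minus[of g] by simp

lemma partial_diff: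
  "C1_future f \<Longrightarrow> C1_future g \<Longrightarrow> z \<in> future \<Longrightarrow>
    partial \<mu> (\<lambda>z. f z - g z) z = partial \<mu> f z - partial \<mu> g z"
  using partial_add[of f "\<lambda>z. - g z" z \<mu>] by (simp add: C1_future_minus partial_minus)

lemmas C1_future_mult = bounded_bilinear_C1_future[OF bounded_bilinear_mult]
lemmas partial_mult = bounded_bilinear_partial[OF bounded_bilinear_mult]
lemmas C1_future_scaleR = bounded_bilinear_C1_future[OF bounded_bilinear_scaleR]
lemmas partial_scaleR = bounded_bilinear_partial[OF bounded_bilinear_scaleR]
lemmas C1_future_inner = bounded_bilinear_C1_future[OF bounded_bilinear_inner]
lemmas partial_inner = bounded_bilinear_partial[OF bounded_bilinear_inner]

lemma C1_future_coordinate: "C1_future (\<lambda>z. z $ \<nu>)"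
  by (rule has_derivative_imp_C1_future[where D = "\<lambda>z h. h $ \<nu>"])
    (auto intro!: bounded_linear_imp_has_derivative bounded_linear_vec_nth)

lemma partial_coordinate:
  "z \<in> future \<Longrightarrow> partial \<mu> (\<lambda>z. z $ \<nu>) z = (if \<mu> = \<nu> then 1 else 0)"
  by (subst partial_eqI[OF _ bounded_linear_imp_has_derivative[OF bounded_linear_vec_nth]])
    (auto simp: axis_def)

lemma C1_future_compose:
  fixes F :: "'a::real_normed_vector \<Rightarrow> 'b::real_normed_vector"
  assumes F: "\<And>w. (F has_derivative F' w) (at w)" and f: "C1_future f"
    and cont: "\<And>\<mu>. continuous_on future (\<lambda>z. F' (f z) (partial \<mu> f z))"
  shows "C1_future (\<lambda>z. F (f z))"
    and "z \<in> future \<Longrightarrow> partial \<mu> (\<lambda>z. F (f z)) z = F' (f z) (partial \<mu> f z)"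
proof -
  have D: "((\<lambda>z. F (f z)) has_derivative (\<lambda>h. F' (f z) (frechet_derivative f (at z within future) h)))
      (at z within future)" if "z \<in> future" for z
    by (rule has_derivative_compose[OF C1_future_has_derivative[OF f that] F])
  show "C1_future (\<lambda>z. F (f z))"
    using cont D by (intro has_derivative_imp_C1_future) (auto simp: partial_def)
  show "partial \<mu> (\<lambda>z. F (f z)) z = F' (f z) (partial \<mu> f z)" if "z \<in> future"
    using partial_eqI[OF that D[OF that]] by (simp add: partial_def)
qed

text \<open>
  For \<open>q > 1\<close> the function vanishes to higher than first order at the origin, so the zeros
  of the field do no harm. With the convention \<open>0 powr r = 0\<close> the formula for the
  derivative also holds there.
\<close>

lemma has_derivative_norm_powr:
  fixes w :: "'a::real_inner"
  assumes q: "1 < q"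
  shows "((\<lambda>w. norm w powr q) has_derivative (\<lambda>h. q * norm w powr (q - 2) * (w \<bullet> h))) (at w)"
proof (cases "w = 0")
  case True
  have "((\<lambda>y. norm y powr (q - 1)) \<longlongrightarrow> 0) (at (0::'a))"
  proof -
    have "((\<lambda>y::'a. norm y powr (q - 1)) \<longlongrightarrow> norm (0::'a) powr (q - 1)) (at 0)"
      using q by (intro tendsto_intros) (auto intro: tendsto_eq_intros)
    then show ?thesis using q by simp
  qed
  then have "((\<lambda>y::'a. norm (norm y powr q) / norm y) \<longlongrightarrow> 0) (at 0)"
  proof (rule Lim_transform_eventually)
    show "\<forall>\<^sub>F y in at (0::'a). norm y powr (q - 1) = norm (norm y powr q) / norm y"
      by (auto simp: eventually_at_filter powr_diff)
  qed
  then show ?thesis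
    using True q by (simp add: has_derivative_at)
next
  case False
  have "((\<lambda>w. norm w powr q) has_derivative (\<lambda>h. norm w powr q * (0 * ln (norm w) + (h \<bullet> sgn w) * q / norm w))) (at w)"
    using False has_derivative_powr[OF has_derivative_norm[OF False] has_derivative_const[of q "at w"]]
    by (auto simp: inner_commute)
  then show ?thesis
    using False by (auto simp: sgn_div_norm inner_commute powr_diff power2_eq_square field_simps 
        powr_numeral elim!: has_derivative_eq_rhs)
qed

lemma norm_powr_C1_future:
  fixes f :: "real^3 \<Rightarrow> complex"
  assumes q: "2 < q" and f: "C1_future f"
  shows C1_future_norm_powr: "C1_future (\<lambda>z. norm (f z) powr q)"
    and partial_norm_powr: "z \<in> future \<Longrightarrow>
      partial \<mu> (\<lambda>z. norm (f z) powr q) z = q * norm (f z) powr (q - 2) * (f z \<bullet> partial \<mu> f z)"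
proof -
  note D = has_derivative_norm_powr[where q = q and 'a = complex]
  have c: "continuous_on future (\<lambda>z. q * norm (f z) powr (q - 2) * (f z \<bullet> partial \<mu> f z))" for \<mu>
    using q C1_future_continuous[OF f] C1_future_continuous_partial[OF f]
    by (intro continuous_intros continuous_on_powr') auto
  show "C1_future (\<lambda>z. norm (f z) powr q)"
    using q by (intro C1_future_compose(1)[OF D f c]) auto
  show "z \<in> future \<Longrightarrow>
      partial \<mu> (\<lambda>z. norm (f z) powr q) z = q * norm (f z) powr (q - 2) * (f z \<bullet> partial \<mu> f z)"
    using q by (intro C1_future_compose(2)[OF D f c]) auto
qed

text \<open>
  The second difference of \<open>f\<close> over a parallelogram does not depend on the order of the two
  sides, whereas applying the mean value theorem twice expresses it by either mixed derivative.
  This is why mixed derivatives commute.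
\<close>

lemma second_difference_mean_value:
  fixes f :: "'a::real_normed_vector \<Rightarrow> real"
  assumes f: "\<And>w. dist z w \<le> h * (norm e + norm d) \<Longrightarrow> ((\<lambda>s. f (w + s *\<^sub>R e)) has_real_derivative fe w) (at 0)"
    and fe: "\<And>w. dist z w \<le> h * (norm e + norm d) \<Longrightarrow> ((\<lambda>s. fe (w + s *\<^sub>R d)) has_real_derivative fde w) (at 0)"
    and h: "0 < h"
  obtains w where "dist z w \<le> h * (norm e + norm d)"
    "f (z + h *\<^sub>R e + h *\<^sub>R d) - f (z + h *\<^sub>R e) - f (z + h *\<^sub>R d) + f z = h\<^sup>2 * fde w"
proof -
  have near: "dist z (z + s *\<^sub>R e + r *\<^sub>R d) \<le> h * (norm e + norm d)"
    if "0 \<le> s" "s \<le> h" "0 \<le> r" "r \<le> h" for s r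
  proof -
    have "dist z (z + s *\<^sub>R e + r *\<^sub>R d) = norm (s *\<^sub>R e + r *\<^sub>R d)"
      using dist_add_cancel[of z 0 "s *\<^sub>R e + r *\<^sub>R d"] by (simp add: add.assoc)
    also have "\<dots> \<le> s * norm e + r * norm d"
      using norm_triangle_ineq[of "s *\<^sub>R e" "r *\<^sub>R d"] that by simp
    also have "\<dots> \<le> h * norm e + h * norm d"
      using that by (intro add_mono mult_right_mono) auto
    finally show ?thesis by (simp add: algebra_simps)
  qed
  have df: "((\<lambda>s. f (z + s *\<^sub>R e + r *\<^sub>R d)) has_real_derivative fe (z + s *\<^sub>R e + r *\<^sub>R d)) (at s)"
    if "0 \<le> s" "s \<le> h" "0 \<le> r" "r \<le> h" for s r
  proof -
    have "((\<lambda>t. f ((z + s *\<^sub>R e + r *\<^sub>R d) + t *\<^sub>R e)) has_real_derivative fe (z + s *\<^sub>R e + r *\<^sub>R d)) (at 0)"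
      by (rule f[OF near[OF that]])
    then have "((\<lambda>t. f (z + (s + t) *\<^sub>R e + r *\<^sub>R d)) has_real_derivative fe (z + s *\<^sub>R e + r *\<^sub>R d)) (at 0)"
      by (simp add: algebra_simps)
    then show ?thesis
      using DERIV_shift[of "\<lambda>t. f (z + t *\<^sub>R e + r *\<^sub>R d)" _ 0 s] by (simp add: add.commute)
  qed
  have dfe: "((\<lambda>r. fe (z + s *\<^sub>R e + r *\<^sub>R d)) has_real_derivative fde (z + s *\<^sub>R e + r *\<^sub>R d)) (at r)"
    if "0 \<le> s" "s \<le> h" "0 \<le> r" "r \<le> h" for s r
  proof -
    have "((\<lambda>t. fe ((z + s *\<^sub>R e + r *\<^sub>R d) + t *\<^sub>R d)) has_real_derivative fde (z + s *\<^sub>R e + r *\<^sub>R d)) (at 0)"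
      by (rule fe[OF near[OF that]])
    then have "((\<lambda>t. fe (z + s *\<^sub>R e + (r + t) *\<^sub>R d)) has_real_derivative fde (z + s *\<^sub>R e + r *\<^sub>R d)) (at 0)"
      by (simp add: algebra_simps)
    then show ?thesis
      using DERIV_shift[of "\<lambda>t. fe (z + s *\<^sub>R e + t *\<^sub>R d)" _ 0 r] by (simp add: add.commute)
  qed
  obtain s where s: "0 < s" "s < h" and
    s_eq: "(f (z + h *\<^sub>R e + h *\<^sub>R d) - f (z + h *\<^sub>R e + 0 *\<^sub>R d)) -
      (f (z + 0 *\<^sub>R e + h *\<^sub>R d) - f (z + 0 *\<^sub>R e + 0 *\<^sub>R d)) =
      (h - 0) * (fe (z + s *\<^sub>R e + h *\<^sub>R d) - fe (z + s *\<^sub>R e + 0 *\<^sub>R d))"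
    by (rule exE[OF MVT2[of 0 h "\<lambda>s. f (z + s *\<^sub>R e + h *\<^sub>R d) - f (z + s *\<^sub>R e + 0 *\<^sub>R d)"
        "\<lambda>s. fe (z + s *\<^sub>R e + h *\<^sub>R d) - fe (z + s *\<^sub>R e + 0 *\<^sub>R d)"]])
      (use h in \<open>auto intro!: DERIV_diff df simp del: scaleR_zero_left add_0_right\<close>)
  obtain r where r: "0 < r" "r < h" and
    r_eq: "fe (z + s *\<^sub>R e + h *\<^sub>R d) - fe (z + s *\<^sub>R e + 0 *\<^sub>R d) = (h - 0) * fde (z + s *\<^sub>R e + r *\<^sub>R d)"
    using MVT2[of 0 h "\<lambda>r. fe (z + s *\<^sub>R e + r *\<^sub>R d)" "\<lambda>r. fde (z + s *\<^sub>R e + r *\<^sub>R d)"] h dfe[of s] s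
    by auto
  show thesis
  proof (rule that[OF near])
    show "f (z + h *\<^sub>R e + h *\<^sub>R d) - f (z + h *\<^sub>R e) - f (z + h *\<^sub>R d) + f z =
        h\<^sup>2 * fde (z + s *\<^sub>R e + r *\<^sub>R d)"
      using s_eq unfolding r_eq by (simp add: power2_eq_square algebra_simps)
  qed (use s r in auto)
qed

lemma mixed_derivatives_commute:
  fixes f :: "'a::real_normed_vector \<Rightarrow> real"
  assumes S: "open S" "z \<in> S"
    and f: "\<And>w. w \<in> S \<Longrightarrow> ((\<lambda>s. f (w + s *\<^sub>R e)) has_real_derivative fe w) (at 0)"
      "\<And>w. w \<in> S \<Longrightarrow> ((\<lambda>s. f (w + s *\<^sub>R d)) has_real_derivative fd w) (at 0)"
    and fe: "\<And>w. w \<in> S \<Longrightarrow> ((\<lambda>s. fe (w + s *\<^sub>R d)) has_real_derivative fde w) (at 0)"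
    and fd: "\<And>w. w \<in> S \<Longrightarrow> ((\<lambda>s. fd (w + s *\<^sub>R e)) has_real_derivative fed w) (at 0)"
    and cont: "isCont fde z" "isCont fed z"
  shows "fde z = fed z"
proof (rule ccontr)
  assume neq: "fde z \<noteq> fed z"
  define \<epsilon> where "\<epsilon> = \<bar>fde z - fed z\<bar> / 2"
  have "\<epsilon> > 0" using neq by (simp add: \<epsilon>_def)
  obtain r1 where r1: "r1 > 0" "\<And>w. dist w z < r1 \<Longrightarrow> dist (fde w) (fde z) < \<epsilon>"
    using cont(1) \<open>\<epsilon> > 0\<close> unfolding continuous_at_eps_delta by blast
  obtain r2 where r2: "r2 > 0" "\<And>w. dist w z < r2 \<Longrightarrow> dist (fed w) (fed z) < \<epsilon>"
    using cont(2) \<open>\<epsilon> > 0\<close> unfolding continuous_at_eps_delta by blast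
  obtain r3 where r3: "r3 > 0" "ball z r3 \<subseteq> S"
    using S open_contains_ball by blast
  define r where "r = min r1 (min r2 r3)"
  define h where "h = r / (2 * (1 + norm e + norm d))"
  have pos: "r > 0" "1 + norm e + norm d > 0"
    using r1 r2 r3 add_pos_nonneg[of 1 "norm e + norm d"] by (simp_all add: r_def add.assoc)
  have h: "h > 0" using pos by (simp add: h_def)
  have "h * (norm e + norm d) < h * (2 * (1 + norm e + norm d))"
    using h pos by (intro mult_strict_left_mono) auto
  also have "\<dots> = r"
    using pos by (simp add: h_def)
  finally have hr: "h * (norm e + norm d) < r" .
  have near: "w \<in> S" "dist w z < r1" "dist w z < r2" if "dist z w \<le> h * (norm e + norm d)" for w
    using that hr r3 by (auto simp: r_def dist_commute subset_iff)
  obtain w1 where w1: "dist z w1 \<le> h * (norm e + norm d)"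
    "f (z + h *\<^sub>R e + h *\<^sub>R d) - f (z + h *\<^sub>R e) - f (z + h *\<^sub>R d) + f z = h\<^sup>2 * fde w1"
    by (rule second_difference_mean_value[of z h e d f fe fde]) (use f(1) fe near h in auto)
  obtain w2 where w2: "dist z w2 \<le> h * (norm e + norm d)"
    "f (z + h *\<^sub>R d + h *\<^sub>R e) - f (z + h *\<^sub>R d) - f (z + h *\<^sub>R e) + f z = h\<^sup>2 * fed w2"
    by (rule second_difference_mean_value[of z h d e f fd fed])
      (use f(2) fd near h in \<open>auto simp: add.commute[of "norm d"]\<close>)
  have "h\<^sup>2 * fde w1 = h\<^sup>2 * fed w2"
    using w1(2) w2(2) by (simp add: algebra_simps)
  then have "fde w1 = fed w2"
    using h by simp
  moreover have "dist (fde w1) (fde z) < \<epsilon>" "dist (fed w2) (fed z) < \<epsilon>"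
    using r1(2) r2(2) near w1(1) w2(1) by auto
  ultimately show False
    by (auto simp: \<epsilon>_def dist_real_def abs_if split: if_splits)
qed

lemma future_interior:
  assumes "0 < z $ 0"
  shows "z \<in> future" "at z within future = at z"
proof -
  have "open {z :: real^3. 0 < z $ 0}"
    by (rule open_halfspace_component_gt_cart)
  moreover have "{z :: real^3. 0 < z $ 0} \<subseteq> future"
    by (auto simp: future_def)
  ultimately have "z \<in> interior future"
    using assms by (auto simp: interior_def)
  then show "at z within future = at z" by (rule at_within_interior)
  show "z \<in> future" using assms by (simp add: future_def)
qed

lemma C1_future_has_directional_derivative:
  assumes f: "C1_future f" and z: "0 < z $ 0" and L: "bounded_linear L"
  shows "((\<lambda>s. L (f (z + s *\<^sub>R axis \<mu> 1))) has_real_derivative L (partial \<mu> f z)) (at 0)"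
proof -
  have "(f has_derivative frechet_derivative f (at z within future)) (at (z + 0 *\<^sub>R axis \<mu> 1))"
    using C1_future_has_derivative[OF f future_interior(1)[OF z]] future_interior(2)[OF z] by simp
  then have "((\<lambda>s. f (z + s *\<^sub>R axis \<mu> 1)) has_derivative
      (\<lambda>h. frechet_derivative f (at z within future) (h *\<^sub>R axis \<mu> 1))) (at 0)"
    by (rule has_derivative_compose[rotated]) (auto intro!: derivative_eq_intros)
  from bounded_linear.has_derivative[OF L this]
  have "((\<lambda>s. L (f (z + s *\<^sub>R axis \<mu> 1))) has_derivative
      (\<lambda>h. L (frechet_derivative f (at z within future) (h *\<^sub>R axis \<mu> 1)))) (at 0)" .
  moreover have "L (frechet_derivative f (at z within future) (h *\<^sub>R axis \<mu> 1)) = h * L (partial \<mu> f z)" for h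
    using has_derivative_bounded_linear[OF C1_future_has_derivative[OF f future_interior(1)[OF z]]] L
    by (simp add: partial_def linear_cmul bounded_linear.linear)
  ultimately show ?thesis
    by (simp add: has_field_derivative_def mult_commute_abs)
qed

text \<open>
  Positive time makes \<open>z\<close> an interior point, so that difference quotients can be taken in all
  directions. The divergence of a current is only needed at such points.
\<close>

lemma partial_commute:
  fixes f :: "real^3 \<Rightarrow> complex"
  assumes f: "C2_future f" and z: "0 < z $ 0"
  shows "partial \<mu> (partial \<nu> f) z = partial \<nu> (partial \<mu> f) z"
proof -
  have C1: "C1_future f" "\<And>\<mu>. C1_future (partial \<mu> f)"
    using f by (auto simp: C2_future_def)
  have cont: "isCont (\<lambda>z. L (partial \<mu> (partial \<nu> f) z)) z" if "bounded_linear L" for L :: "complex \<Rightarrow> real" and \<mu> \<nu>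
    using C1_future_continuous_partial[OF C1(2)[of \<nu>], of \<mu>] future_interior[OF z]
    by (intro bounded_linear.isCont[OF that]) (metis continuous_on_eq_continuous_within)
  have S: "open {z :: real^3. 0 < z $ 0}"
    by (rule open_halfspace_component_gt_cart)
  have "L (partial \<mu> (partial \<nu> f) z) = L (partial \<nu> (partial \<mu> f) z)" if L: "bounded_linear L" for L :: "complex \<Rightarrow> real"
    by (rule mixed_derivatives_commute[OF S, where f = "\<lambda>z. L (f z)" and e = "axis \<nu> 1" and d = "axis \<mu> 1"
          and fe = "\<lambda>z. L (partial \<nu> f z)" and fd = "\<lambda>z. L (partial \<mu> f z)"])
      (use z C1 L cont in \<open>auto intro: C1_future_has_directional_derivative\<close>)
  from this[OF bounded_linear_Re] this[OF bounded_linear_Im] show ?thesis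
    by (simp add: complex_eq_iff)
qed

section \<open>Covariant derivatives\<close>

lemma cov_scaleR_form: "cov A \<mu> f = (\<lambda>z. partial \<mu> f z + A \<mu> z *\<^sub>R (\<i> * f z))"
  by (auto simp: cov_def scaleR_conv_of_real)

lemma C1_future_i_mult: "C1_future f \<Longrightarrow> C1_future (\<lambda>z. \<i> * f z)"
  by (rule bounded_linear_C1_future[OF bounded_linear_mult_right])

lemma C1_future_cov:
  assumes "C1_future (A \<mu>)" "C2_future f"
  shows "C1_future (cov A \<mu> f)"
  using assms unfolding cov_scaleR_form C2_future_def
  by (intro C1_future_add C1_future_scaleR C1_future_i_mult) auto

lemma continuous_on_cov:
  assumes "C1_future (A \<mu>)" "C1_future f"
  shows "continuous_on future (cov A \<mu> f)"
  using assms unfolding cov_scaleR_form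
  by (intro continuous_intros C1_future_continuous_partial C1_future_continuous)

text \<open>
  The potential enters \<open>cov\<close> as multiplication by an imaginary number, which is skew for the
  real inner product, so gauge invariant quadratic expressions obey a Leibniz rule in which
  only covariant derivatives occur.
\<close>

lemma partial_inner_cov:
  assumes "C1_future f" "C1_future g" "z \<in> future"
  shows "partial \<mu> (\<lambda>z. f z \<bullet> g z) z = cov A \<mu> f z \<bullet> g z + f z \<bullet> cov A \<mu> g z"
  by (subst partial_inner[OF assms]) (simp add: cov_def inner_complex_def algebra_simps)

lemma inner_partial_eq_inner_cov: "f z \<bullet> partial \<mu> f z = f z \<bullet> cov A \<mu> f z"
  by (simp add: cov_def inner_complex_def algebra_simps)

lemma cov_add:
  assumes "C1_future f" "C1_future g" "z \<in> future"
  shows "cov A \<mu> (\<lambda>z. f z + g z) z = cov A \<mu> f z + cov A \<mu> g z"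
  using assms by (simp add: cov_def partial_add algebra_simps)

lemma cov_diff:
  assumes "C1_future f" "C1_future g" "z \<in> future"
  shows "cov A \<mu> (\<lambda>z. f z - g z) z = cov A \<mu> f z - cov A \<mu> g z"
  using assms by (simp add: cov_def partial_diff algebra_simps)

lemma cov_scaleR:
  assumes "C1_future r" "C1_future f" "z \<in> future"
  shows "cov A \<mu> (\<lambda>z. r z *\<^sub>R f z) z = partial \<mu> r z *\<^sub>R f z + r z *\<^sub>R cov A \<mu> f z"
  unfolding cov_def by (subst partial_scaleR[OF assms]) (simp add: scaleR_conv_of_real algebra_simps)

lemma cov_commutator:
  assumes A: "\<And>\<mu>. C1_future (A \<mu>)" and f: "C2_future f" and z: "0 < z $ 0"
  shows "cov A \<mu> (cov A \<nu> f) z - cov A \<nu> (cov A \<mu> f) z = curvature A \<mu> \<nu> z *\<^sub>R (\<i> * f z)"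
proof -
  have C1: "C1_future f" "\<And>\<mu>. C1_future (partial \<mu> f)" and fut: "z \<in> future"
    using f z by (auto simp: C2_future_def future_interior)
  have "partial \<mu> (cov A \<nu> f) z = partial \<mu> (partial \<nu> f) z +
      (A \<nu> z *\<^sub>R (\<i> * partial \<mu> f z) + partial \<mu> (A \<nu>) z *\<^sub>R (\<i> * f z))" for \<mu> \<nu>
    using C1 A fut unfolding cov_scaleR_form
    by (simp add: partial_add partial_scaleR C1_future_scaleR C1_future_i_mult
        bounded_linear_partial[OF bounded_linear_mult_right])
  then show ?thesis
    using partial_commute[OF f z, of \<mu> \<nu>]
    unfolding cov_def[of A _ "cov A _ f"] curvature_def
    by (simp add: cov_def scaleR_conv_of_real algebra_simps)
qed

text \<open>
  The divergence of the conformal current at one point, as an identity between numbers: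
  \<open>\<psi>m\<close> and \<open>Hmn\<close> stand for \<open>D_m \<phi>\<close> and \<open>D_m D_n \<phi>\<close>, \<open>n\<close> for \<open>|\<phi>| powr (p - 1)\<close> and \<open>Q\<close> for
  the potential energy density. The hypotheses are the wave equation and the commutators of
  the covariant derivatives, with the curvature replaced by the Chern-Simons current. The
  curvature terms cancel because \<open>F_{mn}\<close> is the dual of the current \<open>J\<close>, whence \<open>F_{mn} J^m = 0\<close>.
\<close>

lemma conformal_divergence_identity:
  fixes \<phi> \<psi>0 \<psi>1 \<psi>2 H00 H01 H02 H10 H11 H12 H20 H21 H22 :: complex
    and \<sigma> u y n Q p :: real
  defines "a \<equiv> \<psi>0 - \<sigma> *\<^sub>R \<psi>1" and "b \<equiv> \<psi>0 + \<sigma> *\<^sub>R \<psi>1"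
  defines "U \<equiv> u *\<^sub>R a + y *\<^sub>R \<psi>2 + \<phi>" and "V \<equiv> y *\<^sub>R b + u *\<^sub>R \<psi>2"
  assumes \<sigma>: "\<sigma> = 1 \<or> \<sigma> = - 1"
    and wave: "- H00 + H11 + H22 = n *\<^sub>R \<phi>"
    and F01: "H01 - H10 = Im (\<phi> * cnj \<psi>2) *\<^sub>R (\<i> * \<phi>)"
    and F02: "H02 - H20 = - Im (\<phi> * cnj \<psi>1) *\<^sub>R (\<i> * \<phi>)"
    and F12: "H12 - H21 = - Im (\<phi> * cnj \<psi>0) *\<^sub>R (\<i> * \<phi>)"
    and Q: "n * (norm \<phi>)\<^sup>2 = (p + 1) * Q"
  shows "(H00 - \<sigma> *\<^sub>R H01) \<bullet> a + H02 \<bullet> \<psi>2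
      + (a + u *\<^sub>R (H00 - \<sigma> *\<^sub>R H01) + y *\<^sub>R H02 + \<psi>0) \<bullet> U
      + (y *\<^sub>R (H00 + \<sigma> *\<^sub>R H01) + \<psi>2 + u *\<^sub>R H02) \<bullet> V
      + 2 * u * Q + (1 + u\<^sup>2 + y\<^sup>2) * (n * (\<phi> \<bullet> \<psi>0))
    + \<sigma> * ((H10 - \<sigma> *\<^sub>R H11) \<bullet> a - H12 \<bullet> \<psi>2
      + (- \<sigma> *\<^sub>R a + u *\<^sub>R (H10 - \<sigma> *\<^sub>R H11) + y *\<^sub>R H12 + \<psi>1) \<bullet> U
      - (y *\<^sub>R (H10 + \<sigma> *\<^sub>R H11) + (- \<sigma> *\<^sub>R \<psi>2 + u *\<^sub>R H12)) \<bullet> V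
      + 2 * u * \<sigma> * Q + (y\<^sup>2 - u\<^sup>2 - 1) * (n * (\<phi> \<bullet> \<psi>1)))
    - ((H20 - \<sigma> *\<^sub>R H21) \<bullet> \<psi>2 + a \<bullet> H22)
      - ((u *\<^sub>R (H20 - \<sigma> *\<^sub>R H21) + (\<psi>2 + y *\<^sub>R H22) + \<psi>2) \<bullet> V
        + U \<bullet> (b + y *\<^sub>R (H20 + \<sigma> *\<^sub>R H21) + u *\<^sub>R H22))
      + 2 * u * Q + 2 * u * y * (n * (\<phi> \<bullet> \<psi>2))
    = (5 - p) * u * Q"
proof -
  have H: "H00 = H11 + H22 - n *\<^sub>R \<phi>"
    "H10 = H01 - Im (\<phi> * cnj \<psi>2) *\<^sub>R (\<i> * \<phi>)"
    "H20 = H02 + Im (\<phi> * cnj \<psi>1) *\<^sub>R (\<i> * \<phi>)"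
    "H21 = H12 + Im (\<phi> * cnj \<psi>0) *\<^sub>R (\<i> * \<phi>)"
    using wave F01 F02 F12 by (auto simp: algebra_simps)
  \<comment> \<open>The relation between \<open>n\<close> and \<open>Q\<close> is used only here, so that a polynomial identity remains.\<close>
  have pQ: "(5 - p) * u * Q = 6 * u * Q - u * n * (\<phi> \<bullet> \<phi>)"
    using arg_cong[OF Q, of "\<lambda>x. u * x"] by (simp add: power2_norm_eq_inner algebra_simps)
  from \<sigma> show ?thesis
  proof
    assume "\<sigma> = 1"
    then show ?thesis
      unfolding pQ H a_def b_def U_def V_def
      by (simp add: inner_complex_def power2_eq_square algebra_simps)
  next
    assume "\<sigma> = - 1"
    then show ?thesis
      unfolding pQ H a_def b_def U_def V_def
      by (simp add: inner_complex_def power2_eq_square algebra_simps)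
  qed
qed

section \<open>The conformal current\<close>

definition null_time :: "real \<Rightarrow> real^3 \<Rightarrow> real" where
  "null_time \<sigma> z = z $ 0 - \<sigma> * z $ 1"

definition cov_minus :: "connection \<Rightarrow> real \<Rightarrow> (real^3 \<Rightarrow> complex) \<Rightarrow> real^3 \<Rightarrow> complex" where
  "cov_minus A \<sigma> \<phi> z = cov A 0 \<phi> z - \<sigma> *\<^sub>R cov A 1 \<phi> z"

definition cov_plus :: "connection \<Rightarrow> real \<Rightarrow> (real^3 \<Rightarrow> complex) \<Rightarrow> real^3 \<Rightarrow> complex" where
  "cov_plus A \<sigma> \<phi> z = cov A 0 \<phi> z + \<sigma> *\<^sub>R cov A 1 \<phi> z"

text \<open>
  With \<open>a = D_0 \<phi> - \<sigma> D_1 \<phi>\<close>, \<open>b = D_0 \<phi> + \<sigma> D_1 \<phi>\<close> and \<open>c = D_2 \<phi>\<close>, the pairs \<open>(a, c)\<close> and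
  \<open>(u a + y c, y b + u c)\<close> are the contractions of \<open>D \<phi>\<close> with two spinors whose squares are the
  null fields \<open>\<partial>_0 - \<sigma> \<partial>_1\<close> and
  \<open>u^2 (\<partial>_0 - \<sigma> \<partial>_1) + 2 u y \<partial>_2 + y^2 (\<partial>_0 + \<sigma> \<partial>_1)\<close>. The extra summand \<open>\<phi>\<close> accounts for the
  conformal weight of the field.
\<close>

definition spinor_U :: "connection \<Rightarrow> real \<Rightarrow> (real^3 \<Rightarrow> complex) \<Rightarrow> real^3 \<Rightarrow> complex" where
  "spinor_U A \<sigma> \<phi> z =
    null_time \<sigma> z *\<^sub>R cov_minus A \<sigma> \<phi> z + z $ 2 *\<^sub>R cov A 2 \<phi> z + \<phi> z"

definition spinor_V :: "connection \<Rightarrow> real \<Rightarrow> (real^3 \<Rightarrow> complex) \<Rightarrow> real^3 \<Rightarrow> complex" where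
  "spinor_V A \<sigma> \<phi> z = z $ 2 *\<^sub>R cov_plus A \<sigma> \<phi> z + null_time \<sigma> z *\<^sub>R cov A 2 \<phi> z"

definition potential :: "real \<Rightarrow> (real^3 \<Rightarrow> complex) \<Rightarrow> real^3 \<Rightarrow> real" where
  "potential p \<phi> z = norm (\<phi> z) powr (p + 1) / (p + 1)"

text \<open>
  This is the current of the conformal Killing field
  \<open>K = (1 + u^2) (\<partial>_0 - \<sigma> \<partial>_1) + 2 u y \<partial>_2 + y^2 (\<partial>_0 + \<sigma> \<partial>_1)\<close>, where \<open>u = t - \<sigma> x_1\<close> and
  \<open>y = x_2\<close>, that is, up to sign, the energy-momentum tensor contracted with \<open>K\<close> plus the usual lower
  order term \<open>u \<phi> D \<phi> - |\<phi>|^2 du / 2\<close>. To it is added a current with identically vanishing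
  divergence, namely, with \<open>N = |\<phi>|^2 / 2\<close> and for \<open>\<sigma> = 1\<close>,
  \<open>(\<partial>_2 (y N) - \<partial>_1 (u N), \<partial>_0 (u N) + \<partial>_2 (y N), - \<partial>_0 (y N) - \<partial>_1 (y N))\<close>. It is chosen such that both
  the density and the flux through the null planes \<open>u = const\<close> become sums of squares
  pointwise, not only after an integration by parts.
\<close>

definition conformal_current ::
  "real \<Rightarrow> connection \<Rightarrow> real \<Rightarrow> (real^3 \<Rightarrow> complex) \<Rightarrow> 3 \<Rightarrow> real^3 \<Rightarrow> real" where
  "conformal_current p A \<sigma> \<phi> \<mu> z =
    (let u = null_time \<sigma> z; y = z $ 2; a = cov_minus A \<sigma> \<phi> z; c = cov A 2 \<phi> z;
         U = spinor_U A \<sigma> \<phi> z; V = spinor_V A \<sigma> \<phi> z; Q = potential p \<phi> z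
     in if \<mu> = 0 then (a \<bullet> a + c \<bullet> c + (U \<bullet> U + V \<bullet> V)) / 2 + (1 + u\<^sup>2 + y\<^sup>2) * Q
        else if \<mu> = 1 then \<sigma> * ((a \<bullet> a - c \<bullet> c + (U \<bullet> U - V \<bullet> V)) / 2 + (y\<^sup>2 - u\<^sup>2 - 1) * Q)
        else 2 * u * y * Q - a \<bullet> c - U \<bullet> V)"

lemma sum_spacetime:
  fixes f :: "3 \<Rightarrow> 'a::comm_monoid_add"
  shows "sum f UNIV = f 0 + f 1 + f 2"
proof -
  have "(3 :: 3) = 0" by simp
  then show ?thesis unfolding sum_3 by (simp only: ac_simps)
qed

lemma C1_future_square: "C1_future f \<Longrightarrow> C1_future (\<lambda>z. (f z :: real)\<^sup>2)"
  unfolding power2_eq_square by (rule C1_future_mult)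

lemma partial_square:
  "C1_future f \<Longrightarrow> z \<in> future \<Longrightarrow> partial \<mu> (\<lambda>z. (f z :: real)\<^sup>2) z = 2 * f z * partial \<mu> f z"
  unfolding power2_eq_square by (subst partial_mult) (auto simp: algebra_simps)

lemma C1_future_divide: "C1_future f \<Longrightarrow> C1_future (\<lambda>z. (f z :: real) / c)"
  by (rule bounded_linear_C1_future[OF bounded_linear_divide])

lemma partial_divide:
  "C1_future f \<Longrightarrow> z \<in> future \<Longrightarrow> partial \<mu> (\<lambda>z. (f z :: real) / c) z = partial \<mu> f z / c"
  by (rule bounded_linear_partial[OF bounded_linear_divide])

lemmas C1_future_intros = C1_future_const C1_future_coordinate C1_future_add C1_future_diff C1_future_mult
  C1_future_scaleR C1_future_inner C1_future_square C1_future_divide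

lemma C1_future_null_time: "C1_future (null_time \<sigma>)"
  unfolding null_time_def[abs_def] by (intro C1_future_intros)

lemma partial_null_time:
  "z \<in> future \<Longrightarrow> partial \<mu> (null_time \<sigma>) z = (if \<mu> = 0 then 1 else if \<mu> = 1 then - \<sigma> else 0)"
  unfolding null_time_def[abs_def]
  by (auto simp: partial_diff partial_mult partial_coordinate C1_future_intros)

context
  fixes p \<sigma> :: real and A :: connection and \<phi> :: "real^3 \<Rightarrow> complex"
  assumes p: "1 < p" and \<sigma>: "\<sigma> = 1 \<or> \<sigma> = - 1"
    and A: "\<And>\<mu>. C1_future (A \<mu>)" and \<phi>: "C2_future \<phi>"
begin

private lemma C1: "C1_future \<phi>" "C1_future (cov A \<mu> \<phi>)" "C1_future (cov_minus A \<sigma> \<phi>)"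
    "C1_future (cov_plus A \<sigma> \<phi>)" "C1_future (spinor_U A \<sigma> \<phi>)" "C1_future (spinor_V A \<sigma> \<phi>)"
proof -
  show 1: "C1_future \<phi>" using \<phi> by (simp add: C2_future_def)
  show 2: "C1_future (cov A \<mu> \<phi>)" for \<mu> by (rule C1_future_cov[OF A \<phi>])
  show 3: "C1_future (cov_minus A \<sigma> \<phi>)" "C1_future (cov_plus A \<sigma> \<phi>)"
    unfolding cov_minus_def[abs_def] cov_plus_def[abs_def]
    by (intro C1_future_intros 2)+
  show "C1_future (spinor_U A \<sigma> \<phi>)" "C1_future (spinor_V A \<sigma> \<phi>)"
    unfolding spinor_U_def[abs_def] spinor_V_def[abs_def]
    by (intro C1_future_intros C1_future_null_time 1 2 3)+
qed

private lemma C1_potential: "C1_future (potential p \<phi>)"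
  unfolding potential_def[abs_def]
  using p by (intro C1_future_divide C1_future_norm_powr C1) auto

private lemma partial_potential:
  assumes z: "z \<in> future"
  shows "partial \<mu> (potential p \<phi>) z = norm (\<phi> z) powr (p - 1) * (\<phi> z \<bullet> cov A \<mu> \<phi> z)"
  unfolding potential_def[abs_def]
  using p z by (subst partial_divide)
    (auto simp: partial_norm_powr C1 C1_future_norm_powr inner_partial_eq_inner_cov[where A = A])

lemma C1_future_conformal_current: "C1_future (conformal_current p A \<sigma> \<phi> \<mu>)"
  unfolding conformal_current_def[abs_def] Let_def
  by (cases "\<mu> = 0"; cases "\<mu> = 1"; simp)
    (intro C1_future_intros C1_future_null_time C1 C1_potential)+

private lemma cov_second:
  assumes z: "z \<in> future"
  defines "H \<equiv> \<lambda>\<mu> \<nu>. cov A \<mu> (cov A \<nu> \<phi>) z"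
  shows "cov A \<mu> (cov_minus A \<sigma> \<phi>) z = H \<mu> 0 - \<sigma> *\<^sub>R H \<mu> 1"
    and "cov A \<mu> (cov_plus A \<sigma> \<phi>) z = H \<mu> 0 + \<sigma> *\<^sub>R H \<mu> 1"
    and "cov A \<mu> (spinor_U A \<sigma> \<phi>) z =
      partial \<mu> (null_time \<sigma>) z *\<^sub>R cov_minus A \<sigma> \<phi> z + null_time \<sigma> z *\<^sub>R cov A \<mu> (cov_minus A \<sigma> \<phi>) z
      + (partial \<mu> (\<lambda>z. z $ 2) z *\<^sub>R cov A 2 \<phi> z + z $ 2 *\<^sub>R H \<mu> 2) + cov A \<mu> \<phi> z"
    and "cov A \<mu> (spinor_V A \<sigma> \<phi>) z =
      partial \<mu> (\<lambda>z. z $ 2) z *\<^sub>R cov_plus A \<sigma> \<phi> z + z $ 2 *\<^sub>R cov A \<mu> (cov_plus A \<sigma> \<phi>) z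
      + (partial \<mu> (null_time \<sigma>) z *\<^sub>R cov A 2 \<phi> z + null_time \<sigma> z *\<^sub>R H \<mu> 2)"
  unfolding cov_minus_def[abs_def] cov_plus_def[abs_def] spinor_U_def[abs_def] spinor_V_def[abs_def] H_def
  using z
  by (simp_all add: cov_add cov_diff cov_scaleR C1[unfolded cov_minus_def[abs_def] cov_plus_def[abs_def]]
      C1_future_intros C1_future_null_time)

private lemma partial_conformal_current:
  assumes z: "z \<in> future"
  defines "u \<equiv> null_time \<sigma> z" and "y \<equiv> z $ 2" and "a \<equiv> cov_minus A \<sigma> \<phi> z" and "c \<equiv> cov A 2 \<phi> z"
    and "U \<equiv> spinor_U A \<sigma> \<phi> z" and "V \<equiv> spinor_V A \<sigma> \<phi> z" and "Q \<equiv> potential p \<phi> z"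
    and "Da \<equiv> \<lambda>\<mu>. cov A \<mu> (cov_minus A \<sigma> \<phi>) z" and "Dc \<equiv> \<lambda>\<mu>. cov A \<mu> (cov A 2 \<phi>) z"
    and "DU \<equiv> \<lambda>\<mu>. cov A \<mu> (spinor_U A \<sigma> \<phi>) z" and "DV \<equiv> \<lambda>\<mu>. cov A \<mu> (spinor_V A \<sigma> \<phi>) z"
    and "DQ \<equiv> \<lambda>\<mu>. norm (\<phi> z) powr (p - 1) * (\<phi> z \<bullet> cov A \<mu> \<phi> z)"
  shows "partial 0 (conformal_current p A \<sigma> \<phi> 0) z =
      Da 0 \<bullet> a + Dc 0 \<bullet> c + DU 0 \<bullet> U + DV 0 \<bullet> V + 2 * u * Q + (1 + u\<^sup>2 + y\<^sup>2) * DQ 0"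
    and "partial 1 (conformal_current p A \<sigma> \<phi> 1) z =
      \<sigma> * (Da 1 \<bullet> a - Dc 1 \<bullet> c + DU 1 \<bullet> U - DV 1 \<bullet> V + 2 * u * \<sigma> * Q + (y\<^sup>2 - u\<^sup>2 - 1) * DQ 1)"
    and "partial 2 (conformal_current p A \<sigma> \<phi> 2) z =
      2 * u * Q + 2 * u * y * DQ 2 - (Da 2 \<bullet> c + a \<bullet> Dc 2) - (DU 2 \<bullet> V + U \<bullet> DV 2)"
  unfolding conformal_current_def[abs_def] Let_def assms(2-)
  using z
  by (simp_all add: partial_add partial_diff partial_mult partial_divide partial_square partial_potential
      partial_coordinate partial_null_time partial_inner_cov[where A = A]
      C1_future_intros C1_future_null_time C1 C1_potential inner_commute add_divide_distrib
      diff_divide_distrib algebra_simps)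

lemma divergence_conformal_current:
  assumes eq: "CSH_equations p A \<phi>" and z: "0 < z $ 0"
  shows "(\<Sum>\<mu>\<in>UNIV. partial \<mu> (conformal_current p A \<sigma> \<phi> \<mu>) z) =
    (5 - p) * null_time \<sigma> z * potential p \<phi> z"
proof -
  define H where "H \<mu> \<nu> = cov A \<mu> (cov A \<nu> \<phi>) z" for \<mu> \<nu>
  have fut: "z \<in> future" using z by (rule future_interior)
  note csh = bspec[OF eq[unfolded CSH_equations_def] fut]
  note box = conjunct1[OF csh]
  note F = conjunct2[OF csh, rule_format]
  have wave: "- H 0 0 + H 1 1 + H 2 2 = norm (\<phi> z) powr (p - 1) *\<^sub>R \<phi> z"
  proof -
    have "cov_box A \<phi> z = - H 0 0 + H 1 1 + H 2 2"
      by (simp add: cov_box_def sum_spacetime minkowski_def H_def)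
    then show ?thesis unfolding box scaleR_conv_of_real by (rule sym)
  qed
  have commutator: "H \<mu> \<nu> - H \<nu> \<mu> = curvature A \<mu> \<nu> z *\<^sub>R (\<i> * \<phi> z)" for \<mu> \<nu>
    unfolding H_def by (rule cov_commutator[OF A \<phi> z])
  have F': "curvature A 0 1 z = Im (\<phi> z * cnj (cov A 2 \<phi> z))"
    "curvature A 0 2 z = - Im (\<phi> z * cnj (cov A 1 \<phi> z))"
    "curvature A 1 2 z = - Im (\<phi> z * cnj (cov A 0 \<phi> z))"
    unfolding F by (simp_all add: sum_spacetime levi_civita_def minkowski_def current_def)
  have Q: "norm (\<phi> z) powr (p - 1) * (norm (\<phi> z))\<^sup>2 = (p + 1) * potential p \<phi> z"
    using p by (cases "\<phi> z = 0") (auto simp: potential_def powr_diff powr_add power2_eq_square)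
  note id = conformal_divergence_identity[OF \<sigma> wave commutator[of 0 1, unfolded F'] commutator[of 0 2, unfolded F']
      commutator[of 1 2, unfolded F'] Q, of "null_time \<sigma> z" "z $ 2"]
  have cov:
    "cov A \<mu> (cov_minus A \<sigma> \<phi>) z = H \<mu> 0 - \<sigma> *\<^sub>R H \<mu> 1"
    "cov A 0 (spinor_U A \<sigma> \<phi>) z = cov_minus A \<sigma> \<phi> z + null_time \<sigma> z *\<^sub>R (H 0 0 - \<sigma> *\<^sub>R H 0 1)
      + z $ 2 *\<^sub>R H 0 2 + cov A 0 \<phi> z"
    "cov A 1 (spinor_U A \<sigma> \<phi>) z = - \<sigma> *\<^sub>R cov_minus A \<sigma> \<phi> z + null_time \<sigma> z *\<^sub>R (H 1 0 - \<sigma> *\<^sub>R H 1 1)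
      + z $ 2 *\<^sub>R H 1 2 + cov A 1 \<phi> z"
    "cov A 2 (spinor_U A \<sigma> \<phi>) z = null_time \<sigma> z *\<^sub>R (H 2 0 - \<sigma> *\<^sub>R H 2 1)
      + (cov A 2 \<phi> z + z $ 2 *\<^sub>R H 2 2) + cov A 2 \<phi> z"
    "cov A 0 (spinor_V A \<sigma> \<phi>) z = z $ 2 *\<^sub>R (H 0 0 + \<sigma> *\<^sub>R H 0 1) + cov A 2 \<phi> z
      + null_time \<sigma> z *\<^sub>R H 0 2"
    "cov A 1 (spinor_V A \<sigma> \<phi>) z = z $ 2 *\<^sub>R (H 1 0 + \<sigma> *\<^sub>R H 1 1)
      + (- \<sigma> *\<^sub>R cov A 2 \<phi> z + null_time \<sigma> z *\<^sub>R H 1 2)"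
    "cov A 2 (spinor_V A \<sigma> \<phi>) z = cov_plus A \<sigma> \<phi> z + z $ 2 *\<^sub>R (H 2 0 + \<sigma> *\<^sub>R H 2 1)
      + null_time \<sigma> z *\<^sub>R H 2 2" for \<mu>
    by (simp_all add: cov_second[OF fut] partial_null_time[OF fut] partial_coordinate[OF fut] H_def)
  have "(\<Sum>\<mu>\<in>UNIV. partial \<mu> (conformal_current p A \<sigma> \<phi> \<mu>) z) =
      partial 0 (conformal_current p A \<sigma> \<phi> 0) z + partial 1 (conformal_current p A \<sigma> \<phi> 1) z +
      partial 2 (conformal_current p A \<sigma> \<phi> 2) z"
    by (simp add: sum_spacetime)
  also have "\<dots> = (5 - p) * null_time \<sigma> z * potential p \<phi> z"
    using id
    unfolding partial_conformal_current[OF fut] cov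
    unfolding cov_minus_def cov_plus_def spinor_U_def spinor_V_def H_def[symmetric]
    by linarith
  finally show ?thesis .
qed

end

lemma abs_inner_le_squares: "\<bar>a \<bullet> b\<bar> \<le> (a \<bullet> a + b \<bullet> b) / 2" for a b :: "'a::real_inner"
proof -
  have "0 \<le> (a - b) \<bullet> (a - b)" "0 \<le> (a + b) \<bullet> (a + b)" by simp_all
  then show ?thesis by (simp add: inner_diff inner_add inner_commute[of b a] abs_le_iff)
qed

lemma potential_nonneg: "0 < p \<Longrightarrow> 0 \<le> potential p \<phi> z"
  by (simp add: potential_def)

text \<open>
  The field \<open>K\<close> is causal, so no energy flows faster than light: every component of the
  current is bounded by its density.
\<close>

lemma abs_conformal_current_le:
  assumes "0 < p" "\<sigma> = 1 \<or> \<sigma> = - 1"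
  shows "\<bar>conformal_current p A \<sigma> \<phi> \<mu> z\<bar> \<le> conformal_current p A \<sigma> \<phi> 0 z"
proof -
  define u y a c U V Q where "u = null_time \<sigma> z" and "y = z $ 2" and "a = cov_minus A \<sigma> \<phi> z"
    and "c = cov A 2 \<phi> z" and "U = spinor_U A \<sigma> \<phi> z" and "V = spinor_V A \<sigma> \<phi> z"
    and "Q = potential p \<phi> z"
  note defs = this
  have Q: "0 \<le> Q" using assms by (simp add: Q_def potential_nonneg)
  have nn: "0 \<le> a \<bullet> a" "0 \<le> c \<bullet> c" "0 \<le> U \<bullet> U" "0 \<le> V \<bullet> V" "0 \<le> u\<^sup>2 * Q" "0 \<le> y\<^sup>2 * Q"
    using Q by simp_all
  have C0: "conformal_current p A \<sigma> \<phi> 0 z = (a \<bullet> a + c \<bullet> c + (U \<bullet> U + V \<bullet> V)) / 2 + (1 + u\<^sup>2 + y\<^sup>2) * Q"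
    by (simp add: conformal_current_def defs Let_def)
  consider "\<mu> = 0" | "\<mu> = 1" | "\<mu> \<noteq> 0" "\<mu> \<noteq> 1" by blast
  then show ?thesis
  proof cases
    case 1
    then show ?thesis using nn Q unfolding 1 C0 by (simp add: distrib_right)
  next
    case 2
    have "conformal_current p A \<sigma> \<phi> \<mu> z =
        \<sigma> * ((a \<bullet> a - c \<bullet> c + (U \<bullet> U - V \<bullet> V)) / 2 + (y\<^sup>2 - u\<^sup>2 - 1) * Q)"
      using 2 by (simp add: conformal_current_def defs Let_def)
    then have "\<bar>conformal_current p A \<sigma> \<phi> \<mu> z\<bar> =
        \<bar>(a \<bullet> a - c \<bullet> c + (U \<bullet> U - V \<bullet> V)) / 2 + (y\<^sup>2 - u\<^sup>2 - 1) * Q\<bar>"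
      using assms(2) by (auto simp: abs_mult)
    moreover have "\<bar>x / 2 + (y\<^sup>2 - u\<^sup>2 - 1) * Q\<bar> \<le> w / 2 + (1 + u\<^sup>2 + y\<^sup>2) * Q" if "\<bar>x\<bar> \<le> w" for x w
    proof -
      have "\<bar>x / 2 + (y\<^sup>2 - u\<^sup>2 - 1) * Q\<bar> \<le> \<bar>x\<bar> / 2 + \<bar>y\<^sup>2 - u\<^sup>2 - 1\<bar> * Q"
        using abs_triangle_ineq[of "x / 2" "(y\<^sup>2 - u\<^sup>2 - 1) * Q"] Q by (simp add: abs_mult)
      also have "\<dots> \<le> w / 2 + (1 + u\<^sup>2 + y\<^sup>2) * Q"
        using that Q by (intro add_mono mult_right_mono) (auto simp: abs_le_iff intro: add_nonneg_nonneg)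
      finally show ?thesis .
    qed
    ultimately show ?thesis
      using nn unfolding C0 by (simp add: abs_le_iff)
  next
    case 3
    then have C2: "conformal_current p A \<sigma> \<phi> \<mu> z = 2 * u * y * Q - a \<bullet> c - U \<bullet> V"
      by (simp add: conformal_current_def defs Let_def)
    have "0 \<le> (u - y)\<^sup>2 * Q" "0 \<le> (u + y)\<^sup>2 * Q"
      using Q by simp_all
    then have "\<bar>2 * u * y * Q\<bar> \<le> (u\<^sup>2 + y\<^sup>2) * Q"
      by (simp add: abs_le_iff power2_eq_square algebra_simps)
    moreover have "(1 + u\<^sup>2 + y\<^sup>2) * Q = Q + (u\<^sup>2 + y\<^sup>2) * Q"
      by (simp add: algebra_simps)
    moreover have "\<bar>q - v - w\<bar> \<le> (s + r) / 2 + (Q + q')"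
      if "\<bar>q\<bar> \<le> q'" "\<bar>v\<bar> \<le> s / 2" "\<bar>w\<bar> \<le> r / 2" for q v w s r q' :: real
      using that Q unfolding add_divide_distrib by linarith
    ultimately show ?thesis
      using abs_inner_le_squares[of a c] abs_inner_le_squares[of U V]
      unfolding C0 C2 by presburger
  qed
qed

lemma conformal_current_density_ge:
  "(1 + (null_time \<sigma> z)\<^sup>2 + (z $ 2)\<^sup>2) * potential p \<phi> z \<le> conformal_current p A \<sigma> \<phi> 0 z"
  by (simp add: conformal_current_def Let_def)

text \<open>
  The left-hand side is the potential part of the flux through the null planes \<open>u = const\<close>;
  the rest of the flux is \<open>|D_2 \<phi>|^2 + |V|^2\<close>. This is what a weight decreasing in \<open>u\<close> gains.
\<close>

lemma conformal_current_null_flux_ge: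
  assumes "\<sigma> = 1 \<or> \<sigma> = - 1"
  shows "2 * (1 + (null_time \<sigma> z)\<^sup>2) * potential p \<phi> z \<le>
    conformal_current p A \<sigma> \<phi> 0 z - \<sigma> * conformal_current p A \<sigma> \<phi> 1 z"
proof -
  have "\<sigma> * \<sigma> = 1" using assms by auto
  then have "conformal_current p A \<sigma> \<phi> 0 z - \<sigma> * conformal_current p A \<sigma> \<phi> 1 z =
    cov A 2 \<phi> z \<bullet> cov A 2 \<phi> z + spinor_V A \<sigma> \<phi> z \<bullet> spinor_V A \<sigma> \<phi> z +
    2 * (1 + (null_time \<sigma> z)\<^sup>2) * potential p \<phi> z"
    by (simp add: conformal_current_def Let_def mult.assoc[symmetric])
      (simp add: field_simps)
  then show ?thesis by simp
qed

lemma event_components [simp]: "event t x $ 0 = t" "event t x $ 1 = x $ 1" "event t x $ 2 = x $ 2"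
  by (simp_all add: event_def)

lemma norm_add_sq_le: "(norm (a + b))\<^sup>2 \<le> 2 * (norm a)\<^sup>2 + 2 * (norm b)\<^sup>2" for a b :: "'a::real_inner"
proof -
  have "0 \<le> (a - b) \<bullet> (a - b)" by simp
  then show ?thesis by (simp add: power2_norm_eq_inner inner_add inner_diff inner_commute)
qed

text \<open>
  The coefficients of \<open>K\<close> grow quadratically, which is the growth allowed for by the weight in
  \<open>flux_density\<close>. The bound serves twice: at spatial infinity, and for the data at time zero.
\<close>

lemma conformal_current_density_le:
  assumes p: "1 < p" and \<sigma>: "\<sigma> = 1 \<or> \<sigma> = - 1" and t: "0 \<le> t"
  shows "conformal_current p A \<sigma> \<phi> 0 (event t x) \<le> 8 * (1 + t)\<^sup>2 * flux_density p A \<phi> t x"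
proof -
  define z where "z = event t x"
  define W where "W = ((1 + t) * (1 + norm x))\<^sup>2"
  define u y where "u = null_time \<sigma> z" and "y = z $ 2"
  define \<psi> where "\<psi> \<mu> = cov A \<mu> \<phi> z" for \<mu>
  define a b where "a = cov_minus A \<sigma> \<phi> z" and "b = cov_plus A \<sigma> \<phi> z"
  define N P where "N = (norm (\<phi> z))\<^sup>2" and "P = norm (\<phi> z) powr (p + 1)"
  define S where "S = (norm (\<psi> 0))\<^sup>2 + (norm (\<psi> 1))\<^sup>2 + (norm (\<psi> 2))\<^sup>2"
  have nn: "0 \<le> N" "0 \<le> P" "0 \<le> S" by (simp_all add: N_def P_def S_def)
  have tx: "t + norm x \<le> (1 + t) * (1 + norm x)" "norm x \<le> (1 + t) * (1 + norm x)"
    "1 \<le> (1 + t) * (1 + norm x)"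
    using t by (simp_all add: algebra_simps)
  have xi: "\<bar>x $ 1\<bar> \<le> norm x" "\<bar>x $ 2\<bar> \<le> norm x"
    using component_le_norm_cart by auto
  have "\<bar>u\<bar> \<le> t + norm x"
    using \<sigma> t xi(1) by (auto simp: u_def null_time_def z_def)
  then have u: "u\<^sup>2 \<le> W" and y: "y\<^sup>2 \<le> W" and W1: "1 \<le> W"
    unfolding W_def using tx xi
    by (auto simp: y_def z_def one_le_power intro!: abs_le_square_iff[THEN iffD1])
  have ab: "(norm a)\<^sup>2 \<le> 2 * (norm (\<psi> 0))\<^sup>2 + 2 * (norm (\<psi> 1))\<^sup>2"
    "(norm b)\<^sup>2 \<le> 2 * (norm (\<psi> 0))\<^sup>2 + 2 * (norm (\<psi> 1))\<^sup>2"
    using norm_add_sq_le[of "\<psi> 0" "- \<sigma> *\<^sub>R \<psi> 1"] norm_add_sq_le[of "\<psi> 0" "\<sigma> *\<^sub>R \<psi> 1"] \<sigma>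
    by (auto simp: a_def b_def cov_minus_def cov_plus_def \<psi>_def)
  have scale: "(norm (r *\<^sub>R w))\<^sup>2 \<le> W * (norm w)\<^sup>2" if "r\<^sup>2 \<le> W" for r and w :: complex
    using that by (simp add: power_mult_distrib mult_right_mono)
  have U: "(norm (spinor_U A \<sigma> \<phi> z))\<^sup>2 \<le> 4 * W * (norm a)\<^sup>2 + 4 * W * (norm (\<psi> 2))\<^sup>2 + 2 * N"
    using norm_add_sq_le[of "u *\<^sub>R a + y *\<^sub>R \<psi> 2" "\<phi> z"] norm_add_sq_le[of "u *\<^sub>R a" "y *\<^sub>R \<psi> 2"]
      scale[OF u, of a] scale[OF y, of "\<psi> 2"]
    unfolding spinor_U_def N_def \<psi>_def u_def y_def a_def by linarith
  have V: "(norm (spinor_V A \<sigma> \<phi> z))\<^sup>2 \<le> 2 * W * (norm b)\<^sup>2 + 2 * W * (norm (\<psi> 2))\<^sup>2"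
    using norm_add_sq_le[of "y *\<^sub>R b" "u *\<^sub>R \<psi> 2"] scale[OF y, of b] scale[OF u, of "\<psi> 2"]
    unfolding spinor_V_def \<psi>_def u_def y_def b_def by linarith
  have Q: "(1 + u\<^sup>2 + y\<^sup>2) * potential p \<phi> z \<le> 3 * W * P"
  proof (rule mult_mono)
    show "1 + u\<^sup>2 + y\<^sup>2 \<le> 3 * W" using u y W1 by simp
    show "potential p \<phi> z \<le> P"
      unfolding potential_def P_def using p by (simp add: divide_le_eq mult_le_cancel_left1)
  qed (use p W1 nn in \<open>auto simp: potential_nonneg\<close>)
  have Wa: "W * (norm a)\<^sup>2 \<le> W * (2 * (norm (\<psi> 0))\<^sup>2 + 2 * (norm (\<psi> 1))\<^sup>2)"
    "W * (norm b)\<^sup>2 \<le> W * (2 * (norm (\<psi> 0))\<^sup>2 + 2 * (norm (\<psi> 1))\<^sup>2)"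
    using ab W1 by (auto intro!: mult_left_mono)
  have W\<psi>: "0 \<le> W * (norm (\<psi> \<mu>))\<^sup>2" for \<mu> using W1 by simp
  have WS: "S \<le> W * S" using W1 nn mult_right_mono[of 1 W S] by simp
  have "conformal_current p A \<sigma> \<phi> 0 z = ((norm a)\<^sup>2 + (norm (\<psi> 2))\<^sup>2 +
      ((norm (spinor_U A \<sigma> \<phi> z))\<^sup>2 + (norm (spinor_V A \<sigma> \<phi> z))\<^sup>2)) / 2 + (1 + u\<^sup>2 + y\<^sup>2) * potential p \<phi> z"
    by (simp add: conformal_current_def Let_def power2_norm_eq_inner u_def y_def a_def \<psi>_def)
  also have "\<dots> \<le> 8 * (W * S) + 3 * (W * P) + N"
  proof -
    have "(norm a)\<^sup>2 + (norm (\<psi> 2))\<^sup>2 + ((norm (spinor_U A \<sigma> \<phi> z))\<^sup>2 + (norm (spinor_V A \<sigma> \<phi> z))\<^sup>2)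
        \<le> 2 * (8 * (W * S) + N)"
      using ab(1) Wa U V WS W\<psi>[of 0] W\<psi>[of 1] W\<psi>[of 2] zero_le_power2[of "norm (\<psi> 2)"]
      unfolding S_def distrib_left mult.left_commute[of W] mult.assoc by linarith
    then show ?thesis using Q unfolding mult.assoc by argo
  qed
  also have "\<dots> \<le> 8 * ((W * (S + P)) + (1 + t)\<^sup>2 * N)"
  proof -
    have "1 * N \<le> (1 + t)\<^sup>2 * N" using t nn by (intro mult_right_mono) (auto simp: one_le_power)
    moreover have "0 \<le> W * P" using W1 nn by simp
    ultimately show ?thesis using nn unfolding distrib_left by linarith
  qed
  also have "\<dots> = 8 * (1 + t)\<^sup>2 * flux_density p A \<phi> t x"
    unfolding W_def power_mult_distrib
    by (simp add: flux_density_def sum_spacetime S_def P_def N_def \<psi>_def z_def algebra_simps)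
  finally show ?thesis by (simp add: z_def)
qed

section \<open>Integration of compactly supported functions\<close>

lemma integral_translation:
  fixes f :: "'a::euclidean_space \<Rightarrow> real"
  assumes [measurable]: "f \<in> borel_measurable borel"
  shows "(\<integral>x. f (c + x) \<partial>lborel) = (\<integral>x. f x \<partial>lborel)"
proof -
  have "(\<integral>x. f x \<partial>lborel) = (\<integral>x. f x \<partial>distr lborel borel ((+) c))"
    by (simp only: lborel_distr_plus)
  also have "\<dots> = (\<integral>x. f (c + x) \<partial>lborel)"
    by (rule integral_distr) simp_all
  finally show ?thesis by simp
qed

lemma Fubini_interval_compact:
  fixes f :: "real \<Rightarrow> 'a::euclidean_space \<Rightarrow> real"
  assumes cont: "continuous_on ({a..b} \<times> K) (\<lambda>(s, x). f s x)" and K: "compact K"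
  defines "G \<equiv> \<lambda>s x. indicator {a..b} s * (indicator K x * f s x)"
  shows "(\<integral>x. \<integral>s. G s x \<partial>lborel \<partial>lborel) = (\<integral>s. \<integral>x. G s x \<partial>lborel \<partial>lborel)"
    and "integrable lborel (\<lambda>s. \<integral>x. G s x \<partial>lborel)"
proof -
  have "integrable lborel (\<lambda>z. indicator ({a..b} \<times> K) z *\<^sub>R (case z of (s, x) \<Rightarrow> f s x))"
    using cont K by (intro borel_integrable_compact compact_Times) auto
  also have "(\<lambda>z. indicator ({a..b} \<times> K) z *\<^sub>R (case z of (s, x) \<Rightarrow> f s x)) = case_prod G"
    by (auto simp: G_def fun_eq_iff indicator_def)
  finally have int: "integrable (lborel \<Otimes>\<^sub>M lborel) (case_prod G)"
    by (simp add: lborel_prod)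
  show "(\<integral>x. \<integral>s. G s x \<partial>lborel \<partial>lborel) = (\<integral>s. \<integral>x. G s x \<partial>lborel \<partial>lborel)"
    by (rule lborel_pair.Fubini_integral[OF int])
  show "integrable lborel (\<lambda>s. \<integral>x. G s x \<partial>lborel)"
    using lborel_pair.integrable_fst[OF int] by simp
qed

lemma integrable_compact_support:
  fixes f :: "'a::euclidean_space \<Rightarrow> real"
  assumes "continuous_on UNIV f" "compact K" "\<And>x. x \<notin> K \<Longrightarrow> f x = 0"
  shows "integrable lborel f"
proof -
  have "integrable lborel (\<lambda>x. indicator K x *\<^sub>R f x)"
    using assms by (intro borel_integrable_compact continuous_on_subset[OF assms(1)]) auto
  also have "(\<lambda>x. indicator K x *\<^sub>R f x) = f"
    using assms(3) by (auto simp: indicator_def fun_eq_iff)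
  finally show ?thesis .
qed

text \<open>
  Integrate \<open>f (x + e) - f x\<close>, which is the integral of the derivative along the segment from \<open>x\<close> to
  \<open>x + e\<close>, over all \<open>x\<close> and use translation invariance twice. This gives integration by parts
  without splitting the space into coordinates.
\<close>

lemma integral_directional_derivative_eq_0:
  fixes f d :: "'a::euclidean_space \<Rightarrow> real"
  assumes f: "\<And>x. ((\<lambda>s. f (x + s *\<^sub>R e)) has_real_derivative d x) (at 0)"
    and cont: "continuous_on UNIV f" "continuous_on UNIV d"
    and supp: "\<And>x. x \<notin> cball 0 R \<Longrightarrow> f x = 0" "\<And>x. x \<notin> cball 0 R \<Longrightarrow> d x = 0"
  shows "(\<integral>x. d x \<partial>lborel) = 0"
proof -
  define K where "K = cball (0::'a) (R + norm e)"
  have K: "compact K" by (simp add: K_def)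
  have outside: "x + s *\<^sub>R e \<notin> cball 0 R" if "x \<notin> K" "s \<in> {0..1}" for x s
  proof -
    have "norm x \<le> norm (x + s *\<^sub>R e) + norm (s *\<^sub>R e)"
      using norm_triangle_ineq4[of "x + s *\<^sub>R e" "s *\<^sub>R e"] by simp
    also have "norm (s *\<^sub>R e) \<le> norm e"
      using that(2) mult_right_mono[of s 1 "norm e"] by simp
    finally show ?thesis using that(1) by (simp add: K_def)
  qed
  have meas: "f \<in> borel_measurable borel" "d \<in> borel_measurable borel"
    using cont by (auto intro: borel_measurable_continuous_onI)
  have int_f: "integrable lborel f"
    by (rule integrable_compact_support[OF cont(1), of "cball 0 R"]) (use supp in auto)
  have int_f': "integrable lborel (\<lambda>x. f (x + e))"
  proof (rule integrable_compact_support[OF _ K])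
    show "continuous_on UNIV (\<lambda>x. f (x + e))"
      by (rule continuous_on_compose2[OF cont(1)]) (auto intro!: continuous_intros)
    show "f (x + e) = 0" if "x \<notin> K" for x
      using supp(1) outside[OF that, of 1] by simp
  qed
  have df: "((\<lambda>s. f (x + s *\<^sub>R e)) has_real_derivative d (x + s *\<^sub>R e)) (at s)" for x s
  proof -
    have "((\<lambda>t. f (x + (s + t) *\<^sub>R e)) has_real_derivative d (x + s *\<^sub>R e)) (at 0)"
      using f[of "x + s *\<^sub>R e"] by (simp add: algebra_simps)
    then show ?thesis
      using DERIV_shift[of "\<lambda>t. f (x + t *\<^sub>R e)" _ 0 s] by (simp add: add.commute)
  qed
  have contd: "continuous_on S (\<lambda>(s, x). d (x + s *\<^sub>R e))" for S
    unfolding case_prod_unfold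
    by (rule continuous_on_compose2[OF cont(2)]) (auto intro!: continuous_intros)
  have FTC: "(\<integral>s. indicator {0..1} s * (indicator K x * d (x + s *\<^sub>R e)) \<partial>lborel) = f (x + e) - f x" for x
  proof -
    have "(\<integral>s. indicator {0..1} s * (indicator K x * d (x + s *\<^sub>R e)) \<partial>lborel) =
        (\<integral>s. indicator {0..1} s *\<^sub>R d (x + s *\<^sub>R e) \<partial>lborel)"
      using supp(2) outside by (intro Bochner_Integration.integral_cong) (auto simp: indicator_def)
    also have "\<dots> = f (x + 1 *\<^sub>R e) - f (x + 0 *\<^sub>R e)"
    proof (rule integral_FTC_atLeastAtMost)
      show "((\<lambda>s. f (x + s *\<^sub>R e)) has_vector_derivative d (x + s *\<^sub>R e)) (at s within {0..1})" for s
        using df by (simp add: has_real_derivative_iff_has_vector_derivative has_vector_derivative_at_within)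
      show "continuous_on {0..1} (\<lambda>s. d (x + s *\<^sub>R e))"
        by (rule continuous_on_compose2[OF cont(2)]) (auto intro!: continuous_intros)
    qed simp
    finally show ?thesis by simp
  qed
  have shifted: "(\<integral>x. indicator {0..1} s * (indicator K x * d (x + s *\<^sub>R e)) \<partial>lborel) =
      indicator {0..1} s * (\<integral>x. d x \<partial>lborel)" for s :: real
  proof -
    have "(\<integral>x. indicator {0..1} s * (indicator K x * d (x + s *\<^sub>R e)) \<partial>lborel) =
        (\<integral>x. indicator {0..1} s * d (s *\<^sub>R e + x) \<partial>lborel)"
      using supp(2) outside by (intro Bochner_Integration.integral_cong) (auto simp: indicator_def add.commute)
    then show ?thesis
      using integral_translation[OF meas(2), of "s *\<^sub>R e"] by simp
  qed
  have "0 = (\<integral>x. f (x + e) - f x \<partial>lborel)"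
    using int_f int_f' integral_translation[OF meas(1), of e] by (simp add: add.commute)
  also have "\<dots> = (\<integral>x. \<integral>s. indicator {0..1} s * (indicator K x * d (x + s *\<^sub>R e)) \<partial>lborel \<partial>lborel)"
    by (simp only: FTC)
  also have "\<dots> = (\<integral>s. \<integral>x. indicator {0..1} s * (indicator K x * d (x + s *\<^sub>R e)) \<partial>lborel \<partial>lborel)"
    by (rule Fubini_interval_compact(1)[OF contd K])
  also have "\<dots> = (\<integral>s. indicator {0..1::real} s * (\<integral>x. d x \<partial>lborel) \<partial>lborel)"
    by (simp only: shifted)
  also have "\<dots> = (\<integral>x. d x \<partial>lborel)"
    by simp
  finally show ?thesis by simp
qed

lemma ennreal_subadditive: "ennreal (a + b) \<le> ennreal a + ennreal b"
proof (cases "0 \<le> a \<and> 0 \<le> b")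
  case False
  then have "a + b \<le> a \<or> a + b \<le> b" by auto
  then show ?thesis
    using ennreal_leI[of "a + b" a] ennreal_leI[of "a + b" b] by (meson add_increasing add_increasing2 zero_le)
qed simp

lemma nn_integral_cball_LIMSEQ:
  fixes f :: "'a::euclidean_space \<Rightarrow> ennreal"
  assumes [measurable]: "f \<in> borel_measurable borel"
  shows "(\<lambda>n. \<integral>\<^sup>+x\<in>cball 0 (real (Suc n)). f x \<partial>lborel) \<longlonglongrightarrow> (\<integral>\<^sup>+x. f x \<partial>lborel)"
proof (rule nn_integral_LIMSEQ)
  show "incseq (\<lambda>n x. f x * indicator (cball 0 (real (Suc n))) x)"
    by (auto simp: incseq_def le_fun_def indicator_def)
  show "(\<lambda>n. f x * indicator (cball 0 (real (Suc n))) x) \<longlonglongrightarrow> f x" for x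
  proof (rule tendsto_eventually)
    obtain N where N: "norm x \<le> real N" using real_arch_simple by blast
    show "\<forall>\<^sub>F n in sequentially. f x * indicator (cball 0 (real (Suc n))) x = f x"
      using eventually_ge_at_top[of N] by eventually_elim (use N in \<open>auto simp: indicator_def\<close>)
  qed
  show "(\<lambda>x. f x * indicator (cball 0 (real (Suc n))) x) \<in> borel_measurable lborel" for n
    by (intro borel_measurable_times_ennreal borel_measurable_indicator) auto
qed

lemma positive_part_square_has_derivative:
  "((\<lambda>s. (max 0 s)\<^sup>2) has_real_derivative 2 * max 0 s) (at s)" for s :: real
proof -
  consider "s < 0" | "s = 0" | "0 < s" by linarith
  then show ?thesis
  proof cases
    case 1
    have "((\<lambda>s::real. 0) has_real_derivative 2 * max 0 s) (at s)" using 1 by simp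
    then show ?thesis
      by (rule has_field_derivative_transform_within_open[where S = "{..<0}"]) (use 1 in auto)
  next
    case 2
    have "(\<lambda>h::real. (max 0 h)\<^sup>2 / h) \<midarrow>0\<rightarrow> 0"
    proof (rule Lim_null_comparison)
      show "\<forall>\<^sub>F h in at 0. norm ((max 0 h)\<^sup>2 / h) \<le> \<bar>h\<bar>"
        by (auto simp: max_def power2_eq_square)
      show "(\<lambda>h::real. \<bar>h\<bar>) \<midarrow>0\<rightarrow> 0" by (rule tendsto_rabs_zero) simp
    qed
    then show ?thesis using 2 by (simp add: DERIV_def)
  next
    case 3
    have "((\<lambda>s::real. s\<^sup>2) has_real_derivative 2 * max 0 s) (at s)"
      using 3 by (auto intro!: derivative_eq_intros)
    then show ?thesis
      by (rule has_field_derivative_transform_within_open[where S = "{0<..}"]) (use 3 in auto)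
  qed
qed

text \<open>
  A continuously differentiable cutoff suffices for one integration by parts, and \<open>(max 0 s)^2\<close>
  is continuously differentiable; two nested copies of it make the cutoff constant both inside radius
  \<open>R\<close> and outside radius \<open>2 R\<close>.
\<close>

lemma smooth_cutoff:
  fixes R :: real
  assumes R: "0 < R"
  obtains \<eta> :: "'a::euclidean_space \<Rightarrow> real" and g :: "'a \<Rightarrow> 'a" where
    "\<And>x. (\<eta> has_derivative (\<lambda>h. g x \<bullet> h)) (at x)" "continuous_on UNIV g"
    "\<And>x. 0 \<le> \<eta> x" "\<And>x. \<eta> x \<le> 1" "\<And>x. norm x \<le> R \<Longrightarrow> \<eta> x = 1" "\<And>x. 2 * R \<le> norm x \<Longrightarrow> \<eta> x = 0"
    "\<And>x. norm (g x) \<le> 16 / R * indicator {x. R \<le> norm x \<and> norm x \<le> 2 * R} x"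
proof
  define m where "m x = max 0 (x \<bullet> x / R\<^sup>2 - 1)" for x :: 'a
  define \<eta> where "\<eta> x = (max 0 (1 - (m x)\<^sup>2))\<^sup>2" for x :: 'a
  define g where "g x = (- 8 * max 0 (1 - (m x)\<^sup>2) * m x / R\<^sup>2) *\<^sub>R x" for x :: 'a
  have dm: "((\<lambda>x. 1 - (m x)\<^sup>2) has_derivative (\<lambda>h. - (2 * m x) * (2 * (x \<bullet> h) / R\<^sup>2))) (at x)" for x
  proof -
    have "((\<lambda>x. x \<bullet> x / R\<^sup>2 - 1) has_derivative (\<lambda>h. 2 * (x \<bullet> h) / R\<^sup>2)) (at x)"
      using R by (auto intro!: derivative_eq_intros simp: inner_commute field_simps)
    from has_derivative_compose[OF this positive_part_square_has_derivative[THEN has_field_derivative_imp_has_derivative]]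
    have "((\<lambda>x. (m x)\<^sup>2) has_derivative (\<lambda>h. 2 * m x * (2 * (x \<bullet> h) / R\<^sup>2))) (at x)"
      by (simp add: m_def)
    from has_derivative_diff[OF has_derivative_const[of 1] this] show ?thesis by simp
  qed
  show "(\<eta> has_derivative (\<lambda>h. g x \<bullet> h)) (at x)" for x
    using has_derivative_compose[OF dm[of x] positive_part_square_has_derivative[THEN has_field_derivative_imp_has_derivative]]
    unfolding \<eta>_def[abs_def] by (simp add: g_def mult_ac)
  show "continuous_on UNIV g"
    unfolding g_def m_def using R by (intro continuous_intros) auto
  have m0: "0 \<le> m x" for x by (simp add: m_def)
  have n2: "x \<bullet> x / R\<^sup>2 = (norm x / R)\<^sup>2" for x :: 'a
    by (simp add: power2_norm_eq_inner[symmetric] power_divide)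
  show "0 \<le> \<eta> x" "\<eta> x \<le> 1" for x
    by (auto simp: \<eta>_def intro!: power_le_one)
  have inner: "m x = 0" if "norm x \<le> R" for x
    using that R by (simp add: m_def n2 power_le_one divide_le_eq)
  show "\<eta> x = 1" if "norm x \<le> R" for x
    using inner[OF that] by (simp add: \<eta>_def)
  have outer: "max 0 (1 - (m x)\<^sup>2) = 0" if "2 * R \<le> norm x" for x
  proof -
    have "2 \<le> norm x / R" using that R by (simp add: le_divide_eq)
    then have "2\<^sup>2 \<le> (norm x / R)\<^sup>2" by (intro power_mono) auto
    then have "1 \<le> m x" by (simp add: m_def n2)
    then show ?thesis by (simp add: one_le_power)
  qed
  show "\<eta> x = 0" if "2 * R \<le> norm x" for x
    using outer[OF that] by (simp add: \<eta>_def)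
  show "norm (g x) \<le> 16 / R * indicator {x. R \<le> norm x \<and> norm x \<le> 2 * R} x" for x
  proof (cases "R \<le> norm x \<and> norm x \<le> 2 * R")
    case True
    have "max 0 (1 - (m x)\<^sup>2) * m x \<le> 1"
    proof (cases "m x \<le> 1")
      case True
      then show ?thesis using m0[of x] by (intro mult_le_one) (auto simp: power_le_one)
    next
      case False
      then have "1 < (m x)\<^sup>2" by (intro one_less_power) auto
      then show ?thesis by simp
    qed
    then have "8 * (max 0 (1 - (m x)\<^sup>2) * m x) / R\<^sup>2 * norm x \<le> 8 * 1 / R\<^sup>2 * norm x"
      by (intro mult_right_mono divide_right_mono mult_left_mono) auto
    moreover have "norm (g x) = 8 * (max 0 (1 - (m x)\<^sup>2) * m x) / R\<^sup>2 * norm x"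
      using m0[of x] by (simp add: g_def abs_mult)
    ultimately have "norm (g x) \<le> 8 * 1 / R\<^sup>2 * norm x"
      by simp
    also have "\<dots> \<le> 8 * 1 / R\<^sup>2 * (2 * R)"
      using True R by (intro mult_left_mono) auto
    also have "\<dots> = 16 / R" using R by (simp add: power2_eq_square)
    finally show ?thesis using True by simp
  next
    case False
    then show ?thesis
      using inner[of x] outer[of x] by (auto simp: g_def not_le)
  qed
qed

section \<open>Currents with nonpositive divergence\<close>

lemma event_in_future [simp]: "event s x \<in> future \<longleftrightarrow> 0 \<le> s"
  by (simp add: future_def)

lemma vec3_eq_iff: "z = w \<longleftrightarrow> z $ 0 = w $ 0 \<and> z $ 1 = w $ 1 \<and> z $ 2 = w $ 2" for z w :: "'a^3"
proof -
  have "(3 :: 3) = 0" by simp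
  then show ?thesis unfolding vec_eq_iff forall_3 by metis
qed

lemma event_eq: "event s x = s *\<^sub>R axis 0 1 + (x $ 1) *\<^sub>R axis 1 1 + (x $ 2) *\<^sub>R axis 2 1"
  by (simp add: vec3_eq_iff axis_def)

lemma event_add_axis:
  "event s (x + r *\<^sub>R axis i 1) = event s x + r *\<^sub>R axis (spacetime_index i) 1"
  using exhaust_2[of i] by (auto simp: vec3_eq_iff axis_def spacetime_index_def)

lemma continuous_on_event [continuous_intros]:
  "continuous_on S f \<Longrightarrow> continuous_on S g \<Longrightarrow> continuous_on S (\<lambda>x. event (f x) (g x))"
  unfolding event_eq by (intro continuous_intros)

lemma continuous_on_compose_event:
  assumes "continuous_on future f" "\<And>s x. (s, x) \<in> S \<Longrightarrow> 0 \<le> s"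
  shows "continuous_on S (\<lambda>(s, x). f (event s x))"
  unfolding case_prod_unfold
  by (rule continuous_on_compose2[OF assms(1)]) (use assms(2) in \<open>auto intro!: continuous_intros\<close>)

lemma continuous_on_slice: "continuous_on future f \<Longrightarrow> 0 \<le> s \<Longrightarrow> continuous_on S (\<lambda>x. f (event s x))"
  by (rule continuous_on_compose2[of future f]) (auto intro!: continuous_intros)

lemma C1_future_time_derivative:
  fixes f :: "real^3 \<Rightarrow> real"
  assumes f: "C1_future f" and s: "0 \<le> s" "s \<le> t"
  shows "((\<lambda>s. f (event s x)) has_vector_derivative partial 0 f (event s x)) (at s within {0..t})"
proof -
  define D where "D = frechet_derivative f (at (event s x) within future)"
  have D: "(f has_derivative D) (at (event s x) within future)"
    unfolding D_def using C1_future_has_derivative[OF f] s by simp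
  have "((\<lambda>s. event s x) has_derivative (\<lambda>h. h *\<^sub>R axis 0 1)) (at s within {0..t})"
    unfolding event_eq by (auto intro!: derivative_eq_intros)
  moreover have "(f has_derivative D) (at (event s x) within (\<lambda>s. event s x) ` {0..t})"
    by (rule has_derivative_subset[OF D]) auto
  ultimately have "((\<lambda>s. f (event s x)) has_derivative (\<lambda>h. D (h *\<^sub>R axis 0 1))) (at s within {0..t})"
    by (rule has_derivative_in_compose)
  moreover have "D (h *\<^sub>R axis 0 1) = h *\<^sub>R partial 0 f (event s x)" for h
    using has_derivative_bounded_linear[OF D]
    by (simp add: D_def partial_def linear_cmul bounded_linear.linear)
  ultimately show ?thesis by (simp add: has_vector_derivative_def)
qed

lemma integral_cutoff_divergence:
  fixes f :: "real^3 \<Rightarrow> real" and \<eta> :: "real^2 \<Rightarrow> real"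
  assumes f: "C1_future f" and s: "0 < s"
    and \<eta>: "\<And>x. (\<eta> has_derivative (\<lambda>h. g x \<bullet> h)) (at x)" "continuous_on UNIV g"
    and supp: "\<And>x. x \<notin> cball 0 R \<Longrightarrow> \<eta> x = 0" "\<And>x. x \<notin> cball 0 R \<Longrightarrow> g x = 0"
  shows "(\<integral>x. \<eta> x * partial (spacetime_index i) f (event s x) \<partial>lborel) =
    - (\<integral>x. g x $ i * f (event s x) \<partial>lborel)"
proof -
  let ?d = "\<lambda>x. \<eta> x * partial (spacetime_index i) f (event s x) + g x $ i * f (event s x)"
  have cont: "continuous_on UNIV \<eta>"
    using \<eta>(1) by (meson has_derivative_continuous continuous_at_imp_continuous_on)
  have contf: "continuous_on UNIV (\<lambda>x. f (event s x))"
    "continuous_on UNIV (\<lambda>x. partial \<mu> f (event s x))" for \<mu>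
    using f s by (auto intro!: continuous_on_slice C1_future_continuous C1_future_continuous_partial)
  have "(\<integral>x. ?d x \<partial>lborel) = 0"
  proof (rule integral_directional_derivative_eq_0[where R = R and e = "axis i 1"])
    show "((\<lambda>r. \<eta> (x + r *\<^sub>R axis i 1) * f (event s (x + r *\<^sub>R axis i 1))) has_real_derivative ?d x) (at 0)" for x
    proof -
      have "((\<lambda>r. \<eta> (x + r *\<^sub>R axis i 1)) has_derivative (\<lambda>h. g (x + 0 *\<^sub>R axis i 1) \<bullet> (h *\<^sub>R axis i 1))) (at 0)"
        by (rule has_derivative_compose[where f = "\<lambda>r. x + r *\<^sub>R axis i 1", OF _ \<eta>(1)])
          (auto intro!: derivative_eq_intros)
      then have "((\<lambda>r. \<eta> (x + r *\<^sub>R axis i 1)) has_real_derivative g x $ i) (at 0)"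
        by (simp add: has_field_derivative_def inner_axis mult_commute_abs)
      moreover have "((\<lambda>r. f (event s x + r *\<^sub>R axis (spacetime_index i) 1)) has_real_derivative
          partial (spacetime_index i) f (event s x)) (at 0)"
        by (rule C1_future_has_directional_derivative[OF f _ bounded_linear_ident]) (use s in simp)
      ultimately show ?thesis
        unfolding event_add_axis by (rule DERIV_cong[OF DERIV_mult]) simp
    qed
    show "continuous_on UNIV (\<lambda>x. \<eta> x * f (event s x))" "continuous_on UNIV ?d"
      using cont \<eta>(2) contf by (auto intro!: continuous_intros)
  qed (use supp in auto)
  moreover have "integrable lborel (\<lambda>x. \<eta> x * partial (spacetime_index i) f (event s x))"
    "integrable lborel (\<lambda>x. g x $ i * f (event s x))"
    using cont \<eta>(2) contf supp
    by (auto intro!: integrable_compact_support[of _ "cball 0 R"] continuous_intros)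
  ultimately show ?thesis by simp
qed

text \<open>
  Multiply the current by a cutoff at radius \<open>R\<close> and integrate over the slab between the times
  \<open>0\<close> and \<open>t\<close>. The divergence has the good sign, and the derivative of the cutoff produces an
  error bounded by \<open>1 / R\<close> times the integral of \<open>w\<close> over the slab with \<open>R \<le> |x| \<le> 2 R\<close>, which
  tends to zero.
\<close>

lemma current_inequality:
  fixes J :: "3 \<Rightarrow> real^3 \<Rightarrow> real" and w :: "real \<Rightarrow> real^2 \<Rightarrow> real"
  assumes C1: "\<And>\<mu>. C1_future (J \<mu>)"
    and div: "\<And>z. 0 < z $ 0 \<Longrightarrow> (\<Sum>\<mu>\<in>UNIV. partial \<mu> (J \<mu>) z) \<le> 0"
    and nonneg: "\<And>z. z \<in> future \<Longrightarrow> 0 \<le> J 0 z"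
    and t: "0 < t" and K: "0 \<le> K"
    and bound: "\<And>s x i. 0 \<le> s \<Longrightarrow> s \<le> t \<Longrightarrow> \<bar>J (spacetime_index i) (event s x)\<bar> \<le> K * w s x"
    and w: "continuous_on ({0..} \<times> UNIV) (\<lambda>(s, x). w s x)"
    and decay: "((\<lambda>R. (\<integral>\<^sup>+s\<in>{0..t}. (\<integral>\<^sup>+x\<in>{x. R \<le> norm x \<and> norm x \<le> 2 * R}.
        ennreal (w s x) \<partial>lborel) \<partial>lborel) / ennreal R) \<longlongrightarrow> 0) at_top"
  shows "(\<integral>\<^sup>+x. ennreal (J 0 (event t x)) \<partial>lborel) \<le> (\<integral>\<^sup>+x. ennreal (J 0 (event 0 x)) \<partial>lborel)"
proof -
  define ann where "ann R = {x :: real^2. R \<le> norm x \<and> norm x \<le> 2 * R}" for R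
  define I where "I R = (\<integral>\<^sup>+s\<in>{0..t}. (\<integral>\<^sup>+x\<in>ann R. ennreal (w s x) \<partial>lborel) \<partial>lborel)" for R
  have ann_meas [measurable]: "ann R \<in> sets borel" for R
    unfolding ann_def by measurable
  have cont: "continuous_on UNIV (\<lambda>x. J \<mu> (event s x))" "continuous_on UNIV (\<lambda>x. partial \<nu> (J \<mu>) (event s x))"
    if "0 \<le> s" for s \<mu> \<nu>
    using C1 that by (auto intro!: continuous_on_slice C1_future_continuous C1_future_continuous_partial)
  have slice_meas: "(\<lambda>x. J 0 (event s x)) \<in> borel_measurable borel" if "0 \<le> s" for s
    using cont(1)[OF that] by (rule borel_measurable_continuous_onI)
  have cut: "(\<integral>\<^sup>+x\<in>cball 0 R. ennreal (J 0 (event t x)) \<partial>lborel) \<le>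
      (\<integral>\<^sup>+x. ennreal (J 0 (event 0 x)) \<partial>lborel) + ennreal (32 * K) * (I R / ennreal R)" if R: "0 < R" for R
  proof -
    obtain \<eta> :: "real^2 \<Rightarrow> real" and g where
      \<eta>: "\<And>x. (\<eta> has_derivative (\<lambda>h. g x \<bullet> h)) (at x)" and g: "continuous_on UNIV g"
      and \<eta>01: "\<And>x. 0 \<le> \<eta> x" "\<And>x. \<eta> x \<le> 1" and \<eta>1: "\<And>x. norm x \<le> R \<Longrightarrow> \<eta> x = 1"
      and \<eta>0: "\<And>x. 2 * R \<le> norm x \<Longrightarrow> \<eta> x = 0"
      and g_le: "\<And>x. norm (g x) \<le> 16 / R * indicator {x. R \<le> norm x \<and> norm x \<le> 2 * R} x"
      using smooth_cutoff[OF R, where 'a = "real^2"] by blast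
    let ?B = "cball (0 :: real^2) (2 * R)"
    have supp: "\<eta> x = 0" "g x = 0" if "x \<notin> ?B" for x
      using that \<eta>0[of x] g_le[of x] by (auto simp: indicator_def)
    have cont\<eta>: "continuous_on S \<eta>" for S
      using \<eta> by (meson has_derivative_continuous continuous_at_imp_continuous_on)
    have int: "integrable lborel (\<lambda>x. \<eta> x * J 0 (event s x))"
      "integrable lborel (\<lambda>x. \<eta> x * partial \<mu> (J \<mu>) (event s x))"
      "integrable lborel (\<lambda>x. g x $ i * J \<mu> (event s x))" if "0 \<le> s" for s \<mu> i
      using cont\<eta> g cont[OF that] supp
      by (auto intro!: integrable_compact_support[of _ ?B] continuous_intros)
    define flux where "flux s x = (\<Sum>i\<in>UNIV. g x $ i * J (spacetime_index i) (event s x))" for s x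
    have flux_cont: "continuous_on ({0..t} \<times> ?B) (\<lambda>(s, x). flux s x)"
      unfolding flux_def case_prod_unfold
      by (intro continuous_intros continuous_on_compose2[OF g] 
          continuous_on_compose_event[unfolded case_prod_unfold] C1_future_continuous C1) auto
    have J0_cont: "continuous_on ({0..t} \<times> ?B) (\<lambda>(s, x). \<eta> x * partial 0 (J 0) (event s x))"
      unfolding case_prod_unfold
      by (intro continuous_intros continuous_on_compose2[OF cont\<eta>[of UNIV]]
          continuous_on_compose_event[unfolded case_prod_unfold] C1_future_continuous_partial C1) auto
    have FTC: "(\<integral>s. indicator {0..t} s * (indicator ?B x * (\<eta> x * partial 0 (J 0) (event s x))) \<partial>lborel) =
        \<eta> x * J 0 (event t x) - \<eta> x * J 0 (event 0 x)" for x
    proof -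
      have "(\<integral>s. indicator {0..t} s *\<^sub>R partial 0 (J 0) (event s x) \<partial>lborel) =
          J 0 (event t x) - J 0 (event 0 x)"
      proof (rule integral_FTC_atLeastAtMost)
        show "continuous_on {0..t} (\<lambda>s. partial 0 (J 0) (event s x))"
          by (rule continuous_on_compose2[OF C1_future_continuous_partial[OF C1]])
            (auto intro!: continuous_intros)
      qed (use t C1_future_time_derivative[OF C1] in auto)
      moreover have "(\<integral>s. indicator {0..t} s * (indicator ?B x * (\<eta> x * partial 0 (J 0) (event s x))) \<partial>lborel) =
          (\<integral>s. \<eta> x * (indicator {0..t} s *\<^sub>R partial 0 (J 0) (event s x)) \<partial>lborel)"
        using supp(1)[of x] by (intro Bochner_Integration.integral_cong) (auto simp: indicator_def)
      ultimately show ?thesis by (simp add: right_diff_distrib)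
    qed
    \<comment> \<open>The sign of the divergence is known at positive times; the single time zero has measure zero.\<close>
    have slice: "(\<integral>x. indicator {0..t} s * (indicator ?B x * (\<eta> x * partial 0 (J 0) (event s x))) \<partial>lborel) \<le>
        (\<integral>x. indicator {0..t} s * (indicator ?B x * flux s x) \<partial>lborel)" if "s \<noteq> 0" for s
    proof (cases "s \<in> {0..t}")
      case True
      then have s: "0 < s" using that by auto
      have "(\<integral>x. indicator {0..t} s * (indicator ?B x * (\<eta> x * partial 0 (J 0) (event s x))) \<partial>lborel) =
          (\<integral>x. \<eta> x * partial 0 (J 0) (event s x) \<partial>lborel)"
        using supp True by (intro Bochner_Integration.integral_cong) (auto simp: indicator_def)
      also have "\<dots> \<le> (\<integral>x. - (\<eta> x * partial 1 (J 1) (event s x)) - \<eta> x * partial 2 (J 2) (event s x) \<partial>lborel)"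
      proof (rule integral_mono)
        fix x
        have "\<eta> x * (partial 0 (J 0) (event s x) + partial 1 (J 1) (event s x) + partial 2 (J 2) (event s x)) \<le> 0"
          using div[of "event s x"] s \<eta>01(1)[of x]
          by (intro mult_nonneg_nonpos) (auto simp: sum_spacetime)
        then show "\<eta> x * partial 0 (J 0) (event s x) \<le>
            - (\<eta> x * partial 1 (J 1) (event s x)) - \<eta> x * partial 2 (J 2) (event s x)"
          unfolding distrib_left by linarith
      qed (use int s in auto)
      also have "\<dots> = (\<integral>x. g x $ 1 * J 1 (event s x) \<partial>lborel) + (\<integral>x. g x $ 2 * J 2 (event s x) \<partial>lborel)"
        using integral_cutoff_divergence[OF C1 s \<eta> g supp, where i = 1]
          integral_cutoff_divergence[OF C1 s \<eta> g supp, where i = 2] int s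
        by (simp add: spacetime_index_def)
      also have "\<dots> = (\<integral>x. flux s x \<partial>lborel)"
        using int s by (simp add: flux_def sum_2 spacetime_index_def)
      also have "\<dots> = (\<integral>x. indicator {0..t} s * (indicator ?B x * flux s x) \<partial>lborel)"
        using supp True by (intro Bochner_Integration.integral_cong) (auto simp: indicator_def flux_def)
      finally show ?thesis .
    qed simp
    have "(\<integral>x. \<eta> x * J 0 (event t x) \<partial>lborel) - (\<integral>x. \<eta> x * J 0 (event 0 x) \<partial>lborel) =
        (\<integral>x. \<eta> x * J 0 (event t x) - \<eta> x * J 0 (event 0 x) \<partial>lborel)"
      using int t by simp
    also have "\<dots> = (\<integral>s. \<integral>x. indicator {0..t} s * (indicator ?B x * (\<eta> x * partial 0 (J 0) (event s x))) \<partial>lborel \<partial>lborel)"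
      unfolding FTC[symmetric] by (rule Fubini_interval_compact(1)[OF J0_cont compact_cball])
    also have "\<dots> \<le> (\<integral>s. \<integral>x. indicator {0..t} s * (indicator ?B x * flux s x) \<partial>lborel \<partial>lborel)"
    proof (rule integral_mono_AE)
      show "AE s in lborel. (\<integral>x. indicator {0..t} s * (indicator ?B x * (\<eta> x * partial 0 (J 0) (event s x))) \<partial>lborel) \<le>
          (\<integral>x. indicator {0..t} s * (indicator ?B x * flux s x) \<partial>lborel)"
        using AE_lborel_singleton[of 0] by eventually_elim (rule slice)
    qed (rule Fubini_interval_compact(2)[OF J0_cont compact_cball]
        Fubini_interval_compact(2)[OF flux_cont compact_cball])+
    finally have real_ineq: "(\<integral>x. \<eta> x * J 0 (event t x) \<partial>lborel) \<le> (\<integral>x. \<eta> x * J 0 (event 0 x) \<partial>lborel) +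
        (\<integral>s. \<integral>x. indicator {0..t} s * (indicator ?B x * flux s x) \<partial>lborel \<partial>lborel)" by simp
    have flux_le: "\<bar>flux s x\<bar> \<le> 32 * K / R * w s x * indicator (ann R) x" if "s \<in> {0..t}" for s x
    proof -
      have "\<bar>g x $ i * J (spacetime_index i) (event s x)\<bar> \<le> (16 / R * indicator (ann R) x) * (K * w s x)" for i
        unfolding abs_mult
        using order_trans[OF component_le_norm_cart[of "g x" i] g_le[of x]] bound[of s i x] that R
        by (intro mult_mono) (auto simp: ann_def)
      then have "\<bar>flux s x\<bar> \<le> (16 / R * indicator (ann R) x) * (K * w s x) + (16 / R * indicator (ann R) x) * (K * w s x)"
        unfolding flux_def sum_2 by (meson abs_triangle_ineq add_mono order_trans)
      then show ?thesis by (simp add: field_simps)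
    qed
    have "ennreal (\<integral>s. \<integral>x. indicator {0..t} s * (indicator ?B x * flux s x) \<partial>lborel \<partial>lborel) \<le>
        ennreal \<bar>\<integral>s. \<integral>x. indicator {0..t} s * (indicator ?B x * flux s x) \<partial>lborel \<partial>lborel\<bar>"
      by (intro ennreal_leI) simp
    also have "\<dots> \<le> (\<integral>\<^sup>+s. ennreal \<bar>\<integral>x. indicator {0..t} s * (indicator ?B x * flux s x) \<partial>lborel\<bar> \<partial>lborel)"
      using integral_norm_bound_ennreal[OF Fubini_interval_compact(2)[OF flux_cont compact_cball]]
      by simp
    also have "\<dots> \<le> (\<integral>\<^sup>+s. (ennreal (32 * K / R) * (\<integral>\<^sup>+x\<in>ann R. ennreal (w s x) \<partial>lborel)) * indicator {0..t} s \<partial>lborel)"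
    proof (rule nn_integral_mono)
      fix s :: real
      show "ennreal \<bar>\<integral>x. indicator {0..t} s * (indicator ?B x * flux s x) \<partial>lborel\<bar> \<le>
        (ennreal (32 * K / R) * (\<integral>\<^sup>+x\<in>ann R. ennreal (w s x) \<partial>lborel)) * indicator {0..t} s"
      proof (cases "s \<in> {0..t}")
        case True
        have ws: "continuous_on UNIV (w s)"
          using True continuous_on_compose2[OF w continuous_on_Pair[OF continuous_on_const continuous_on_id], of s UNIV]
          by auto
        have [measurable]: "w s \<in> borel_measurable borel"
          using ws by (rule borel_measurable_continuous_onI)
        have "ennreal \<bar>\<integral>x. indicator {0..t} s * (indicator ?B x * flux s x) \<partial>lborel\<bar> = ennreal \<bar>\<integral>x. flux s x \<partial>lborel\<bar>"
          using True supp by (intro arg_cong[where f = "\<lambda>x. ennreal \<bar>x\<bar>"] Bochner_Integration.integral_cong)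
            (auto simp: indicator_def flux_def)
        also have "\<dots> \<le> (\<integral>\<^sup>+x. ennreal \<bar>flux s x\<bar> \<partial>lborel)"
          using integral_norm_bound_ennreal[of lborel "flux s"] True int
          by (simp add: flux_def[abs_def])
        also have "\<dots> \<le> (\<integral>\<^sup>+x. ennreal (32 * K / R) * (ennreal (w s x) * indicator (ann R) x) \<partial>lborel)"
        proof (rule nn_integral_mono)
          fix x
          have "ennreal \<bar>flux s x\<bar> \<le> ennreal (32 * K / R * (w s x * indicator (ann R) x))"
            using flux_le[OF True, of x] by (intro ennreal_leI) (simp add: mult.assoc)
          also have "\<dots> = ennreal (32 * K / R) * (ennreal (w s x) * indicator (ann R) x)"
            using K R by (subst ennreal_mult') (auto simp: indicator_def)
          finally show "ennreal \<bar>flux s x\<bar> \<le> ennreal (32 * K / R) * (ennreal (w s x) * indicator (ann R) x)" .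
        qed
        also have "\<dots> = ennreal (32 * K / R) * (\<integral>\<^sup>+x\<in>ann R. ennreal (w s x) \<partial>lborel)"
          by (rule nn_integral_cmult) simp
        finally show ?thesis using True by simp
      qed simp
    qed
    also have "\<dots> = ennreal (32 * K / R) * I R"
    proof -
      have "(\<lambda>z. indicator ({0..} \<times> UNIV) z *\<^sub>R (case z of (s, x) \<Rightarrow> w s x)) \<in> borel_measurable borel"
        using w by (intro borel_measurable_continuous_on_indicator) (auto intro!: borel_closed closed_Times)
      then have [measurable]: "(\<lambda>(s, x). indicator {0..} s * w s x) \<in> borel_measurable (lborel \<Otimes>\<^sub>M lborel)"
        by (simp add: lborel_prod case_prod_unfold indicator_times)
      have meas: "(\<lambda>s. \<integral>\<^sup>+x\<in>ann R. ennreal (indicator {0..} s * w s x) \<partial>lborel) \<in> borel_measurable lborel"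
        by measurable
      have "(\<integral>\<^sup>+s. (ennreal (32 * K / R) * (\<integral>\<^sup>+x\<in>ann R. ennreal (w s x) \<partial>lborel)) * indicator {0..t} s \<partial>lborel) =
         (\<integral>\<^sup>+s. ennreal (32 * K / R) * ((\<integral>\<^sup>+x\<in>ann R. ennreal (indicator {0..} s * w s x) \<partial>lborel) * indicator {0..t} s) \<partial>lborel)"
        by (intro nn_integral_cong) (auto simp: indicator_def)
      also have "\<dots> = ennreal (32 * K / R) *
          (\<integral>\<^sup>+s. (\<integral>\<^sup>+x\<in>ann R. ennreal (indicator {0..} s * w s x) \<partial>lborel) * indicator {0..t} s \<partial>lborel)"
        using meas by (intro nn_integral_cmult borel_measurable_times_ennreal) auto
      also have "(\<integral>\<^sup>+s. (\<integral>\<^sup>+x\<in>ann R. ennreal (indicator {0..} s * w s x) \<partial>lborel) * indicator {0..t} s \<partial>lborel) = I R"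
        unfolding I_def by (intro nn_integral_cong) (auto simp: indicator_def)
      finally show ?thesis .
    qed
    also have "\<dots> = ennreal (32 * K) * (I R / ennreal R)"
      using K R by (simp add: divide_ennreal_def ennreal_mult divide_inverse inverse_ennreal mult_ac)
    finally have flux_ineq: "ennreal (\<integral>s. \<integral>x. indicator {0..t} s * (indicator ?B x * flux s x) \<partial>lborel \<partial>lborel) \<le>
      ennreal (32 * K) * (I R / ennreal R)" .
    have nn: "0 \<le> \<eta> x * J 0 (event s x)" if "0 \<le> s" for s x
      using \<eta>01(1) nonneg[of "event s x"] that by simp
    have "(\<integral>\<^sup>+x\<in>cball 0 R. ennreal (J 0 (event t x)) \<partial>lborel) \<le> (\<integral>\<^sup>+x. ennreal (\<eta> x * J 0 (event t x)) \<partial>lborel)"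
      by (intro nn_integral_mono) (auto simp: indicator_def \<eta>1)
    also have "\<dots> = ennreal (\<integral>x. \<eta> x * J 0 (event t x) \<partial>lborel)"
      using int nn t by (intro nn_integral_eq_integral) auto
    also have "\<dots> \<le> ennreal (\<integral>x. \<eta> x * J 0 (event 0 x) \<partial>lborel) +
        ennreal (\<integral>s. \<integral>x. indicator {0..t} s * (indicator ?B x * flux s x) \<partial>lborel \<partial>lborel)"
      using ennreal_leI[OF real_ineq] ennreal_subadditive
      by (meson order_trans)
    also have "ennreal (\<integral>x. \<eta> x * J 0 (event 0 x) \<partial>lborel) = (\<integral>\<^sup>+x. ennreal (\<eta> x * J 0 (event 0 x)) \<partial>lborel)"
      using int nn by (intro nn_integral_eq_integral[symmetric]) auto
    also have "\<dots> \<le> (\<integral>\<^sup>+x. ennreal (J 0 (event 0 x)) \<partial>lborel)"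
      using \<eta>01 nonneg by (intro nn_integral_mono ennreal_leI mult_left_le_one_le) auto
    finally show ?thesis
      using flux_ineq by (meson add_left_mono add_right_mono order_trans)
  qed
  \<comment> \<open>Radii \<open>Suc n\<close> rather than \<open>n\<close>, since the cutoff needs a positive radius.\<close>
  have "(\<lambda>n. \<integral>\<^sup>+x\<in>cball 0 (real (Suc n)). ennreal (J 0 (event t x)) \<partial>lborel) \<longlonglongrightarrow>
      (\<integral>\<^sup>+x. ennreal (J 0 (event t x)) \<partial>lborel)"
    using slice_meas[of t] t by (intro nn_integral_cball_LIMSEQ) auto
  moreover have "(\<lambda>n. (\<integral>\<^sup>+x. ennreal (J 0 (event 0 x)) \<partial>lborel) +
      ennreal (32 * K) * (I (real (Suc n)) / ennreal (real (Suc n)))) \<longlonglongrightarrow>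
      (\<integral>\<^sup>+x. ennreal (J 0 (event 0 x)) \<partial>lborel) + ennreal (32 * K) * 0"
  proof (intro tendsto_add tendsto_const ennreal_tendsto_cmult)
    have "filterlim (\<lambda>n. real (Suc n)) at_top sequentially"
      by (intro filterlim_compose[OF filterlim_real_sequentially filterlim_Suc])
    with decay show "(\<lambda>n. I (real (Suc n)) / ennreal (real (Suc n))) \<longlonglongrightarrow> 0"
      unfolding I_def ann_def by (rule filterlim_compose)
  qed simp
  ultimately show ?thesis
    using cut by (intro LIMSEQ_le) (auto simp del: of_nat_Suc)
qed

section \<open>Hardy's inequality\<close>

lemma nn_integral_dilation:
  fixes h :: "'a::euclidean_space \<Rightarrow> ennreal"
  assumes [measurable]: "h \<in> borel_measurable borel" and s: "0 < s"
  shows "(\<integral>\<^sup>+x. h (s *\<^sub>R x) \<partial>lborel) = ennreal (1 / s ^ DIM('a)) * (\<integral>\<^sup>+x. h x \<partial>lborel)"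
proof -
  have "(\<integral>\<^sup>+x. h x \<partial>lborel) = (\<integral>\<^sup>+x. ennreal (s ^ DIM('a)) * h (s *\<^sub>R x) \<partial>lborel)"
    by (subst lborel_affine[of s 0]) (use s in \<open>simp_all add: nn_integral_density nn_integral_distr\<close>)
  also have "\<dots> = ennreal (s ^ DIM('a)) * (\<integral>\<^sup>+x. h (s *\<^sub>R x) \<partial>lborel)"
    by (rule nn_integral_cmult) simp
  finally have "ennreal (1 / s ^ DIM('a)) * (\<integral>\<^sup>+x. h x \<partial>lborel) =
      (ennreal (1 / s ^ DIM('a)) * ennreal (s ^ DIM('a))) * (\<integral>\<^sup>+x. h (s *\<^sub>R x) \<partial>lborel)"
    by (simp add: mult.assoc)
  also have "ennreal (1 / s ^ DIM('a)) * ennreal (s ^ DIM('a)) = 1"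
    using s by (simp add: ennreal_mult[symmetric])
  finally show ?thesis by simp
qed

lemma nn_integral_Icc_eq_integral:
  fixes k :: "real \<Rightarrow> real"
  assumes k: "continuous_on {a..b} k" and nonneg: "\<And>s. s \<in> {a..b} \<Longrightarrow> 0 \<le> k s"
  shows "(\<integral>\<^sup>+s\<in>{a..b}. ennreal (k s) \<partial>lborel) = ennreal (integral {a..b} k)"
proof -
  have int: "set_integrable lborel {a..b} k"
    using k by (rule borel_integrable_atLeastAtMost')
  have "(\<integral>\<^sup>+s\<in>{a..b}. ennreal (k s) \<partial>lborel) = (\<integral>\<^sup>+s. ennreal (indicator {a..b} s *\<^sub>R k s) \<partial>lborel)"
    by (intro nn_integral_cong) (auto simp: indicator_def)
  also have "\<dots> = ennreal (\<integral>s. indicator {a..b} s *\<^sub>R k s \<partial>lborel)"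
    using int nonneg unfolding set_integrable_def
    by (intro nn_integral_eq_integral) (auto simp: indicator_def)
  also have "(\<integral>s. indicator {a..b} s *\<^sub>R k s \<partial>lborel) = integral {a..b} k"
    using set_borel_integral_eq_integral(2)[OF int] by (simp add: set_lebesgue_integral_def)
  finally show ?thesis .
qed

lemma nn_integral_inverse_square_le: "(\<integral>\<^sup>+s\<in>{1..S}. ennreal (1 / s\<^sup>2) \<partial>lborel) \<le> 1"
proof (cases "1 \<le> S")
  case True
  have "((\<lambda>s. - (1 / s)) has_real_derivative 1 / s\<^sup>2) (at s)" if "1 \<le> s" for s :: real
    using that by (auto intro!: derivative_eq_intros simp: power2_eq_square)
  then have "((\<lambda>s. 1 / s\<^sup>2) has_integral (- (1 / S) - - (1 / 1))) {1..S}"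
    using True by (intro fundamental_theorem_of_calculus)
      (auto simp: has_real_derivative_iff_has_vector_derivative[symmetric] intro: has_field_derivative_at_within)
  then have "integral {1..S} (\<lambda>s. 1 / s\<^sup>2) \<le> 1"
    using True by (simp add: integral_unique)
  then show ?thesis
    by (subst nn_integral_Icc_eq_integral) (auto intro!: continuous_intros)
qed simp

text \<open>
  The derivative of \<open>(2 - 1 / s) N s\<close> is at least
  \<open>N / s^2 - 2 (2 - 1 / s) sqrt N r / s\<close>, and completing the square bounds this from below by
  \<open>- 4 r^2\<close>. The bounded increasing weight \<open>2 - 1 / s\<close> supplies the term \<open>N / s^2\<close> that makes this
  possible. Here \<open>N\<close> is \<open>|f|^2\<close> and \<open>r\<close> is \<open>|x| |D f|\<close> along a ray.
\<close>

lemma hardy_along_ray: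
  fixes N r :: "real \<Rightarrow> real"
  assumes der: "\<And>s. 0 < s \<Longrightarrow> \<exists>d. (N has_real_derivative d) (at s) \<and> \<bar>d\<bar> \<le> 2 * sqrt (N s) * r s / s"
    and N: "\<And>s. 0 \<le> N s" and r: "continuous_on {0..} r" "\<And>s. 0 \<le> r s" and S: "1 \<le> S"
  shows "N 1 \<le> 2 * N S + integral {1..S} (\<lambda>s. 4 * (r s)\<^sup>2)"
proof -
  define k where "k s = 4 * (r s)\<^sup>2" for s
  define K where "K s = integral {0..s} k" for s
  have k: "continuous_on {0..b} k" for b
    unfolding k_def using r by (auto intro!: continuous_intros intro: continuous_on_subset)
  have dK: "(K has_real_derivative k s) (at s)" if "1 \<le> s" "s \<le> S" for s
  proof -
    have "(K has_real_derivative k s) (at s within {0..S + 1})"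
      unfolding K_def by (rule integral_has_real_derivative[OF k]) (use that in auto)
    moreover have "at s within {0..S + 1} = at s"
      by (rule at_within_interior) (use that in auto)
    ultimately show ?thesis by simp
  qed
  have "(2 - 1 / 1) * N 1 + K 1 \<le> (2 - 1 / S) * N S + K S"
  proof (rule DERIV_nonneg_imp_nondecreasing[OF S])
    fix s assume s: "1 \<le> s" "s \<le> S"
    define w where "w = 2 - 1 / s"
    have w: "0 \<le> w" "w \<le> 2" using s by (auto simp: w_def divide_le_eq)
    obtain d where d: "(N has_real_derivative d) (at s)" "\<bar>d\<bar> \<le> 2 * sqrt (N s) * r s / s"
      using der[of s] s by auto
    have "((\<lambda>s. (2 - 1 / s) * N s + K s) has_real_derivative (N s / s\<^sup>2 + w * d + k s)) (at s)"
      using s d(1) dK[OF s]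
      by (auto intro!: derivative_eq_intros simp: w_def power2_eq_square field_simps)
    moreover have "0 \<le> N s / s\<^sup>2 + w * d + k s"
    proof -
      have "w * \<bar>d\<bar> \<le> w * (2 * sqrt (N s) * r s / s)"
        using d(2) w by (intro mult_left_mono)
      then have "- (w * d) \<le> 2 * (sqrt (N s) / s) * (w * r s)"
        using w mult_left_mono[OF abs_ge_minus_self, of w d] by (simp add: mult_ac)
      also have "\<dots> \<le> (sqrt (N s) / s)\<^sup>2 + (w * r s)\<^sup>2"
        by (rule sum_squares_bound)
      also have "(sqrt (N s) / s)\<^sup>2 = N s / s\<^sup>2"
        using N[of s] by (simp add: power_divide)
      also have "(w * r s)\<^sup>2 \<le> (2 * r s)\<^sup>2"
        using w r(2)[of s] by (intro power_mono mult_right_mono mult_nonneg_nonneg) auto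
      finally show ?thesis by (simp add: k_def power_mult_distrib)
    qed
    ultimately show "\<exists>y. ((\<lambda>s. (2 - 1 / s) * N s + K s) has_real_derivative y) (at s) \<and> 0 \<le> y"
      by blast
  qed
  moreover have "K S = K 1 + integral {1..S} k"
    unfolding K_def using S integrable_continuous_real[OF k]
    by (intro Henstock_Kurzweil_Integration.integral_combine[symmetric]) auto
  moreover have "(2 - 1 / S) * N S \<le> 2 * N S"
    using S N[of S] by (intro mult_right_mono) auto
  ultimately show ?thesis by (simp add: k_def[abs_def])
qed

text \<open>
  Integrating the estimate along rays over a ball of radius \<open>\<rho>\<close>, the change of variables \<open>y = s x\<close>
  turns the integral over \<open>s\<close> into \<open>\<integral> s^{-2} ds \<le> 1\<close> times the right-hand side. What remains is the
  average of \<open>|f|^2\<close> over the ball of radius \<open>S \<rho>\<close>, and it vanishes as \<open>S \<rightarrow> \<infinity>\<close> because some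
  power \<open>q > 2\<close> of \<open>|f|\<close> is integrable. In the plane the weight \<open>|x|^2\<close> alone would not exclude
  constants; the integrability does. In the application \<open>G\<close> is the norm
  of the covariant gradient of \<open>f\<close>.
\<close>

lemma hardy_inequality:
  fixes f :: "real^2 \<Rightarrow> complex" and G :: "real^2 \<Rightarrow> real"
  assumes f: "continuous_on UNIV f" and G: "continuous_on UNIV G" "\<And>x. 0 \<le> G x"
    and der: "\<And>x s. \<exists>d. ((\<lambda>s. (norm (f (s *\<^sub>R x)))\<^sup>2) has_real_derivative d) (at s) \<and>
      \<bar>d\<bar> \<le> 2 * norm (f (s *\<^sub>R x)) * (norm x * G (s *\<^sub>R x))"
    and q: "2 < q" and fin: "(\<integral>\<^sup>+x. ennreal (norm (f x) powr q) \<partial>lborel) < \<infinity>"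
  shows "(\<integral>\<^sup>+x. ennreal ((norm (f x))\<^sup>2) \<partial>lborel) \<le> (\<integral>\<^sup>+x. ennreal (4 * (norm x * G x)\<^sup>2) \<partial>lborel)"
    (is "_ \<le> ?H")
proof -
  define N where "N x = (norm (f x))\<^sup>2" for x
  define k where "k x = 4 * (norm x * G x)\<^sup>2" for x
  obtain P where P: "0 \<le> P" "(\<integral>\<^sup>+x. ennreal (norm (f x) powr q) \<partial>lborel) = ennreal P"
    using fin by (cases "\<integral>\<^sup>+x. ennreal (norm (f x) powr q) \<partial>lborel") auto
  have cont: "continuous_on UNIV N" "continuous_on UNIV k" "continuous_on UNIV (\<lambda>x. norm (f x) powr q)"
    unfolding N_def k_def using f G q by (auto intro!: continuous_intros continuous_on_powr')
  note [measurable] = cont[THEN borel_measurable_continuous_onI] f[THEN borel_measurable_continuous_onI]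
  have ray: "ennreal (N x) \<le> 2 * ennreal (N (S *\<^sub>R x)) + (\<integral>\<^sup>+s\<in>{1..S}. ennreal (k (s *\<^sub>R x)) \<partial>lborel)"
    if S: "1 \<le> S" for S x
  proof -
    have contG: "continuous_on A (\<lambda>s. G (s *\<^sub>R x))" for A
      by (rule continuous_on_compose2[OF G(1)]) (auto intro!: continuous_intros)
    have "N (1 *\<^sub>R x) \<le> 2 * N (S *\<^sub>R x) + integral {1..S} (\<lambda>s. 4 * (norm (s *\<^sub>R x) * G (s *\<^sub>R x))\<^sup>2)"
    proof (rule hardy_along_ray[OF _ _ _ _ S])
      fix s :: real assume "0 < s"
      then have e: "2 * sqrt (N (s *\<^sub>R x)) * (norm (s *\<^sub>R x) * G (s *\<^sub>R x)) / s =
          2 * norm (f (s *\<^sub>R x)) * (norm x * G (s *\<^sub>R x))"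
        by (simp add: N_def)
      show "\<exists>d. ((\<lambda>s. N (s *\<^sub>R x)) has_real_derivative d) (at s) \<and>
          \<bar>d\<bar> \<le> 2 * sqrt (N (s *\<^sub>R x)) * (norm (s *\<^sub>R x) * G (s *\<^sub>R x)) / s"
        unfolding e unfolding N_def by (rule der)
    qed (use G contG in \<open>auto simp: N_def intro!: continuous_intros\<close>)
    then have "N x \<le> 2 * N (S *\<^sub>R x) + integral {1..S} (\<lambda>s. k (s *\<^sub>R x))"
      by (simp add: k_def[abs_def])
    then have "ennreal (N x) \<le> ennreal (2 * N (S *\<^sub>R x) + integral {1..S} (\<lambda>s. k (s *\<^sub>R x)))"
      by (rule ennreal_leI)
    also have "\<dots> \<le> ennreal (2 * N (S *\<^sub>R x)) + ennreal (integral {1..S} (\<lambda>s. k (s *\<^sub>R x)))"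
      by (rule ennreal_subadditive)
    also have "ennreal (integral {1..S} (\<lambda>s. k (s *\<^sub>R x))) = (\<integral>\<^sup>+s\<in>{1..S}. ennreal (k (s *\<^sub>R x)) \<partial>lborel)"
      by (rule nn_integral_Icc_eq_integral[symmetric])
        (auto intro!: contG continuous_intros simp: k_def)
    finally show ?thesis by (simp add: ennreal_mult')
  qed
  have ball: "(\<integral>\<^sup>+x\<in>cball 0 \<rho>. ennreal (N x) \<partial>lborel) \<le> ?H" for \<rho>
  proof (rule ennreal_le_epsilon)
    fix e :: real assume "0 < e"
    define V where "V = measure lborel (cball (0 :: real^2) \<rho>)"
    have V: "emeasure lborel (cball (0 :: real^2) \<rho>) = ennreal V" "0 \<le> V"
      using emeasure_eq_ennreal_measure[of lborel "cball (0 :: real^2) \<rho>"] emeasure_lborel_cball_finite[of "0 :: real^2" \<rho>]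
      by (auto simp: V_def)
    define \<epsilon> where "\<epsilon> = e / (4 * (V + 1))"
    have \<epsilon>: "0 < \<epsilon>" using \<open>0 < e\<close> V by (simp add: \<epsilon>_def)
    have \<epsilon>V: "2 * \<epsilon> * V \<le> e / 2" using \<open>0 < e\<close> V by (simp add: \<epsilon>_def field_simps)
    define C where "C = \<epsilon> powr (- ((q - 2) / 2))"
    have C: "0 \<le> C" by (simp add: C_def)
    \<comment> \<open>Either \<open>N x\<close> is at most \<open>\<epsilon>\<close>, or \<open>(N x / \<epsilon>)\<close> raised to \<open>(q - 2) / 2\<close> exceeds one.\<close>
    have young: "N x \<le> \<epsilon> + C * norm (f x) powr q" for x
    proof (cases "N x \<le> \<epsilon>")
      case True
      then show ?thesis using C by (simp add: add_increasing2)
    next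
      case False
      then have pos: "0 < norm (f x)" "\<epsilon> < (norm (f x))\<^sup>2" using \<epsilon> by (auto simp: N_def)
      have "C * \<epsilon> powr ((q - 2) / 2) \<le> C * ((norm (f x))\<^sup>2) powr ((q - 2) / 2)"
        using pos \<epsilon> q C by (intro mult_left_mono powr_mono2) auto
      also have "C * \<epsilon> powr ((q - 2) / 2) = 1"
        using \<epsilon> by (simp add: C_def powr_add[symmetric])
      also have "((norm (f x))\<^sup>2) powr ((q - 2) / 2) = norm (f x) powr (q - 2)"
        using pos powr_powr[of "norm (f x)" 2 "(q - 2) / 2"] by (simp add: powr_numeral diff_divide_distrib)
      finally have "1 * (norm (f x))\<^sup>2 \<le> C * norm (f x) powr (q - 2) * (norm (f x))\<^sup>2"
        by (rule mult_right_mono) simp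
      also have "\<dots> = C * norm (f x) powr q"
        using pos by (simp add: powr_diff powr_numeral)
      finally show ?thesis using \<epsilon> by (simp add: N_def)
    qed
    define S where "S = 1 + 4 * C * P / e"
    have S: "1 \<le> S" using C P \<open>0 < e\<close> by (simp add: S_def)
    have "4 * C * P / e \<le> S\<^sup>2"
      using S self_le_power[of S 2] by (simp add: S_def)
    then have CP: "2 * C * P / S\<^sup>2 \<le> e / 2"
      using S \<open>0 < e\<close> by (simp add: field_simps)
    have "(\<integral>\<^sup>+x\<in>cball 0 \<rho>. ennreal (N x) \<partial>lborel) \<le>
        (\<integral>\<^sup>+x. ennreal (2 * \<epsilon>) * indicator (cball 0 \<rho>) x + ennreal (2 * C) * ennreal (norm (f (S *\<^sub>R x)) powr q) +
          (\<integral>\<^sup>+s\<in>{1..S}. ennreal (k (s *\<^sub>R x)) \<partial>lborel) \<partial>lborel)"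
    proof (rule nn_integral_mono)
      fix x :: "real^2"
      have "2 * ennreal (N (S *\<^sub>R x)) = ennreal (2 * N (S *\<^sub>R x))"
        by (simp add: ennreal_mult')
      also have "\<dots> \<le> ennreal (2 * \<epsilon> + 2 * C * norm (f (S *\<^sub>R x)) powr q)"
        using young[of "S *\<^sub>R x"] by (intro ennreal_leI) (simp add: algebra_simps)
      also have "\<dots> = ennreal (2 * \<epsilon>) + ennreal (2 * C) * ennreal (norm (f (S *\<^sub>R x)) powr q)"
        using \<epsilon> C by (simp add: ennreal_mult)
      finally have "ennreal (N x) \<le> ennreal (2 * \<epsilon>) + ennreal (2 * C) * ennreal (norm (f (S *\<^sub>R x)) powr q) +
          (\<integral>\<^sup>+s\<in>{1..S}. ennreal (k (s *\<^sub>R x)) \<partial>lborel)"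
        using ray[OF S, of x] by (meson add_right_mono order_trans)
      then show "ennreal (N x) * indicator (cball 0 \<rho>) x \<le>
          ennreal (2 * \<epsilon>) * indicator (cball 0 \<rho>) x + ennreal (2 * C) * ennreal (norm (f (S *\<^sub>R x)) powr q) +
          (\<integral>\<^sup>+s\<in>{1..S}. ennreal (k (s *\<^sub>R x)) \<partial>lborel)"
        by (auto simp: indicator_def)
    qed
    also have "\<dots> = ennreal (2 * \<epsilon>) * ennreal V + ennreal (2 * C) * (\<integral>\<^sup>+x. ennreal (norm (f (S *\<^sub>R x)) powr q) \<partial>lborel) +
        (\<integral>\<^sup>+x. (\<integral>\<^sup>+s\<in>{1..S}. ennreal (k (s *\<^sub>R x)) \<partial>lborel) \<partial>lborel)"
    proof -
      have add3: "(\<integral>\<^sup>+x. a x + c * b x + d x \<partial>lborel) =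
          (\<integral>\<^sup>+x. a x \<partial>lborel) + c * (\<integral>\<^sup>+x. b x \<partial>lborel) + (\<integral>\<^sup>+x. d x \<partial>lborel)"
        if [measurable]: "a \<in> borel_measurable lborel" "b \<in> borel_measurable lborel" "d \<in> borel_measurable lborel"
        for a b d :: "real^2 \<Rightarrow> ennreal" and c
        by (simp add: nn_integral_add nn_integral_cmult)
      have [measurable]: "(\<lambda>x. ennreal (norm (f (S *\<^sub>R x)) powr q)) \<in> borel_measurable lborel"
        "(\<lambda>x. \<integral>\<^sup>+s\<in>{1..S}. ennreal (k (s *\<^sub>R x)) \<partial>lborel) \<in> borel_measurable lborel"
        by measurable
      have [measurable]: "(\<lambda>x. ennreal (2 * \<epsilon>) * indicator (cball (0 :: real^2) \<rho>) x) \<in> borel_measurable lborel"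
        by (intro borel_measurable_times_ennreal borel_measurable_indicator) auto
      have "(\<integral>\<^sup>+x. ennreal (2 * \<epsilon>) * indicator (cball (0 :: real^2) \<rho>) x \<partial>lborel) = ennreal (2 * \<epsilon>) * ennreal V"
        by (subst nn_integral_cmult_indicator) (auto simp: V)
      then show ?thesis
        using add3[of "\<lambda>x. ennreal (2 * \<epsilon>) * indicator (cball (0 :: real^2) \<rho>) x"
            "\<lambda>x. ennreal (norm (f (S *\<^sub>R x)) powr q)" "\<lambda>x. \<integral>\<^sup>+s\<in>{1..S}. ennreal (k (s *\<^sub>R x)) \<partial>lborel"]
        by simp
    qed
    also have "(\<integral>\<^sup>+x. ennreal (norm (f (S *\<^sub>R x)) powr q) \<partial>lborel) = ennreal (1 / S\<^sup>2) * ennreal P"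
      using nn_integral_dilation[of "\<lambda>x. ennreal (norm (f x) powr q)" S] S P by simp
    also have "(\<integral>\<^sup>+x. (\<integral>\<^sup>+s\<in>{1..S}. ennreal (k (s *\<^sub>R x)) \<partial>lborel) \<partial>lborel) =
        (\<integral>\<^sup>+s. (\<integral>\<^sup>+x. ennreal (k (s *\<^sub>R x)) * indicator {1..S} s \<partial>lborel) \<partial>lborel)"
      by (rule lborel_pair.Fubini') measurable
    also have "\<dots> = (\<integral>\<^sup>+s. ?H * (ennreal (1 / s\<^sup>2) * indicator {1..S} s) \<partial>lborel)"
    proof (rule nn_integral_cong)
      fix s :: real
      show "(\<integral>\<^sup>+x. ennreal (k (s *\<^sub>R x)) * indicator {1..S} s \<partial>lborel) = ?H * (ennreal (1 / s\<^sup>2) * indicator {1..S} s)"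
      proof (cases "s \<in> {1..S}")
        case True
        have [measurable]: "(\<lambda>x. ennreal (k x)) \<in> borel_measurable borel"
          by measurable
        have "(\<integral>\<^sup>+x. ennreal (k (s *\<^sub>R x)) \<partial>lborel) = ennreal (1 / s\<^sup>2) * (\<integral>\<^sup>+x. ennreal (k x) \<partial>lborel)"
          using True by (subst nn_integral_dilation[of "\<lambda>x. ennreal (k x)" s]) auto
        then show ?thesis using True by (simp add: k_def mult.commute)
      qed simp
    qed
    also have "\<dots> = ?H * (\<integral>\<^sup>+s\<in>{1..S}. ennreal (1 / s\<^sup>2) \<partial>lborel)"
      by (rule nn_integral_cmult) measurable
    also have "ennreal (2 * \<epsilon>) * ennreal V + ennreal (2 * C) * (ennreal (1 / S\<^sup>2) * ennreal P) =
        ennreal (2 * \<epsilon> * V + 2 * C * P / S\<^sup>2)"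
      using \<epsilon> V C P by (simp add: ennreal_mult[symmetric] ennreal_plus[symmetric] del: ennreal_plus)
    also have "ennreal (2 * \<epsilon> * V + 2 * C * P / S\<^sup>2) + ?H * (\<integral>\<^sup>+s\<in>{1..S}. ennreal (1 / s\<^sup>2) \<partial>lborel) \<le>
        ennreal e + ?H * 1"
      using \<epsilon>V CP by (intro add_mono mult_left_mono nn_integral_inverse_square_le ennreal_leI) auto
    finally show "(\<integral>\<^sup>+x\<in>cball 0 \<rho>. ennreal (N x) \<partial>lborel) \<le> ?H + ennreal e"
      by (simp add: add.commute)
  qed
  have "(\<integral>\<^sup>+x. ennreal (N x) \<partial>lborel) \<le> ?H"
    by (rule LIMSEQ_le_const2[OF nn_integral_cball_LIMSEQ]) (use ball in auto)
  then show ?thesis by (simp add: N_def)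
qed

section \<open>The energy of the data controls the current at time zero\<close>

lemma continuous_on_flux_density:
  assumes p: "1 < p" and A: "\<And>\<mu>. C1_future (A \<mu>)" and \<phi>: "C2_future \<phi>"
  shows "continuous_on ({0..} \<times> UNIV) (\<lambda>(s, x). flux_density p A \<phi> s x)"
proof -
  have C1: "C1_future \<phi>" using \<phi> by (simp add: C2_future_def)
  have \<phi>_cont: "continuous_on ({0..} \<times> UNIV) (\<lambda>z. \<phi> (event (fst z) (snd z)))"
    using continuous_on_compose_event[OF C1_future_continuous[OF C1], of "{0..} \<times> UNIV"]
    by (auto simp: case_prod_unfold)
  have cov_cont: "continuous_on ({0..} \<times> UNIV) (\<lambda>z. cov A \<mu> \<phi> (event (fst z) (snd z)))" for \<mu>
    using continuous_on_compose_event[OF continuous_on_cov[OF A C1], of "{0..} \<times> UNIV"]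
    by (auto simp: case_prod_unfold)
  show ?thesis
    unfolding flux_density_def case_prod_unfold
    using p by (intro continuous_intros continuous_on_powr' \<phi>_cont cov_cont) auto
qed

lemma space_cov_initial:
  assumes \<phi>: "C1_future \<phi>" and data: "\<And>x. \<phi> (event 0 x) = \<phi>\<^sub>0 x"
  shows "space_cov (initial_connection A) i \<phi>\<^sub>0 x = cov A (spacetime_index i) \<phi> (event 0 x)"
proof -
  define D where "D = frechet_derivative \<phi> (at (event 0 x) within future)"
  have D: "(\<phi> has_derivative D) (at (event 0 x) within future)"
    unfolding D_def by (rule C1_future_has_derivative[OF \<phi>]) simp
  have "bounded_linear (\<lambda>x. event 0 x)"
    unfolding event_eq scaleR_zero_left add_0
    by (intro bounded_linear_add bounded_linear_compose[OF bounded_linear_scaleR_left bounded_linear_vec_nth])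
  then have "((\<lambda>x. event 0 x) has_derivative (\<lambda>h. event 0 h)) (at x)"
    by (rule bounded_linear_imp_has_derivative)
  moreover have "(\<phi> has_derivative D) (at (event 0 x) within range (event 0))"
    by (rule has_derivative_subset[OF D]) auto
  ultimately have "((\<lambda>x. \<phi> (event 0 x)) has_derivative (\<lambda>h. D (event 0 h))) (at x)"
    by (rule has_derivative_in_compose)
  then have "frechet_derivative \<phi>\<^sub>0 (at x) = (\<lambda>h. D (event 0 h))"
    unfolding data by (rule frechet_derivative_at[symmetric])
  moreover have "event 0 (axis i 1) = axis (spacetime_index i) 1"
    using event_add_axis[of 0 0 1 i] by (simp add: vec3_eq_iff)
  ultimately show ?thesis
    by (simp add: space_cov_def cov_def partial_def D_def initial_connection_def data)
qed

text \<open>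
  Differentiating \<open>|\<phi>|^2\<close> involves covariant derivatives only, hence Hardy's inequality applies
  to \<open>\<phi>\<close> in a gauge invariant form.
\<close>

lemma ray_derivative_bound:
  assumes A: "\<And>\<mu>. C1_future (A \<mu>)" and \<phi>: "C1_future \<phi>"
  shows "\<exists>d. ((\<lambda>s. (norm (\<phi> (event 0 (s *\<^sub>R x))))\<^sup>2) has_real_derivative d) (at s) \<and>
    \<bar>d\<bar> \<le> 2 * norm (\<phi> (event 0 (s *\<^sub>R x))) *
      (norm x * L2_set (\<lambda>i. norm (cov A (spacetime_index i) \<phi> (event 0 (s *\<^sub>R x)))) UNIV)"
proof -
  define z where "z = event 0 (s *\<^sub>R x)"
  have z: "z \<in> future" by (simp add: z_def)
  let ?N = "\<lambda>z. \<phi> z \<bullet> \<phi> z"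
  define D where "D = frechet_derivative ?N (at z within future)"
  have N: "C1_future ?N" by (intro C1_future_inner \<phi>)
  have D: "(?N has_derivative D) (at z within future)"
    unfolding D_def by (rule C1_future_has_derivative[OF N z])
  have "((\<lambda>s. event 0 (s *\<^sub>R x)) has_derivative (\<lambda>h. h *\<^sub>R event 0 x)) (at s)"
    unfolding event_eq by (auto intro!: derivative_eq_intros simp: algebra_simps)
  moreover have "(?N has_derivative D) (at (event 0 (s *\<^sub>R x)) within range (\<lambda>s. event 0 (s *\<^sub>R x)))"
    by (rule has_derivative_subset[OF D[unfolded z_def]]) auto
  ultimately have "((\<lambda>s. ?N (event 0 (s *\<^sub>R x))) has_derivative (\<lambda>h. D (h *\<^sub>R event 0 x))) (at s)"
    by (rule has_derivative_in_compose)
  moreover have lin: "linear D"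
    using has_derivative_bounded_linear[OF D] by (rule bounded_linear.linear)
  ultimately have der: "((\<lambda>s. (norm (\<phi> (event 0 (s *\<^sub>R x))))\<^sup>2) has_real_derivative D (event 0 x)) (at s)"
    by (simp add: has_field_derivative_def linear_cmul power2_norm_eq_inner mult_commute_abs)
  have partial_N: "D (axis \<mu> 1) = 2 * (\<phi> z \<bullet> cov A \<mu> \<phi> z)" for \<mu>
    using partial_inner_cov[OF \<phi> \<phi> z, of \<mu> A] by (simp add: D_def partial_def inner_commute)
  have "D (event 0 x) = (\<Sum>i\<in>UNIV. x $ i * (2 * (\<phi> z \<bullet> cov A (spacetime_index i) \<phi> z)))"
    unfolding event_eq by (simp add: linear_add[OF lin] linear_cmul[OF lin] partial_N sum_2 spacetime_index_def)
  also have "\<bar>\<dots>\<bar> \<le> (\<Sum>i\<in>UNIV. \<bar>x $ i * (2 * (\<phi> z \<bullet> cov A (spacetime_index i) \<phi> z))\<bar>)"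
    by (rule sum_abs)
  also have "\<dots> \<le> (\<Sum>i\<in>UNIV. 2 * norm (\<phi> z) * (\<bar>norm (x $ i)\<bar> * \<bar>norm (cov A (spacetime_index i) \<phi> z)\<bar>))"
  proof (rule sum_mono)
    fix i
    have "\<bar>x $ i\<bar> * \<bar>\<phi> z \<bullet> cov A (spacetime_index i) \<phi> z\<bar> \<le>
        \<bar>x $ i\<bar> * (norm (\<phi> z) * norm (cov A (spacetime_index i) \<phi> z))"
      by (intro mult_left_mono Cauchy_Schwarz_ineq2) auto
    then show "\<bar>x $ i * (2 * (\<phi> z \<bullet> cov A (spacetime_index i) \<phi> z))\<bar> \<le>
        2 * norm (\<phi> z) * (\<bar>norm (x $ i)\<bar> * \<bar>norm (cov A (spacetime_index i) \<phi> z)\<bar>)"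
      by (simp add: abs_mult mult_ac)
  qed
  also have "\<dots> \<le> 2 * norm (\<phi> z) * (norm x * L2_set (\<lambda>i. norm (cov A (spacetime_index i) \<phi> z)) UNIV)"
    unfolding sum_distrib_left[symmetric] norm_vec_def
    by (intro mult_left_mono L2_set_mult_ineq) auto
  finally show ?thesis
    using der unfolding z_def by blast
qed

text \<open>
  All of \<open>flux_density\<close> except for \<open>|\<phi>|^2\<close> is part of the energy of the data, and Hardy's
  inequality bounds the integral of \<open>|\<phi>|^2\<close> by four times that of \<open>|x|^2 |D \<phi>|^2\<close>.
\<close>

lemma initial_flux_density_le_energy:
  assumes p: "1 < p" and A: "\<And>\<mu>. C1_future (A \<mu>)" and \<phi>: "C2_future \<phi>"
    and data: "has_initial_data A \<phi> \<phi>\<^sub>0 \<phi>\<^sub>1"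
    and fin: "weighted_energy p 0 2 (initial_connection A) \<phi>\<^sub>0 \<phi>\<^sub>1 < \<infinity>"
  shows "(\<integral>\<^sup>+x. ennreal (flux_density p A \<phi> 0 x) \<partial>lborel) \<le>
    5 * weighted_energy p 0 2 (initial_connection A) \<phi>\<^sub>0 \<phi>\<^sub>1"
proof -
  define E where "E = weighted_energy p 0 2 (initial_connection A) \<phi>\<^sub>0 \<phi>\<^sub>1"
  define c where "c \<mu> x = cov A \<mu> \<phi> (event 0 x)" for \<mu> x
  define f where "f x = \<phi> (event 0 x)" for x
  define G where "G x = L2_set (\<lambda>i. norm (c (spacetime_index i) x)) UNIV" for x
  define e1 where "e1 x = (1 + norm x)\<^sup>2 * ((G x)\<^sup>2 + (norm (c 0 x))\<^sup>2)" for x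
  define e2 where "e2 x = (1 + norm x)\<^sup>2 * norm (f x) powr (p + 1)" for x
  have C1: "C1_future \<phi>" using \<phi> by (simp add: C2_future_def)
  have d: "\<And>x. \<phi> (event 0 x) = \<phi>\<^sub>0 x" "\<And>x. c 0 x = \<phi>\<^sub>1 x"
    using data by (auto simp: has_initial_data_def c_def)
  have cont: "continuous_on UNIV (c \<mu>)" "continuous_on UNIV f" for \<mu>
    unfolding c_def[abs_def] f_def[abs_def]
    using continuous_on_cov[OF A C1] C1_future_continuous[OF C1] by (auto intro: continuous_on_slice)
  have G2: "(G x)\<^sup>2 = (norm (c 1 x))\<^sup>2 + (norm (c 2 x))\<^sup>2" for x
    unfolding G_def L2_set_def by (simp add: sum_nonneg sum_2 spacetime_index_def)
  have contG: "continuous_on UNIV G"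
    unfolding G_def[abs_def] L2_set_def using cont by (intro continuous_intros)
  have "continuous_on UNIV e1" "continuous_on UNIV e2"
    unfolding e1_def[abs_def] e2_def[abs_def] using cont contG p
    by (auto intro!: continuous_intros continuous_on_powr')
  note [measurable] = this[THEN borel_measurable_continuous_onI] contG[THEN borel_measurable_continuous_onI]
    cont(2)[THEN borel_measurable_continuous_onI]
  have E: "E = (\<integral>\<^sup>+x. ennreal (e1 x) \<partial>lborel) + (\<integral>\<^sup>+x. ennreal (e2 x) \<partial>lborel)"
  proof -
    have "space_cov (initial_connection A) i \<phi>\<^sub>0 x = c (spacetime_index i) x" for i x
      by (simp add: space_cov_initial[OF C1 d(1)] c_def)
    then have "space_cov_sq (initial_connection A) (Suc 0) \<phi>\<^sub>0 x + space_cov_sq (initial_connection A) 0 \<phi>\<^sub>1 x =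
        (G x)\<^sup>2 + (norm (c 0 x))\<^sup>2" for x
      by (simp add: G2 d(2) sum_2 spacetime_index_def)
    moreover have "(1 + norm x) powr 2 = (1 + norm x)\<^sup>2" for x :: "real^2"
      by (rule powr_numeral) (simp add: add_pos_nonneg)
    ultimately show ?thesis
      by (simp add: E_def weighted_energy_def e1_def e2_def f_def d(1))
  qed
  have weight: "y \<le> (1 + norm x)\<^sup>2 * y" "(norm x)\<^sup>2 * y \<le> (1 + norm x)\<^sup>2 * y" if "0 \<le> y" for x :: "real^2" and y :: real
    using mult_right_mono[of 1 "(1 + norm x)\<^sup>2" y] that
    by (auto simp: one_le_power intro!: mult_right_mono power_mono)
  have "(\<integral>\<^sup>+x. ennreal (norm (f x) powr (p + 1)) \<partial>lborel) \<le> (\<integral>\<^sup>+x. ennreal (e2 x) \<partial>lborel)"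
    unfolding e2_def by (intro nn_integral_mono ennreal_leI weight) simp
  also have "\<dots> \<le> E" unfolding E by simp
  finally have finP: "(\<integral>\<^sup>+x. ennreal (norm (f x) powr (p + 1)) \<partial>lborel) < \<infinity>"
    using fin unfolding E_def by (rule le_less_trans)
  have "(\<integral>\<^sup>+x. ennreal ((norm (f x))\<^sup>2) \<partial>lborel) \<le> (\<integral>\<^sup>+x. ennreal (4 * (norm x * G x)\<^sup>2) \<partial>lborel)"
  proof (rule hardy_inequality[OF cont(2) contG _ _ _ finP])
    show "\<exists>d. ((\<lambda>s. (norm (f (s *\<^sub>R x)))\<^sup>2) has_real_derivative d) (at s) \<and>
        \<bar>d\<bar> \<le> 2 * norm (f (s *\<^sub>R x)) * (norm x * G (s *\<^sub>R x))" for x s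
      using ray_derivative_bound[OF A C1, of x s] by (simp add: f_def G_def c_def)
  qed (use p in \<open>auto simp: G_def L2_set_nonneg\<close>)
  also have "\<dots> \<le> (\<integral>\<^sup>+x. 4 * ennreal (e1 x) \<partial>lborel)"
  proof (rule nn_integral_mono)
    fix x
    have "(norm x * G x)\<^sup>2 \<le> e1 x"
      using weight(2)[of "(G x)\<^sup>2" x] by (simp add: e1_def power_mult_distrib distrib_left add_increasing2)
    then have "ennreal (4 * (norm x * G x)\<^sup>2) \<le> ennreal (4 * e1 x)"
      by (intro ennreal_leI) simp
    then show "ennreal (4 * (norm x * G x)\<^sup>2) \<le> 4 * ennreal (e1 x)"
      by (simp add: ennreal_mult')
  qed
  also have "\<dots> = 4 * (\<integral>\<^sup>+x. ennreal (e1 x) \<partial>lborel)"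
    by (rule nn_integral_cmult) simp
  also have "\<dots> \<le> 4 * E"
    unfolding E by (intro mult_left_mono) auto
  finally have hardy: "(\<integral>\<^sup>+x. ennreal ((norm (f x))\<^sup>2) \<partial>lborel) \<le> 4 * E" .
  have "(\<integral>\<^sup>+x. ennreal (flux_density p A \<phi> 0 x) \<partial>lborel) =
      (\<integral>\<^sup>+x. ennreal (e1 x) + ennreal (e2 x) + ennreal ((norm (f x))\<^sup>2) \<partial>lborel)"
    by (intro nn_integral_cong)
      (simp add: flux_density_def sum_spacetime e1_def e2_def G2 c_def f_def algebra_simps
        flip: ennreal_plus)
  also have "\<dots> = E + (\<integral>\<^sup>+x. ennreal ((norm (f x))\<^sup>2) \<partial>lborel)"
    unfolding E by (simp add: nn_integral_add)
  also have "\<dots> \<le> E + 4 * E" using hardy by (intro add_left_mono)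
  also have "\<dots> = (1 + 4) * E" by (simp only: distrib_right mult_1)
  finally show ?thesis by (simp add: E_def)
qed

section \<open>Decay of the potential energy\<close>

text \<open>
  A single bound by \<open>flux_density\<close> makes the error at spatial infinity vanish and, at time zero,
  bounds the current by the energy of the data. Both ranges of \<open>p\<close> are treated by exhibiting a
  suitable current \<open>J\<close>.
\<close>

lemma solution_current_inequality:
  assumes p: "1 < p" and sol: "CSH_solution p A \<phi>" and data: "has_initial_data A \<phi> \<phi>\<^sub>0 \<phi>\<^sub>1"
    and fin: "weighted_energy p 0 2 (initial_connection A) \<phi>\<^sub>0 \<phi>\<^sub>1 < \<infinity>"
    and C1: "\<And>\<mu>. C1_future (J \<mu>)"
    and div: "\<And>z. 0 < z $ 0 \<Longrightarrow> (\<Sum>\<mu>\<in>UNIV. partial \<mu> (J \<mu>) z) \<le> 0"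
    and J: "\<And>z. z \<in> future \<Longrightarrow> 0 \<le> J 0 z"
    and J_le: "\<And>\<mu> s x. 0 \<le> s \<Longrightarrow> \<bar>J \<mu> (event s x)\<bar> \<le> 16 * (1 + s)\<^sup>2 * flux_density p A \<phi> s x"
    and t: "0 \<le> t"
  shows "(\<integral>\<^sup>+x. ennreal (J 0 (event t x)) \<partial>lborel) \<le>
    80 * weighted_energy p 0 2 (initial_connection A) \<phi>\<^sub>0 \<phi>\<^sub>1"
proof -
  have A: "\<And>\<mu>. C1_future (A \<mu>)" and \<phi>: "C2_future \<phi>" and decay: "decays_at_spatial_infinity p A \<phi>"
    using sol by (auto simp: CSH_solution_def)
  have flux_nonneg: "0 \<le> flux_density p A \<phi> s x" for s x
    by (auto simp: flux_density_def intro!: add_nonneg_nonneg mult_nonneg_nonneg sum_nonneg)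
  have "(\<integral>\<^sup>+x. ennreal (J 0 (event t x)) \<partial>lborel) \<le> (\<integral>\<^sup>+x. ennreal (J 0 (event 0 x)) \<partial>lborel)"
  proof (cases "t = 0")
    case False
    then have "0 < t" using t by simp
    show ?thesis
    proof (rule current_inequality[where K = "16 * (1 + t)\<^sup>2" and w = "flux_density p A \<phi>"])
      show "0 \<le> 16 * (1 + t)\<^sup>2" by simp
      show "\<bar>J (spacetime_index i) (event s x)\<bar> \<le> 16 * (1 + t)\<^sup>2 * flux_density p A \<phi> s x"
        if "0 \<le> s" "s \<le> t" for s x i
      proof -
        have "16 * (1 + s)\<^sup>2 * flux_density p A \<phi> s x \<le> 16 * (1 + t)\<^sup>2 * flux_density p A \<phi> s x"
          using that flux_nonneg by (intro mult_right_mono mult_left_mono power_mono) auto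
        then show ?thesis using J_le[OF that(1)] order_trans by blast
      qed
      show "((\<lambda>R. (\<integral>\<^sup>+s\<in>{0..t}. (\<integral>\<^sup>+x\<in>{x. R \<le> norm x \<and> norm x \<le> 2 * R}.
          ennreal (flux_density p A \<phi> s x) \<partial>lborel) \<partial>lborel) / ennreal R) \<longlongrightarrow> 0) at_top"
        using decay \<open>0 < t\<close> unfolding decays_at_spatial_infinity_def by blast
    qed (fact C1 div J \<open>0 < t\<close> continuous_on_flux_density[OF p A \<phi>])+
  qed simp
  also have "\<dots> \<le> (\<integral>\<^sup>+x. 16 * ennreal (flux_density p A \<phi> 0 x) \<partial>lborel)"
  proof (rule nn_integral_mono)
    fix x
    have "ennreal (J 0 (event 0 x)) \<le> ennreal (16 * flux_density p A \<phi> 0 x)"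
      using J_le[of 0 0 x] by (intro ennreal_leI) simp
    then show "ennreal (J 0 (event 0 x)) \<le> 16 * ennreal (flux_density p A \<phi> 0 x)"
      by (simp add: ennreal_mult')
  qed
  also have "\<dots> = 16 * (\<integral>\<^sup>+x. ennreal (flux_density p A \<phi> 0 x) \<partial>lborel)"
  proof (rule nn_integral_cmult)
    have "continuous_on UNIV (\<lambda>x. flux_density p A \<phi> 0 x)"
      using continuous_on_compose2[OF continuous_on_flux_density[of p A \<phi>, OF p A \<phi>]
          continuous_on_Pair[OF continuous_on_const continuous_on_id], of 0 UNIV] by auto
    then have [measurable]: "(\<lambda>x. flux_density p A \<phi> 0 x) \<in> borel_measurable borel"
      by (rule borel_measurable_continuous_onI)
    show "(\<lambda>x. ennreal (flux_density p A \<phi> 0 x)) \<in> borel_measurable lborel" by measurable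
  qed
  also have "\<dots> \<le> 16 * (5 * weighted_energy p 0 2 (initial_connection A) \<phi>\<^sub>0 \<phi>\<^sub>1)"
    by (intro mult_left_mono initial_flux_density_le_energy[OF p A \<phi> data fin]) simp
  finally show ?thesis by (simp add: mult.assoc[symmetric])
qed

lemma time_weight_has_derivative:
  "((\<lambda>u. (1 + (max 0 u)\<^sup>2) powr (- k)) has_real_derivative
    - 2 * k * max 0 u * (1 + (max 0 u)\<^sup>2) powr (- k - 1)) (at u)" for u k :: real
proof -
  have "0 < 1 + (max 0 u)\<^sup>2" by (simp add: add_pos_nonneg)
  moreover have "((\<lambda>u. 1 + (max 0 u)\<^sup>2) has_real_derivative 2 * max 0 u) (at u)"
    using DERIV_add[OF DERIV_const positive_part_square_has_derivative] by simp
  ultimately show ?thesis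
    using DERIV_fun_powr[of "\<lambda>u. 1 + (max 0 u)\<^sup>2" "2 * max 0 u" u "- k"] by (simp add: mult_ac)
qed

text \<open>
  The conformal current has divergence \<open>(5 - p) u Q\<close>, which is positive in the future
  \<open>u > 0\<close> of the null plane \<open>u = 0\<close>. There the current is multiplied by
  \<open>g = (1 + u^2) powr (- (5 - p) / 4)\<close>: the flux through \<open>u = const\<close> contributes at most
  \<open>2 (1 + u^2) g' Q = - (5 - p) u g Q\<close>, which exactly compensates for the divergence. For
  \<open>u \<le> 0\<close> the divergence has the good sign, and the constant weight \<open>1\<close> continues \<open>g\<close> in a
  continuously differentiable way. On the half plane \<open>\<sigma> x_1 \<le> 0\<close> one has \<open>u \<ge> t\<close>, so the
  weighted density there is at least \<open>(1 + t^2) powr (1 - (5 - p) / 4) Q\<close>.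
\<close>

lemma potential_decay_subconformal:
  assumes p: "1 < p" "p < 5" and \<sigma>: "\<sigma> = 1 \<or> \<sigma> = - 1"
    and sol: "CSH_solution p A \<phi>" and data: "has_initial_data A \<phi> \<phi>\<^sub>0 \<phi>\<^sub>1"
    and fin: "weighted_energy p 0 2 (initial_connection A) \<phi>\<^sub>0 \<phi>\<^sub>1 < \<infinity>"
    and t: "0 \<le> t"
  shows "(\<integral>\<^sup>+x\<in>{x. \<sigma> * x $ 1 \<le> 0}. ennreal ((1 + t\<^sup>2) powr ((p - 1) / 4) * potential p \<phi> (event t x)) \<partial>lborel) \<le>
    80 * weighted_energy p 0 2 (initial_connection A) \<phi>\<^sub>0 \<phi>\<^sub>1"
proof -
  have A: "\<And>\<mu>. C1_future (A \<mu>)" and \<phi>: "C2_future \<phi>" and eq: "CSH_equations p A \<phi>"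
    using sol by (auto simp: CSH_solution_def)
  define k where "k = (5 - p) / 4"
  have k: "0 < k" "4 * k = 5 - p" "1 - k = (p - 1) / 4" using p by (simp_all add: k_def diff_divide_distrib)
  define g where "g u = (1 + (max 0 u)\<^sup>2) powr (- k)" for u :: real
  define g' where "g' u = - 2 * k * max 0 u * (1 + (max 0 u)\<^sup>2) powr (- k - 1)" for u :: real
  define C where "C = conformal_current p A \<sigma> \<phi>"
  define J where "J \<mu> z = g (null_time \<sigma> z) * C \<mu> z" for \<mu> z
  have base: "1 \<le> 1 + (max 0 u)\<^sup>2" for u :: real by simp
  have g: "0 \<le> g u" "g u \<le> 1" for u
    using k(1) base[of u] powr_mono[of "- k" 0 "1 + (max 0 u)\<^sup>2"]
    by (auto simp: g_def add_nonneg_eq_0_iff split: if_splits)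
  have dg: "(g has_derivative (\<lambda>h. g' u * h)) (at u)" for u
    using time_weight_has_derivative[of k u] unfolding g_def[abs_def] g'_def has_field_derivative_def .
  have cont_g': "continuous_on UNIV g'"
    unfolding g'_def by (intro continuous_intros) (auto simp: add_nonneg_eq_0_iff)
  have g'_cont: "continuous_on future (\<lambda>z. g' (null_time \<sigma> z) * partial \<mu> (null_time \<sigma>) z)" for \<mu>
    using C1_future_null_time[of \<sigma>]
    by (intro continuous_intros continuous_on_compose2[OF cont_g'] C1_future_continuous_partial C1_future_continuous) auto
  note C1_g = C1_future_compose(1)[OF dg C1_future_null_time g'_cont]
  note partial_g = C1_future_compose(2)[OF dg C1_future_null_time g'_cont]
  have C1_C: "C1_future (C \<mu>)" for \<mu>
    unfolding C_def by (rule C1_future_conformal_current[OF p(1) \<sigma> A \<phi>])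
  have Q: "0 \<le> potential p \<phi> z" for z using p by (simp add: potential_nonneg)
  have C_ge: "(1 + (null_time \<sigma> z)\<^sup>2 + (z $ 2)\<^sup>2) * potential p \<phi> z \<le> C 0 z" for z
    unfolding C_def by (rule conformal_current_density_ge)
  have C0: "0 \<le> C 0 z" for z
    using abs_conformal_current_le[of p \<sigma> A \<phi> 0 z] p \<sigma> unfolding C_def by linarith
  have "(\<integral>\<^sup>+x. ennreal (J 0 (event t x)) \<partial>lborel) \<le>
    80 * weighted_energy p 0 2 (initial_connection A) \<phi>\<^sub>0 \<phi>\<^sub>1"
  proof (rule solution_current_inequality[OF p(1) sol data fin _ _ _ _ t])
    show "C1_future (J \<mu>)" for \<mu>
      unfolding J_def[abs_def] by (intro C1_future_mult C1_g C1_C)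
    show "0 \<le> J 0 z" for z using g C0 by (simp add: J_def)
    show "\<bar>J \<mu> (event s x)\<bar> \<le> 16 * (1 + s)\<^sup>2 * flux_density p A \<phi> s x" if "0 \<le> s" for \<mu> s x
    proof -
      have "\<bar>J \<mu> (event s x)\<bar> \<le> 1 * C 0 (event s x)"
        unfolding J_def abs_mult using g p \<sigma> abs_conformal_current_le[of p \<sigma> A \<phi> \<mu>]
        by (intro mult_mono) (auto simp: C_def)
      also have "\<dots> \<le> 8 * (1 + s)\<^sup>2 * flux_density p A \<phi> s x"
        using conformal_current_density_le[OF p(1) \<sigma> that] by (simp add: C_def)
      finally show ?thesis by linarith
    qed
    show "(\<Sum>\<mu>\<in>UNIV. partial \<mu> (J \<mu>) z) \<le> 0" if z: "0 < z $ 0" for z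
    proof -
      define u where "u = null_time \<sigma> z"
      have fut: "z \<in> future" using z by (rule future_interior)
      have "partial \<mu> (J \<mu>) z = g u * partial \<mu> (C \<mu>) z + g' u * partial \<mu> (null_time \<sigma>) z * C \<mu> z" for \<mu>
        unfolding J_def[abs_def] u_def using fut by (simp add: partial_mult C1_g C1_C partial_g)
      then have "(\<Sum>\<mu>\<in>UNIV. partial \<mu> (J \<mu>) z) =
          g u * (\<Sum>\<mu>\<in>UNIV. partial \<mu> (C \<mu>) z) + g' u * (C 0 z - \<sigma> * C 1 z)"
        using fut by (simp add: sum_spacetime partial_null_time algebra_simps)
      also have "\<dots> = g u * ((5 - p) * u * potential p \<phi> z) + g' u * (C 0 z - \<sigma> * C 1 z)"
        using divergence_conformal_current[OF p(1) \<sigma> A \<phi> eq z] by (simp add: C_def u_def)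
      also have "\<dots> \<le> 0"
      proof (cases "0 < u")
        case False
        then have "g' u = 0" "(5 - p) * u \<le> 0"
          using p by (auto simp: g'_def max_def mult_nonneg_nonpos)
        then show ?thesis
          using mult_nonneg_nonpos[OF g(1)[of u] mult_nonpos_nonneg[OF _ Q[of z]], of "(5 - p) * u"] by simp
      next
        case True
        have "g' u \<le> 0"
          using True k(1) by (simp add: g'_def mult_nonneg_nonneg)
        then have "g' u * (C 0 z - \<sigma> * C 1 z) \<le> g' u * (2 * (1 + u\<^sup>2) * potential p \<phi> z)"
          using conformal_current_null_flux_ge[OF \<sigma>] unfolding C_def u_def
          by (intro mult_left_mono_neg)
        also have "\<dots> = - (4 * k) * u * ((1 + u\<^sup>2) powr (- k - 1) * (1 + u\<^sup>2)) * potential p \<phi> z"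
          using True by (simp add: g'_def)
        also have "(1 + u\<^sup>2) powr (- k - 1) * (1 + u\<^sup>2) = g u"
          using True powr_add[of "1 + u\<^sup>2" "- k - 1" 1] base[of u] by (simp add: g_def)
        finally show ?thesis unfolding k(2) by (simp add: algebra_simps)
      qed
      finally show ?thesis .
    qed
  qed
  moreover have "(\<integral>\<^sup>+x\<in>{x. \<sigma> * x $ 1 \<le> 0}. ennreal ((1 + t\<^sup>2) powr ((p - 1) / 4) * potential p \<phi> (event t x)) \<partial>lborel) \<le>
      (\<integral>\<^sup>+x. ennreal (J 0 (event t x)) \<partial>lborel)"
  proof (rule nn_integral_mono)
    fix x :: "real^2"
    define u where "u = null_time \<sigma> (event t x)"
    have "(1 + t\<^sup>2) powr ((p - 1) / 4) * potential p \<phi> (event t x) \<le> J 0 (event t x)" if "\<sigma> * x $ 1 \<le> 0"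
    proof -
      have u: "t \<le> u" using that by (simp add: u_def null_time_def)
      have "(1 + t\<^sup>2) powr ((p - 1) / 4) \<le> (1 + u\<^sup>2) powr ((p - 1) / 4)"
        using u t p by (intro powr_mono2) (auto intro: power_mono)
      also have "\<dots> = g u * (1 + u\<^sup>2)"
        using u t powr_add[of "1 + u\<^sup>2" "- k" 1] base[of u] k(3) by (simp add: g_def max_def)
      finally have "(1 + t\<^sup>2) powr ((p - 1) / 4) * potential p \<phi> (event t x) \<le>
          g u * (1 + u\<^sup>2) * potential p \<phi> (event t x)"
        using Q by (intro mult_right_mono)
      also have "\<dots> \<le> g u * C 0 (event t x)"
      proof -
        have "(1 + u\<^sup>2) * potential p \<phi> (event t x) \<le> (1 + u\<^sup>2 + (x $ 2)\<^sup>2) * potential p \<phi> (event t x)"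
          using Q by (intro mult_right_mono) auto
        also have "\<dots> \<le> C 0 (event t x)" using C_ge[of "event t x"] by (simp add: u_def)
        finally show ?thesis using g(1)[of u] by (simp add: mult.assoc mult_left_mono)
      qed
      finally show ?thesis by (simp add: J_def u_def)
    qed
    then show "ennreal ((1 + t\<^sup>2) powr ((p - 1) / 4) * potential p \<phi> (event t x)) * indicator {x. \<sigma> * x $ 1 \<le> 0} x \<le>
        ennreal (J 0 (event t x))"
      by (auto simp: indicator_def intro: ennreal_leI)
  qed
  ultimately show ?thesis by (rule order_trans[rotated])
qed

text \<open>
  The sum of the two conformal currents for \<open>\<sigma> = 1\<close> and \<open>\<sigma> = - 1\<close> is, up to a divergence free
  part, twice the current of the field \<open>(1 + t^2 + |x|^2) \<partial>_t + 2 t x \<cdot> \<nabla>\<close>, Morawetz's conformal field plus \<open>\<partial>_t\<close>. Its divergence is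
  \<open>2 (5 - p) t Q \<le> 0\<close>, and its density grows like \<open>t^2\<close> everywhere, not only on a half plane.
\<close>

lemma potential_decay_superconformal:
  assumes p: "5 \<le> p"
    and sol: "CSH_solution p A \<phi>" and data: "has_initial_data A \<phi> \<phi>\<^sub>0 \<phi>\<^sub>1"
    and fin: "weighted_energy p 0 2 (initial_connection A) \<phi>\<^sub>0 \<phi>\<^sub>1 < \<infinity>"
    and t: "0 \<le> t"
  shows "(\<integral>\<^sup>+x. ennreal ((1 + t\<^sup>2) * potential p \<phi> (event t x)) \<partial>lborel) \<le>
    80 * weighted_energy p 0 2 (initial_connection A) \<phi>\<^sub>0 \<phi>\<^sub>1"
proof -
  have A: "\<And>\<mu>. C1_future (A \<mu>)" and \<phi>: "C2_future \<phi>" and eq: "CSH_equations p A \<phi>"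
    using sol by (auto simp: CSH_solution_def)
  have p1: "1 < p" using p by simp
  define C where "C \<sigma> = conformal_current p A \<sigma> \<phi>" for \<sigma>
  define J where "J \<mu> z = C 1 \<mu> z + C (- 1) \<mu> z" for \<mu> z
  have C1_C: "C1_future (C 1 \<mu>)" "C1_future (C (- 1) \<mu>)" for \<mu>
    unfolding C_def by (rule C1_future_conformal_current[OF p1 _ A \<phi>]; simp)+
  have Q: "0 \<le> potential p \<phi> z" for z using p by (simp add: potential_nonneg)
  have abs_C: "\<bar>C 1 \<mu> z\<bar> \<le> C 1 0 z" "\<bar>C (- 1) \<mu> z\<bar> \<le> C (- 1) 0 z" for \<mu> z
    unfolding C_def using p by (auto intro!: abs_conformal_current_le)
  have "(\<integral>\<^sup>+x. ennreal (J 0 (event t x)) \<partial>lborel) \<le>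
    80 * weighted_energy p 0 2 (initial_connection A) \<phi>\<^sub>0 \<phi>\<^sub>1"
  proof (rule solution_current_inequality[OF p1 sol data fin _ _ _ _ t])
    show "C1_future (J \<mu>)" for \<mu>
      unfolding J_def[abs_def] by (intro C1_future_add C1_C)
    show "0 \<le> J 0 z" for z using abs_C[of 0 z] unfolding J_def by linarith
    show "\<bar>J \<mu> (event s x)\<bar> \<le> 16 * (1 + s)\<^sup>2 * flux_density p A \<phi> s x" if "0 \<le> s" for \<mu> s x
      using abs_C[of \<mu> "event s x"] conformal_current_density_le[OF p1 _ that, of 1 A \<phi> x]
        conformal_current_density_le[OF p1 _ that, of "- 1" A \<phi> x]
      unfolding J_def C_def by simp
    show "(\<Sum>\<mu>\<in>UNIV. partial \<mu> (J \<mu>) z) \<le> 0" if z: "0 < z $ 0" for z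
    proof -
      have "(\<Sum>\<mu>\<in>UNIV. partial \<mu> (J \<mu>) z) =
          (\<Sum>\<mu>\<in>UNIV. partial \<mu> (C 1 \<mu>) z) + (\<Sum>\<mu>\<in>UNIV. partial \<mu> (C (- 1) \<mu>) z)"
        unfolding J_def[abs_def] sum.distrib[symmetric]
        by (intro sum.cong refl partial_add C1_C future_interior z)
      also have "\<dots> = (5 - p) * (2 * z $ 0 * potential p \<phi> z)"
        using divergence_conformal_current[OF p1 _ A \<phi> eq z, of 1]
          divergence_conformal_current[OF p1 _ A \<phi> eq z, of "- 1"]
        by (simp add: C_def null_time_def algebra_simps)
      also have "\<dots> \<le> 0"
        using p z Q[of z] by (intro mult_nonpos_nonneg mult_nonneg_nonneg) auto
      finally show ?thesis .
    qed
  qed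
  moreover have "(\<integral>\<^sup>+x. ennreal ((1 + t\<^sup>2) * potential p \<phi> (event t x)) \<partial>lborel) \<le>
      (\<integral>\<^sup>+x. ennreal (J 0 (event t x)) \<partial>lborel)"
  proof (intro nn_integral_mono ennreal_leI)
    fix x :: "real^2"
    let ?z = "event t x"
    have "1 + t\<^sup>2 \<le> (1 + (null_time 1 ?z)\<^sup>2 + (?z $ 2)\<^sup>2) + (1 + (null_time (- 1) ?z)\<^sup>2 + (?z $ 2)\<^sup>2)"
      by (simp add: null_time_def power2_eq_square algebra_simps)
    then have "(1 + t\<^sup>2) * potential p \<phi> ?z \<le> (1 + (null_time 1 ?z)\<^sup>2 + (?z $ 2)\<^sup>2) * potential p \<phi> ?z +
        (1 + (null_time (- 1) ?z)\<^sup>2 + (?z $ 2)\<^sup>2) * potential p \<phi> ?z"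
      unfolding distrib_right[symmetric] using Q by (rule mult_right_mono)
    also have "\<dots> \<le> J 0 ?z"
      unfolding J_def C_def by (intro add_mono conformal_current_density_ge)
    finally show "(1 + t\<^sup>2) * potential p \<phi> ?z \<le> J 0 ?z" .
  qed
  ultimately show ?thesis by (rule order_trans[rotated])
qed

text \<open>
  For \<open>p < 5\<close> the two signs of \<open>\<sigma>\<close> cover the two half planes \<open>x_1 \<le> 0\<close> and \<open>x_1 \<ge> 0\<close>.
\<close>

lemma potential_decay:
  assumes p: "1 < p"
    and sol: "CSH_solution p A \<phi>" and data: "has_initial_data A \<phi> \<phi>\<^sub>0 \<phi>\<^sub>1"
    and fin: "weighted_energy p 0 2 (initial_connection A) \<phi>\<^sub>0 \<phi>\<^sub>1 < \<infinity>"
    and t: "0 \<le> t"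
  shows "(\<integral>\<^sup>+x. ennreal ((1 + t\<^sup>2) powr min ((p - 1) / 4) 1 * potential p \<phi> (event t x)) \<partial>lborel) \<le>
    160 * weighted_energy p 0 2 (initial_connection A) \<phi>\<^sub>0 \<phi>\<^sub>1"
    (is "integral\<^sup>N lborel ?P \<le> 160 * ?E")
proof (cases "p < 5")
  case True
  then have m: "min ((p - 1) / 4) 1 = (p - 1) / 4" by simp
  have "C1_future \<phi>" using sol by (simp add: CSH_solution_def C2_future_def)
  then have "continuous_on UNIV (\<lambda>x. \<phi> (event t x))"
    using t by (intro continuous_on_slice C1_future_continuous)
  then have [measurable]: "(\<lambda>x. \<phi> (event t x)) \<in> borel_measurable borel"
    by (rule borel_measurable_continuous_onI)
  have P [measurable]: "?P \<in> borel_measurable lborel"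
    unfolding potential_def by measurable
  have H: "{x :: real^2. \<sigma> * x $ 1 \<le> 0} \<in> sets lborel" for \<sigma> :: real
    using closed_Collect_le[of "\<lambda>x :: real^2. \<sigma> * x $ 1" "\<lambda>x. 0"]
    by (auto intro!: borel_closed continuous_intros)
  have "integral\<^sup>N lborel ?P \<le> (\<integral>\<^sup>+x. ?P x * indicator {x. 1 * x $ 1 \<le> 0} x +
      ?P x * indicator {x. - 1 * x $ 1 \<le> 0} x \<partial>lborel)"
    by (intro nn_integral_mono) (auto simp: indicator_def)
  also have "\<dots> = (\<integral>\<^sup>+x\<in>{x. 1 * x $ 1 \<le> 0}. ?P x \<partial>lborel) + (\<integral>\<^sup>+x\<in>{x. - 1 * x $ 1 \<le> 0}. ?P x \<partial>lborel)"
    using P H[of 1] H[of "- 1"]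
    by (intro nn_integral_add borel_measurable_times_ennreal borel_measurable_indicator)
  also have "\<dots> \<le> 80 * ?E + 80 * ?E"
    unfolding m using p True sol data fin t
    by (intro add_mono potential_decay_subconformal) auto
  also have "\<dots> = (80 + 80) * ?E" by (simp only: distrib_right)
  finally show ?thesis by simp
next
  case False
  then have m: "min ((p - 1) / 4) 1 = 1" by simp
  have "(1 + t\<^sup>2) powr 1 = 1 + t\<^sup>2" by (rule powr_one) simp
  then have "integral\<^sup>N lborel ?P \<le> 80 * ?E"
    unfolding m using potential_decay_superconformal[OF _ sol data fin t] False by simp
  also have "\<dots> \<le> 160 * ?E" by (intro mult_right_mono) simp_all
  finally show ?thesis .
qed

theorem theorem1:
  fixes p :: real
  assumes "1 < p"
  shows "\<exists>C::real. 0 < C \<and>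
    (\<forall>(A :: connection) (\<phi> :: real^3 \<Rightarrow> complex) (\<phi>\<^sub>0 :: real^2 \<Rightarrow> complex) (\<phi>\<^sub>1 :: real^2 \<Rightarrow> complex).
      CSH_solution p A \<phi> \<longrightarrow>
      has_initial_data A \<phi> \<phi>\<^sub>0 \<phi>\<^sub>1 \<longrightarrow>
      weighted_energy p 0 2 (initial_connection A) \<phi>\<^sub>0 \<phi>\<^sub>1 < \<infinity> \<longrightarrow>
      (\<forall>t\<ge>0. (\<integral>\<^sup>+x. ennreal (norm (\<phi> (event t x)) powr (p + 1)) \<partial>lborel)
        \<le> ennreal C * weighted_energy p 0 2 (initial_connection A) \<phi>\<^sub>0 \<phi>\<^sub>1 *
          ennreal ((1 + t) powr (- min ((p - 1) / 2) 2))))"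
proof (intro exI[of _ "320 * (p + 1)"] conjI allI impI)
  show "0 < 320 * (p + 1)" using assms by simp
  fix A :: connection and \<phi> :: "real^3 \<Rightarrow> complex" and \<phi>\<^sub>0 \<phi>\<^sub>1 :: "real^2 \<Rightarrow> complex" and t :: real
  assume sol: "CSH_solution p A \<phi>" and data: "has_initial_data A \<phi> \<phi>\<^sub>0 \<phi>\<^sub>1"
    and fin: "weighted_energy p 0 2 (initial_connection A) \<phi>\<^sub>0 \<phi>\<^sub>1 < \<infinity>" and t: "0 \<le> t"
  let ?E = "weighted_energy p 0 2 (initial_connection A) \<phi>\<^sub>0 \<phi>\<^sub>1"
  define \<theta> where "\<theta> = min ((p - 1) / 4) 1"
  have \<theta>: "0 \<le> \<theta>" "\<theta> \<le> 1" "min ((p - 1) / 2) 2 = 2 * \<theta>"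
    using assms by (auto simp: \<theta>_def min_def)
  define c where "c = 2 * (p + 1) * (1 + t) powr (- (2 * \<theta>))"
  have c: "0 \<le> c" using assms by (simp add: c_def)
  \<comment> \<open>The weight \<open>(1 + t^2) powr \<theta>\<close> is comparable to \<open>(1 + t) powr (2 \<theta>)\<close>, with the factor \<open>2 powr \<theta> \<le> 2\<close>.\<close>
  have ratio: "1 \<le> 2 * (1 + t) powr (- (2 * \<theta>)) * (1 + t\<^sup>2) powr \<theta>"
  proof -
    have "(1 + t) powr (2 * \<theta>) = ((1 + t)\<^sup>2) powr \<theta>"
      using t powr_powr[of "1 + t" 2 \<theta>] by (simp add: powr_numeral)
    also have "\<dots> \<le> (2 * (1 + t\<^sup>2)) powr \<theta>"
      using \<theta> t sum_squares_bound[of 1 t] by (intro powr_mono2) (auto simp: power2_eq_square algebra_simps)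
    also have "\<dots> = 2 powr \<theta> * (1 + t\<^sup>2) powr \<theta>"
      by (rule powr_mult)
    also have "\<dots> \<le> 2 * (1 + t\<^sup>2) powr \<theta>"
      using \<theta> powr_mono[of \<theta> 1 2] by (intro mult_right_mono) auto
    finally have "(1 + t) powr (- (2 * \<theta>)) * (1 + t) powr (2 * \<theta>) \<le>
        (1 + t) powr (- (2 * \<theta>)) * (2 * (1 + t\<^sup>2) powr \<theta>)"
      by (intro mult_left_mono) auto
    then show ?thesis using t by (simp add: powr_minus field_simps)
  qed
  have C1: "C1_future \<phi>" using sol by (simp add: CSH_solution_def C2_future_def)
  then have "continuous_on UNIV (\<lambda>x. \<phi> (event t x))"
    using t by (intro continuous_on_slice C1_future_continuous)
  then have [measurable]: "(\<lambda>x. \<phi> (event t x)) \<in> borel_measurable borel"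
    by (rule borel_measurable_continuous_onI)
  have meas: "(\<lambda>x. ennreal ((1 + t\<^sup>2) powr \<theta> * potential p \<phi> (event t x))) \<in> borel_measurable lborel"
    unfolding potential_def by measurable
  have "(\<integral>\<^sup>+x. ennreal (norm (\<phi> (event t x)) powr (p + 1)) \<partial>lborel) \<le>
      (\<integral>\<^sup>+x. ennreal c * ennreal ((1 + t\<^sup>2) powr \<theta> * potential p \<phi> (event t x)) \<partial>lborel)"
  proof (rule nn_integral_mono)
    fix x
    have "norm (\<phi> (event t x)) powr (p + 1) = 1 * ((p + 1) * potential p \<phi> (event t x))"
      using assms by (simp add: potential_def)
    also have "\<dots> \<le> (2 * (1 + t) powr (- (2 * \<theta>)) * (1 + t\<^sup>2) powr \<theta>) * ((p + 1) * potential p \<phi> (event t x))"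
      using assms by (intro mult_right_mono ratio mult_nonneg_nonneg potential_nonneg) auto
    also have "\<dots> = c * ((1 + t\<^sup>2) powr \<theta> * potential p \<phi> (event t x))"
      by (simp add: c_def mult_ac)
    finally show "ennreal (norm (\<phi> (event t x)) powr (p + 1)) \<le>
        ennreal c * ennreal ((1 + t\<^sup>2) powr \<theta> * potential p \<phi> (event t x))"
      using c by (metis ennreal_leI ennreal_mult')
  qed
  also have "\<dots> = ennreal c * (\<integral>\<^sup>+x. ennreal ((1 + t\<^sup>2) powr \<theta> * potential p \<phi> (event t x)) \<partial>lborel)"
    by (rule nn_integral_cmult[OF meas])
  also have "\<dots> \<le> ennreal c * (160 * ?E)"
    unfolding \<theta>_def by (intro mult_left_mono potential_decay[OF assms sol data fin t]) simp
  also have "\<dots> = ennreal (320 * (p + 1)) * ?E * ennreal ((1 + t) powr (- min ((p - 1) / 2) 2))"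
  proof -
    have "ennreal c * 160 = ennreal (c * 160)" using c by (simp add: ennreal_mult)
    also have "c * 160 = 320 * (p + 1) * (1 + t) powr (- min ((p - 1) / 2) 2)"
      by (simp add: c_def \<theta>(3))
    also have "ennreal \<dots> = ennreal (320 * (p + 1)) * ennreal ((1 + t) powr (- min ((p - 1) / 2) 2))"
      using assms by (simp add: ennreal_mult)
    finally show ?thesis unfolding mult.assoc[symmetric] by (simp only: mult_ac)
  qed
  finally show "(\<integral>\<^sup>+x. ennreal (norm (\<phi> (event t x)) powr (p + 1)) \<partial>lborel) \<le>
      ennreal (320 * (p + 1)) * ?E * ennreal ((1 + t) powr (- min ((p - 1) / 2) 2))" .
qed

end
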